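(* Let $\{P_j(x,D)\}_{j=1}^N$, $P_j(x,D)=\sum_{|\alpha|\le l}a_{j\alpha}(x)D^\alpha$, be a system of differential operators of order $l$ on $\mathbb R^n$ with $L^\infty(\mathbb R^n)$ coefficients such that the principal parts of the operators $P_j(x,D)$ have constant coefficients: $P_j^l(x,D)\equiv P_j^l(D)$. Let $p\in(1,\infty]$ (or $p\in[1,\infty]$ in the case of constant coefficients). Then the system $\{P_j(x,D)\}_1^N$ is elliptic if and only if it is a system of principal type in $L^p(\mathbb R^n)$.
   Context: Notation: $D_k=-i\,\partial/\partial x_k$, $P_j^l(x,D)=\sum_{|\alpha|=l}a_{j\alpha}(x)D^\alpha$ (principal part), with symbol $P_j^l(\xi)$ when its coefficients are constant. The system is elliptic if $(P_1^l(\xi),\dots,P_N^l(\xi))\neq0$ for all $\xi\in\mathbb R^n\setminus\{0\}$. For a domain $\Omega\subset\mathbb R^n$ and $p\in[1,\infty]$, $L^0_{p,\Omega}(P_1,\dots,P_N)$ denotes the space of all differential operators $Q(x,D)$ for which there are constants $C_1,C_2$ with $\|Q(x,D)f\|_{L^p(\Omega)}\le C_1\sum_{j=1}^N\|P_j(x,D)f\|_{L^p(\Omega)}+C_2\|f\|_{L^p(\Omega)}$ for all $f\in C_0^\infty(\Omega)$. A system $\{P_j(x,D)\}_1^N$ with $L^\infty(\Omega)$ coefficients is a system of principal type in $L^p(\Omega)$ if $L^0_{p,\Omega}(P_1,\dots,P_N)=L^0_{p,\Omega}(R_1,\dots,R_N)$ for every system $\{R_j(x,D)\}_1^N$ with $L^\infty(\Omega)$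 coefficients and the same principal part.
   Formalization: The order is assumed to satisfy l ≥ 2: for l = 1 lower-order terms are bounded multiplications absorbed by C_2‖f‖, so every system is of principal type (e.g. D_1 on R^2, which is not elliptic), and for l = 0 the zero system is a counterexample. *)

theory Defs
  imports "HOL-Analysis.Analysis" "HOL-Probability.Essential_Supremum"
begin

definition partial :: "'n \<Rightarrow> (real^'n \<Rightarrow> complex) \<Rightarrow> real^'n \<Rightarrow> complex" where
  "partial k f x = vector_derivative (\<lambda>t. f (x + t *\<^sub>R axis k 1)) (at 0)"

text \<open>The operator \<open>D\<^sub>k = -i \<partial>/\<partial>x\<^sub>k\<close>.\<close>

definition Dk :: "'n \<Rightarrow> (real^'n \<Rightarrow> complex) \<Rightarrow> real^'n \<Rightarrow> complex" where
  "Dk k f = (\<lambda>x. - \<i> * partial k f x)"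

definition smooth :: "(real^'n \<Rightarrow> complex) \<Rightarrow> bool" where
  "smooth f \<longleftrightarrow> (\<forall>ks :: 'n list. \<forall>x. foldr partial ks f differentiable (at x))"

definition test_functions :: "(real^'n) set \<Rightarrow> (real^'n \<Rightarrow> complex) set" where
  "test_functions \<Omega> =
     {f. smooth f \<and> compact (closure {x. f x \<noteq> 0}) \<and> closure {x. f x \<noteq> 0} \<subseteq> \<Omega>}"

type_synonym 'n multiindex = "'n \<Rightarrow> nat"

definition mi_abs :: "'n::finite multiindex \<Rightarrow> nat" where
  "mi_abs \<alpha> = (\<Sum>k\<in>UNIV. \<alpha> k)"

text \<open>An arbitrary but fixed enumeration of the coordinates. The order in which the partial
  derivatives are taken in \<open>D\<^sup>\<alpha>\<close> does not matter on smooth functions.\<close>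

definition coords :: "'n::finite list" where
  "coords = (SOME ks. distinct ks \<and> set ks = UNIV)"

definition Dmulti :: "'n::finite multiindex \<Rightarrow> (real^'n \<Rightarrow> complex) \<Rightarrow> real^'n \<Rightarrow> complex" where
  "Dmulti \<alpha> f = foldr (\<lambda>k. Dk k ^^ \<alpha> k) coords f"

text \<open>The exponent ranges over \<open>[1, \<infinity>]\<close> inside \<open>ennreal\<close>; the value is \<open>\<infinity>\<close> for functions
  that are not in \<open>L\<^sup>p\<close>.\<close>

definition Lp_norm :: "ennreal \<Rightarrow> (real^'n) set \<Rightarrow> (real^'n \<Rightarrow> complex) \<Rightarrow> ennreal" where
  "Lp_norm p \<Omega> f =
    (if p = \<infinity> then esssup (lebesgue_on \<Omega>) (\<lambda>x. ennreal (norm (f x)))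
     else let I = (\<integral>\<^sup>+ x. ennreal (norm (f x) powr enn2real p) \<partial>lebesgue_on \<Omega>)
          in if I = \<infinity> then \<infinity> else ennreal (enn2real I powr (1 / enn2real p)))"

definition Linf :: "(real^'n) set \<Rightarrow> (real^'n \<Rightarrow> complex) set" where
  "Linf \<Omega> = {f. f \<in> borel_measurable (lebesgue_on \<Omega>) \<and> Lp_norm \<infinity> \<Omega> f < \<infinity>}"

text \<open>A differential operator \<open>\<Sum>\<^sub>\<alpha> a\<^sub>\<alpha>(x) D\<^sup>\<alpha>\<close> is given by its family of coefficients; only
  finitely many of them are nonzero when it has finite order.\<close>

type_synonym 'n coeffs = "'n multiindex \<Rightarrow> real^'n \<Rightarrow> complex"

definition order_le :: "nat \<Rightarrow> ('n::finite) coeffs \<Rightarrow> bool" where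
  "order_le l a \<longleftrightarrow> (\<forall>\<alpha>. l < mi_abs \<alpha> \<longrightarrow> a \<alpha> = (\<lambda>x. 0))"

definition diff_op :: "('n::finite) coeffs \<Rightarrow> (real^'n \<Rightarrow> complex) \<Rightarrow> real^'n \<Rightarrow> complex" where
  "diff_op a f x = (\<Sum>\<alpha> | a \<alpha> \<noteq> (\<lambda>x. 0). a \<alpha> x * Dmulti \<alpha> f x)"

text \<open>Systems \<open>{P\<^sub>j}\<close> are indexed by \<open>j \<in> {1..N}\<close>.\<close>

definition Linf_system :: "(real^'n::finite) set \<Rightarrow> nat \<Rightarrow> nat \<Rightarrow> (nat \<Rightarrow> 'n coeffs) \<Rightarrow> bool" where
  "Linf_system \<Omega> l N a \<longleftrightarrow> (\<forall>j\<in>{1..N}. order_le l (a j) \<and> (\<forall>\<alpha>. a j \<alpha> \<in> Linf \<Omega>))"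

text \<open>Coefficients are identified when they agree almost everywhere.\<close>

definition same_principal_part ::
    "(real^'n::finite) set \<Rightarrow> nat \<Rightarrow> nat \<Rightarrow> (nat \<Rightarrow> 'n coeffs) \<Rightarrow> (nat \<Rightarrow> 'n coeffs) \<Rightarrow> bool" where
  "same_principal_part \<Omega> l N a b \<longleftrightarrow>
     (\<forall>j\<in>{1..N}. \<forall>\<alpha>. mi_abs \<alpha> = l \<longrightarrow> (AE x in lebesgue_on \<Omega>. a j \<alpha> x = b j \<alpha> x))"

text \<open>The space \<open>L\<^sup>0\<^bsub>p,\<Omega>\<^esub>(P\<^sub>1, \<dots>, P\<^sub>N)\<close>. Operators \<open>Q\<close> of any finite order with
  arbitrary measurable coefficients are admitted.\<close>

definition L0 :: "ennreal \<Rightarrow> (real^'n::finite) set \<Rightarrow> nat \<Rightarrow> (nat \<Rightarrow> 'n coeffs) \<Rightarrow> 'n coeffs set" where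
  "L0 p \<Omega> N a =
     {q. (\<exists>m. order_le m q) \<and> (\<forall>\<alpha>. q \<alpha> \<in> borel_measurable (lebesgue_on \<Omega>)) \<and>
         (\<exists>C1 C2 :: real. \<forall>f \<in> test_functions \<Omega>.
            Lp_norm p \<Omega> (diff_op q f)
              \<le> ennreal C1 * (\<Sum>j\<in>{1..N}. Lp_norm p \<Omega> (diff_op (a j) f))
                + ennreal C2 * Lp_norm p \<Omega> f)}"

definition principal_type ::
    "ennreal \<Rightarrow> (real^'n::finite) set \<Rightarrow> nat \<Rightarrow> nat \<Rightarrow> (nat \<Rightarrow> 'n coeffs) \<Rightarrow> bool" where
  "principal_type p \<Omega> l N a \<longleftrightarrow>
     (\<forall>r. Linf_system \<Omega> l N r \<and> same_principal_part \<Omega> l N a r \<longrightarrow> L0 p \<Omega> N a = L0 p \<Omega> N r)"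

definition principal_symbol :: "nat \<Rightarrow> ('n::finite multiindex \<Rightarrow> complex) \<Rightarrow> real^'n \<Rightarrow> complex" where
  "principal_symbol l c \<xi> =
     (\<Sum>\<alpha> | mi_abs \<alpha> = l. c \<alpha> * (\<Prod>k\<in>UNIV. of_real (\<xi> $ k) ^ \<alpha> k))"

definition elliptic :: "nat \<Rightarrow> nat \<Rightarrow> (nat \<Rightarrow> 'n::finite multiindex \<Rightarrow> complex) \<Rightarrow> bool" where
  "elliptic l N c \<longleftrightarrow>
     (\<forall>\<xi> :: real^'n. \<xi> \<noteq> 0 \<longrightarrow> (\<exists>j\<in>{1..N}. principal_symbol l (c j) \<xi> \<noteq> 0))"

end

theory Submission
  imports Defs
begin

text \<open>
  Suppose the system is elliptic and put \<open>E = \<Sum>\<^sub>j \<bar>P\<^sub>j\<bar>\<^sup>2\<close> for the principal symbols \<open>P\<^sub>j\<close>. The identity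
  \<open>1 = e\<^bsup>-E(\<rho>\<xi>)\<^esup> + \<integral>\<^sub>0\<^sup>\<rho> 2l r\<^bsup>2l-1\<^esup> E(\<xi>) e\<^bsup>-E(r\<xi>)\<^esup> dr\<close>, multiplied by \<open>\<xi>\<^sup>\<alpha>\<close> and combined with
  \<open>E \<cdot> FT f = \<Sum>\<^sub>j cnj P\<^sub>j \<cdot> FT (P\<^sub>j(D) f)\<close>, writes \<open>D\<^sup>\<alpha> f\<close> as a sum of superpositions of translates of \<open>f\<close> and of
  the \<open>P\<^sub>j(D) f\<close>. For \<open>\<bar>\<alpha>\<bar> < l\<close> the kernels are integrable, with mass \<open>O(\<rho>)\<close> on the
  \<open>P\<^sub>j(D) f\<close>, so lower order derivatives are bounded by an arbitrarily small multiple of the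
  principal parts plus a multiple of \<open>f\<close>, for every \<open>p \<in> [1, \<infinity>]\<close>; bounded lower order terms
  can then be absorbed. Conversely, at a common real zero \<open>\<xi> \<noteq> 0\<close> of the \<open>P\<^sub>j\<close> the wave
  packets \<open>e\<^bsup>i t x\<cdot>\<xi>\<^esup> \<phi>(x/t)\<close> show that some \<open>D\<^sub>k\<^bsup>l-1\<^esup>\<close> is not controlled by the principal parts,
  so a perturbation by it changes the space.
\<close>

section \<open>Partial derivatives\<close>

text \<open>Only orders \<open>d < l\<close> are required, and for these the kernel carries the
  factor \<open>r ^ (l - 1 - d)\<close>, which is bounded near 0, so a superposition of translates
  suffices. The small factor is just the length of the interval from 0 to \<rho>; the kernel masses
  do not depend on \<rho>. Absorbing means subtracting a multiple of the norm of the principal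
  parts, which must therefore be finite. Since no constant has to be sharp, a quasi-triangle
  inequality and an unidentified inversion constant are enough. In the converse the packet width
  \<open>t\<close> is essential: a derivative falling on the envelope costs \<open>1 / t\<close>
  where the phase gains \<open>t\<close>, so at a zero of the symbols the principal parts have size
  \<open>t ^ (l - 2)\<close>. A fixed width would give \<open>t ^ (l - 1)\<close>, the size of the
  perturbation itself. For \<open>l = 1\<close> the perturbation would be \<open>f\<close>, which
  the term with \<open>C2\<close> always controls; hence \<open>2 \<le> l\<close>.\<close>

lemma partial_has_derivative:
  assumes "(f has_derivative f') (at x)"
  shows "partial k f x = f' (axis k 1)"
proof -
  have "((\<lambda>t. x + t *\<^sub>R axis k 1) has_vector_derivative axis k (1::real)) (at 0)"
    by (auto intro!: derivative_eq_intros)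
  moreover have "(f has_derivative f') (at (x + 0 *\<^sub>R axis k 1) within range (\<lambda>t. x + t *\<^sub>R axis k 1))"
    using assms by (simp add: has_derivative_at_withinI)
  ultimately have "(f \<circ> (\<lambda>t. x + t *\<^sub>R axis k 1) has_vector_derivative f' (axis k 1)) (at 0)"
    by (rule vector_derivative_diff_chain_within)
  then show ?thesis
    unfolding partial_def o_def by (rule vector_derivative_at)
qed

lemma has_derivative_partial_line:
  assumes "\<And>x. f differentiable (at x)"
  shows "((\<lambda>t. f (x + t *\<^sub>R axis k 1)) has_vector_derivative partial k f (x + t *\<^sub>R axis k 1)) (at t)"
proof -
  obtain f' where f': "(f has_derivative f') (at (x + t *\<^sub>R axis k 1))"
    using assms by (auto simp: differentiable_def)
  have "((\<lambda>t. x + t *\<^sub>R axis k 1) has_vector_derivative axis k (1::real)) (at t)"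
    by (auto intro!: derivative_eq_intros)
  moreover have "(f has_derivative f') (at (x + t *\<^sub>R axis k 1) within range (\<lambda>t. x + t *\<^sub>R axis k 1))"
    using f' by (simp add: has_derivative_at_withinI)
  ultimately have "(f \<circ> (\<lambda>t. x + t *\<^sub>R axis k 1) has_vector_derivative f' (axis k 1)) (at t)"
    by (rule vector_derivative_diff_chain_within)
  then show ?thesis
    using partial_has_derivative[OF f'] by (simp add: o_def)
qed

lemma partial_add:
  assumes "f differentiable (at x)" "g differentiable (at x)"
  shows "partial k (\<lambda>x. f x + g x) x = partial k f x + partial k g x"
proof -
  obtain f' g' where fg: "(f has_derivative f') (at x)" "(g has_derivative g') (at x)"
    using assms by (auto simp: differentiable_def)
  then show ?thesis
    using partial_has_derivative[OF has_derivative_add[OF fg]]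
      partial_has_derivative[OF fg(1)] partial_has_derivative[OF fg(2)] by simp
qed

lemma partial_mult:
  assumes "f differentiable (at x)" "g differentiable (at x)"
  shows "partial k (\<lambda>x. f x * g x) x = f x * partial k g x + partial k f x * g x"
proof -
  obtain f' g' where fg: "(f has_derivative f') (at x)" "(g has_derivative g') (at x)"
    using assms by (auto simp: differentiable_def)
  then show ?thesis
    using partial_has_derivative[OF has_derivative_mult[OF fg]]
      partial_has_derivative[OF fg(1)] partial_has_derivative[OF fg(2)] by simp
qed

lemma partial_const [simp]: "partial k (\<lambda>x. c) x = 0"
  using partial_has_derivative[OF has_derivative_const] .

lemma partial_cmult:
  assumes "f differentiable (at x)"
  shows "partial k (\<lambda>x. c * f x) x = c * partial k f x"
  using partial_mult[of "\<lambda>x. c" x f k] assms by simp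

lemma has_derivative_coord:
  "((\<lambda>x::real^'n. complex_of_real (x $ j)) has_derivative (\<lambda>h. of_real (h $ j))) (at x)"
  by (intro derivative_intros bounded_linear_imp_has_derivative bounded_linear_vec_nth
      bounded_linear_compose[OF bounded_linear_of_real])

lemma differentiable_coord: "(\<lambda>x::real^'n. complex_of_real (x $ j)) differentiable (at x)"
  using has_derivative_coord differentiableI by blast

lemma partial_coord:
  "partial k (\<lambda>x. complex_of_real (x $ j)) x = (if k = j then 1 else 0)"
  by (subst partial_has_derivative[OF has_derivative_coord]) (auto simp: axis_def)

lemma partial_exp:
  fixes f :: "real^'n \<Rightarrow> complex"
  assumes "f differentiable (at x)"
  shows "(\<lambda>x. exp (f x)) differentiable (at x)"
    and "partial k (\<lambda>x. exp (f x)) x = partial k f x * exp (f x)"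
proof -
  obtain f' where f': "(f has_derivative f') (at x)"
    using assms by (auto simp: differentiable_def)
  have "(exp has_derivative (\<lambda>h. exp (f x) * h)) (at (f x))"
    using DERIV_exp[of "f x"] by (simp add: has_field_derivative_def)
  then have d: "((\<lambda>x. exp (f x)) has_derivative (\<lambda>h. exp (f x) * f' h)) (at x)"
    using has_derivative_compose[OF f'] by blast
  then show "(\<lambda>x. exp (f x)) differentiable (at x)" by (rule differentiableI)
  show "partial k (\<lambda>x. exp (f x)) x = partial k f x * exp (f x)"
    using partial_has_derivative[OF d] partial_has_derivative[OF f'] by simp
qed

section \<open>Closure properties of smooth functions\<close>

lemma smooth_differentiable: "smooth f \<Longrightarrow> f differentiable (at x)"
  unfolding smooth_def by (metis foldr_Nil id_apply)

lemma smooth_continuous: "smooth f \<Longrightarrow> continuous_on A f"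
  by (meson continuous_at_imp_continuous_on differentiable_imp_continuous_within smooth_differentiable)

lemma smooth_partial:
  assumes "smooth f" shows "smooth (partial k f)"
  unfolding smooth_def
proof (intro allI)
  fix ks x
  show "foldr partial ks (partial k f) differentiable at x"
    using assms[unfolded smooth_def, rule_format, of "ks @ [k]" x] by simp
qed

lemma smooth_foldr_partial: "smooth f \<Longrightarrow> smooth (foldr partial ks f)"
  by (induction ks) (auto intro: smooth_partial)

lemma foldr_partial_add:
  assumes "smooth f" "smooth g"
  shows "foldr partial ks (\<lambda>x. f x + g x) = (\<lambda>x. foldr partial ks f x + foldr partial ks g x)"
proof (induction ks)
  case (Cons k ks)
  show ?case
    using assms by (auto simp: Cons partial_add smooth_differentiable smooth_foldr_partial)
qed simp

lemma foldr_partial_cmult: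
  assumes "smooth f"
  shows "foldr partial ks (\<lambda>x. c * f x) = (\<lambda>x. c * foldr partial ks f x)"
proof (induction ks)
  case (Cons k ks)
  show ?case
    using assms by (auto simp: Cons partial_cmult smooth_differentiable smooth_foldr_partial)
qed simp

lemma smooth_add: "smooth f \<Longrightarrow> smooth g \<Longrightarrow> smooth (\<lambda>x. f x + g x)"
  unfolding smooth_def[of "\<lambda>x. f x + g x"]
  by (simp add: foldr_partial_add differentiable_add smooth_differentiable smooth_foldr_partial)

lemma smooth_cmult: "smooth f \<Longrightarrow> smooth (\<lambda>x. c * f x)"
  unfolding smooth_def[of "\<lambda>x. c * f x"]
  by (simp add: foldr_partial_cmult differentiable_mult smooth_differentiable smooth_foldr_partial)

lemma smooth_Dk: "smooth f \<Longrightarrow> smooth (Dk k f)"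
  unfolding Dk_def by (intro smooth_cmult smooth_partial)

lemma smooth_const: "smooth (\<lambda>x. c)"
proof -
  have "\<exists>d. foldr partial ks (\<lambda>x::real^'a. c) = (\<lambda>x. d)" for ks
    by (induction ks) auto
  then show ?thesis unfolding smooth_def by (metis differentiable_const)
qed

text \<open>Smoothness is proved by naming a class of differentiable functions whose partials stay
  in the class. It is applied to polynomials times \<open>exp (- E x)\<close> and to polynomials
  times \<open>flat m\<close>.\<close>

lemma smooth_closed_class:
  assumes "F f"
    and "\<And>f x. F f \<Longrightarrow> f differentiable (at x)"
    and "\<And>f k. F f \<Longrightarrow> F (partial k f)"
  shows "F (foldr partial ks f)" "smooth f"
proof -
  show *: "F (foldr partial ks f)" for ks
    by (induction ks) (use assms in auto)
  show "smooth f" unfolding smooth_def using * assms by auto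
qed

text \<open>Spells a multi-index as a word of coordinates, so that facts about \<open>Dmulti\<close>
  become list inductions applying one derivative at a time.\<close>

definition dlist :: "'n::finite multiindex \<Rightarrow> 'n list" where
  "dlist \<alpha> = concat (map (\<lambda>k. replicate (\<alpha> k) k) coords)"

lemma coords: "distinct (coords :: 'n::finite list)" "set (coords :: 'n list) = UNIV"
proof -
  have "\<exists>ks :: 'n list. distinct ks \<and> set ks = UNIV"
    using finite_distinct_list[OF finite, of UNIV] by auto
  then have "distinct (coords :: 'n list) \<and> set (coords :: 'n list) = UNIV"
    unfolding coords_def by (rule someI_ex)
  then show "distinct (coords :: 'n::finite list)" "set (coords :: 'n list) = UNIV" by auto
qed

lemma Dmulti_dlist: "Dmulti \<alpha> f = foldr Dk (dlist \<alpha>) f"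
proof -
  have r: "foldr Dk (replicate m k) g = (Dk k ^^ m) g" for m k and g :: "real^'a \<Rightarrow> complex"
    by (induction m) auto
  have "foldr (\<lambda>k. Dk k ^^ \<alpha> k) ks f = foldr Dk (concat (map (\<lambda>k. replicate (\<alpha> k) k) ks)) f" for ks
    by (induction ks) (auto simp: r)
  then show ?thesis unfolding Dmulti_def dlist_def by simp
qed

lemma length_dlist: "length (dlist \<alpha>) = mi_abs \<alpha>"
  unfolding dlist_def mi_abs_def
  by (simp add: length_concat o_def sum_list_distinct_conv_sum_set coords)

lemma prod_list_dlist:
  fixes g :: "'n::finite \<Rightarrow> 'a::comm_monoid_mult"
  shows "prod_list (map g (dlist \<alpha>)) = (\<Prod>k\<in>UNIV. g k ^ \<alpha> k)"
proof -
  have "prod_list (map g (concat (map (\<lambda>k. replicate (\<alpha> k) k) ks))) = prod_list (map (\<lambda>k. g k ^ \<alpha> k) ks)" for ks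
    by (induction ks) (auto simp: prod_list_replicate)
  then show ?thesis unfolding dlist_def
    by (simp add: prod.distinct_set_conv_list coords flip: coords(2))
qed

lemma finite_mi: "finite {\<alpha> :: 'n::finite multiindex. mi_abs \<alpha> \<le> l}"
proof (rule finite_subset)
  show "{\<alpha> :: 'n multiindex. mi_abs \<alpha> \<le> l} \<subseteq> (UNIV \<rightarrow>\<^sub>E {..l})"
  proof clarify
    fix \<alpha> :: "'n multiindex" assume "mi_abs \<alpha> \<le> l"
    then have "\<alpha> k \<le> l" for k
      using member_le_sum[of k UNIV \<alpha>] unfolding mi_abs_def by fastforce
    then show "\<alpha> \<in> UNIV \<rightarrow>\<^sub>E {..l}" by auto
  qed
  show "finite ((UNIV :: 'n set) \<rightarrow>\<^sub>E {..l})" by (intro finite_PiE) auto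
qed

lemma finite_mi_eq: "finite {\<alpha> :: 'n::finite multiindex. mi_abs \<alpha> = l}"
  by (rule finite_subset[OF _ finite_mi[of l]]) auto

text \<open>Trades the set of nonzero coefficients, which varies with \<open>a\<close>, for one
  fixed finite index set; the added terms have coefficient zero.\<close>

lemma diff_op_order_le:
  assumes "order_le l a"
  shows "diff_op a f x = (\<Sum>\<alpha> | mi_abs \<alpha> \<le> l. a \<alpha> x * Dmulti \<alpha> f x)"
  unfolding diff_op_def
  using assms by (intro sum.mono_neutral_left) (auto simp: order_le_def finite_mi not_le[symmetric])

section \<open>Complex polynomials in real variables\<close>

text \<open>A predicate on functions instead of a polynomial type: closure under conjugation (the
  variables are real), under \<open>partial\<close> and under multiplication of transforms are then
  plain inductions.\<close>

inductive cpoly :: "(real^'n \<Rightarrow> complex) \<Rightarrow> bool" where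
  cpoly_const: "cpoly (\<lambda>x. c)"
| cpoly_coord: "cpoly (\<lambda>x. of_real (x $ k))"
| cpoly_add: "cpoly f \<Longrightarrow> cpoly g \<Longrightarrow> cpoly (\<lambda>x. f x + g x)"
| cpoly_mult: "cpoly f \<Longrightarrow> cpoly g \<Longrightarrow> cpoly (\<lambda>x. f x * g x)"

lemma cpoly_sum:
  assumes "\<And>i. i \<in> I \<Longrightarrow> cpoly (f i)"
  shows "cpoly (\<lambda>x. \<Sum>i\<in>I. f i x)"
  using assms by (induction I rule: infinite_finite_induct) (auto intro: cpoly.intros)

lemma cpoly_prod:
  assumes "\<And>i. i \<in> I \<Longrightarrow> cpoly (f i)"
  shows "cpoly (\<lambda>x. \<Prod>i\<in>I. f i x)"
  using assms by (induction I rule: infinite_finite_induct) (auto intro: cpoly.intros)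

lemma cpoly_power: "cpoly f \<Longrightarrow> cpoly (\<lambda>x. f x ^ m)"
  by (induction m) (auto intro: cpoly.intros)

lemma cpoly_cnj: "cpoly f \<Longrightarrow> cpoly (\<lambda>x. cnj (f x))"
  by (induction rule: cpoly.induct) (auto intro: cpoly.intros)

lemma cpoly_differentiable: "cpoly f \<Longrightarrow> f differentiable (at x)"
  by (induction rule: cpoly.induct) (auto intro!: derivative_intros differentiable_coord)

lemma cpoly_continuous: "cpoly f \<Longrightarrow> continuous_on A f"
  by (meson continuous_at_imp_continuous_on differentiable_imp_continuous_within cpoly_differentiable)

lemma cpoly_partial: "cpoly f \<Longrightarrow> cpoly (partial k f)"
proof (induction rule: cpoly.induct)
  case (cpoly_const c)
  have "partial k (\<lambda>x::real^'a. c) = (\<lambda>x. 0)" by auto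
  then show ?case by (auto intro: cpoly.intros)
next
  case (cpoly_coord j)
  have "partial k (\<lambda>x::real^'a. complex_of_real (x $ j)) = (\<lambda>x. if k = j then 1 else 0)"
    by (auto simp: partial_coord)
  then show ?case by (auto intro: cpoly.intros)
next
  case (cpoly_add f g)
  have "partial k (\<lambda>x. f x + g x) = (\<lambda>x. partial k f x + partial k g x)"
    using cpoly_add by (auto simp: partial_add cpoly_differentiable)
  then show ?case using cpoly_add by (auto intro: cpoly.intros)
next
  case (cpoly_mult f g)
  have "partial k (\<lambda>x. f x * g x) = (\<lambda>x. f x * partial k g x + partial k f x * g x)"
    using cpoly_mult by (auto simp: partial_mult cpoly_differentiable)
  then show ?case using cpoly_mult by (auto intro!: cpoly.intros)
qed

lemma cpoly_bound:
  fixes f :: "real^'n \<Rightarrow> complex"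
  assumes "cpoly f"
  shows "\<exists>C m. 0 \<le> C \<and> (\<forall>x. cmod (f x) \<le> C * (1 + norm x) ^ m)"
  using assms
proof (induction rule: cpoly.induct)
  case (cpoly_const c)
  show ?case by (rule exI[of _ "cmod c"], rule exI[of _ 0]) auto
next
  case (cpoly_coord k)
  have "cmod (of_real (x $ k)) \<le> 1 * (1 + norm x) ^ 1" for x :: "real^'n"
    using component_le_norm_cart[of x k] by simp
  then show ?case by (intro exI[of _ 1] exI[of _ "1::nat"]) auto
next
  case (cpoly_add f g)
  then obtain C m D k where *: "0 \<le> C" "0 \<le> D" "\<And>x. cmod (f x) \<le> C * (1 + norm x) ^ m"
    "\<And>x. cmod (g x) \<le> D * (1 + norm x) ^ k" by auto
  have "cmod (f x + g x) \<le> (C + D) * (1 + norm x) ^ (m + k)" for x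
  proof -
    have "cmod (f x + g x) \<le> C * (1 + norm x) ^ m + D * (1 + norm x) ^ k"
      using *(3,4)[of x] norm_triangle_ineq[of "f x" "g x"] by linarith
    also have "\<dots> \<le> C * (1 + norm x) ^ (m + k) + D * (1 + norm x) ^ (m + k)"
      using * by (intro add_mono mult_left_mono power_increasing) auto
    finally show ?thesis by (simp add: algebra_simps)
  qed
  then show ?case using * by (intro exI[of _ "C + D"] exI[of _ "m + k"]) auto
next
  case (cpoly_mult f g)
  then obtain C m D k where *: "0 \<le> C" "0 \<le> D" "\<And>x. cmod (f x) \<le> C * (1 + norm x) ^ m"
    "\<And>x. cmod (g x) \<le> D * (1 + norm x) ^ k" by auto
  have "cmod (f x * g x) \<le> (C * D) * (1 + norm x) ^ (m + k)" for x
    using mult_mono[OF *(3)[of x] *(4)[of x]] *(1,2)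
    by (simp add: norm_mult power_add algebra_simps)
  then show ?case using * by (intro exI[of _ "C * D"] exI[of _ "m + k"]) auto
qed

section \<open>Rapidly decreasing functions and their Fourier transform\<close>

lemma lborel_integrable_affine:
  fixes F :: "'a::euclidean_space \<Rightarrow> 'b::{banach,second_countable_topology}"
  assumes "c \<noteq> 0" "integrable lborel F"
  shows "integrable lborel (\<lambda>x. F (t + c *\<^sub>R x))"
proof -
  have [measurable]: "F \<in> borel_measurable borel" using assms by auto
  have "integrable lborel (\<lambda>x. \<bar>c\<bar> ^ DIM('a) *\<^sub>R F (t + c *\<^sub>R x))" using assms(2)
    by (subst (asm) lborel_affine[OF assms(1), of t]) (simp add: integrable_density integrable_distr_eq)
  from integrable_scaleR_right[OF this, of "1 / \<bar>c\<bar> ^ DIM('a)"] show ?thesis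
    using assms(1) by simp
qed

lemma lborel_integral_affine:
  fixes F :: "'a::euclidean_space \<Rightarrow> 'b::{banach,second_countable_topology}"
  assumes "c \<noteq> 0" and [measurable]: "F \<in> borel_measurable borel"
  shows "integral\<^sup>L lborel F = \<bar>c\<bar> ^ DIM('a) *\<^sub>R (\<integral>x. F (t + c *\<^sub>R x) \<partial>lborel)"
  by (subst lborel_affine[OF assms(1), of t])
     (simp add: integral_density integral_distr)

lemma nn_integral_lborel_translate:
  fixes F :: "'a::euclidean_space \<Rightarrow> ennreal"
  assumes [measurable]: "F \<in> borel_measurable borel"
  shows "(\<integral>\<^sup>+x. F (t + x) \<partial>lborel) = integral\<^sup>N lborel F"
  by (subst (2) lborel_distr_plus[symmetric, of t]) (simp add: nn_integral_distr)

text \<open>A product of one-dimensional Cauchy profiles. It is integrable by integrating each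
  coordinate separately, and its reciprocal is a polynomial, so polynomial bounds translate into
  decay.\<close>

definition weight :: "'a::euclidean_space \<Rightarrow> real" where
  "weight x = (\<Prod>b\<in>Basis. 1 / (1 + (x \<bullet> b)\<^sup>2))"

lemma weight_pos: "0 < weight x"
  unfolding weight_def by (intro prod_pos) (auto simp: add_pos_nonneg)

lemma weight_le_1: "weight x \<le> 1"
  unfolding weight_def by (intro prod_le_1) (auto simp: divide_simps add_pos_nonneg)

lemma continuous_weight: "continuous_on A weight"
  unfolding weight_def
  by (intro continuous_intros ballI) (simp add: add_pos_nonneg less_imp_neq[symmetric])

lemma nn_integral_cauchy_finite: "(\<integral>\<^sup>+t. ennreal (1 / (1 + t\<^sup>2)) \<partial>lborel) < \<infinity>"
proof -
  have A: "(\<integral>\<^sup>+t. ennreal (1 / (1 + t\<^sup>2)) * indicator {0..} t \<partial>lborel) = ennreal (pi / 2 - arctan 0)"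
  proof (rule nn_integral_FTC_atLeast)
    show "(\<lambda>t::real. 1 / (1 + t\<^sup>2)) \<in> borel_measurable borel" by measurable
    show "(arctan has_real_derivative 1 / (1 + x\<^sup>2)) (at x)" for x
      using DERIV_arctan[of x] by (simp add: divide_inverse)
    show "0 \<le> 1 / (1 + x\<^sup>2)" for x :: real by (auto intro!: divide_nonneg_pos simp: add_pos_nonneg)
  qed (rule tendsto_arctan_at_top)
  have "(\<integral>\<^sup>+t. ennreal (1 / (1 + t\<^sup>2)) * indicator {..0} t \<partial>lborel)
    = (\<integral>\<^sup>+t. ennreal (1 / (1 + t\<^sup>2)) * indicator {0..} t \<partial>lborel)"
    by (subst nn_integral_real_affine[of _ "-1" 0])
       (auto intro!: nn_integral_cong simp: indicator_def)
  then have B: "(\<integral>\<^sup>+t. ennreal (1 / (1 + t\<^sup>2)) * indicator {..0} t \<partial>lborel) < \<infinity>" using A by simp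
  have "(\<integral>\<^sup>+t. ennreal (1 / (1 + t\<^sup>2)) \<partial>lborel) \<le>
     (\<integral>\<^sup>+t. ennreal (1 / (1 + t\<^sup>2)) * indicator {0..} t + ennreal (1 / (1 + t\<^sup>2)) * indicator {..0} t \<partial>lborel)"
    by (intro nn_integral_mono) (auto simp: indicator_def)
  also have "\<dots> = (\<integral>\<^sup>+t. ennreal (1 / (1 + t\<^sup>2)) * indicator {0..} t \<partial>lborel)
      + (\<integral>\<^sup>+t. ennreal (1 / (1 + t\<^sup>2)) * indicator {..0} t \<partial>lborel)"
    by (rule nn_integral_add) auto
  also have "\<dots> < \<infinity>" using A B by (simp add: ennreal_add_eq_top)
  finally show ?thesis .
qed

lemma integrable_weight: "integrable lborel (weight :: 'a::euclidean_space \<Rightarrow> real)"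
proof (rule integrableI_nonneg)
  show "weight \<in> borel_measurable (lborel :: 'a measure)"
    using borel_measurable_continuous_onI[OF continuous_weight] by simp
  show "AE x in lborel. 0 \<le> weight (x :: 'a)" using weight_pos less_imp_le by auto
  have "(\<integral>\<^sup>+x. ennreal (weight x) \<partial>(lborel :: 'a measure))
     = (\<integral>\<^sup>+x. (\<Prod>b\<in>Basis. ennreal (1 / (1 + (x \<bullet> b)\<^sup>2))) \<partial>(lborel :: 'a measure))"
    unfolding weight_def
    by (subst prod_ennreal) (auto simp: add_pos_nonneg intro!: divide_nonneg_pos)
  also have "\<dots> = (\<Prod>b\<in>(Basis :: 'a set). (\<integral>\<^sup>+t. ennreal (1 / (1 + t\<^sup>2)) \<partial>lborel))"
    by (rule nn_integral_lborel_prod) auto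
  also have "\<dots> < \<infinity>"
    using nn_integral_cauchy_finite by (simp add: power_less_top_ennreal)
  finally show "(\<integral>\<^sup>+x. ennreal (weight x) \<partial>(lborel :: 'a measure)) < \<infinity>" .
qed

definition decays :: "('a::euclidean_space \<Rightarrow> complex) \<Rightarrow> bool" where
  "decays f \<longleftrightarrow> (\<exists>C. \<forall>x. cmod (f x) \<le> C * weight x)"

lemma decaysE:
  assumes "decays f"
  obtains C where "0 \<le> C" "\<And>x. cmod (f x) \<le> C * weight x"
proof -
  obtain C where C: "\<And>x. cmod (f x) \<le> C * weight x" using assms by (auto simp: decays_def)
  have "0 \<le> C * weight (undefined :: 'a)" using C[of undefined] norm_ge_zero order_trans by blast
  then have "0 \<le> C" using weight_pos[of "undefined :: 'a"] by (simp add: zero_le_mult_iff)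
  then show ?thesis using C that by auto
qed

lemma decays_bounded:
  assumes "decays f" obtains C where "0 \<le> C" "\<And>x. cmod (f x) \<le> C"
proof -
  obtain C where C: "0 \<le> C" "\<And>x. cmod (f x) \<le> C * weight x" using assms by (rule decaysE) blast
  have "cmod (f x) \<le> C" for x
    using C(2)[of x] mult_left_le[OF weight_le_1[of x] C(1)] by linarith
  then show ?thesis using that C by blast
qed

lemma decays_add: "decays f \<Longrightarrow> decays g \<Longrightarrow> decays (\<lambda>x. f x + g x)"
proof -
  assume "decays f" "decays g"
  then obtain C D where "\<And>x. cmod (f x) \<le> C * weight x" "\<And>x. cmod (g x) \<le> D * weight x"
    by (auto simp: decays_def)
  then have "cmod (f x + g x) \<le> (C + D) * weight x" for x
    unfolding distrib_right using norm_triangle_mono by blast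
  then show ?thesis by (auto simp: decays_def)
qed

lemma decays_cmult: "decays f \<Longrightarrow> decays (\<lambda>x. c * f x)"
proof -
  assume "decays f"
  then obtain C where C: "\<And>x. cmod (f x) \<le> C * weight x" by (auto simp: decays_def)
  then have "cmod (c * f x) \<le> (cmod c * C) * weight x" for x
    using mult_left_mono[OF C[of x], of "cmod c"] by (simp add: norm_mult mult.assoc)
  then show ?thesis unfolding decays_def by blast
qed

lemma decays_integrable:
  assumes "decays f" "continuous_on UNIV f"
  shows "integrable lborel f"
proof -
  obtain C where C: "0 \<le> C" "\<And>x. cmod (f x) \<le> C * weight x" using assms by (auto elim: decaysE)
  show ?thesis
  proof (rule Bochner_Integration.integrable_bound)
    show "integrable lborel (\<lambda>x::'a. C * weight x)" using integrable_weight by auto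
    show "f \<in> borel_measurable lborel" using borel_measurable_continuous_onI[OF assms(2)] by simp
    show "AE x in lborel. norm (f x) \<le> norm (C * weight x)"
      using order_trans[OF C(2) abs_ge_self] by (auto intro!: AE_I2)
  qed
qed

text \<open>Asks less than the usual Schwartz space: each derivative is only dominated by the one
  integrable \<open>weight\<close>. This already gives integrability, boundedness and integration by
  parts.\<close>

definition schwartz :: "(real^'n \<Rightarrow> complex) \<Rightarrow> bool" where
  "schwartz f \<longleftrightarrow> smooth f \<and> (\<forall>ks. decays (foldr partial ks f))"

lemma schwartz_decays: "schwartz f \<Longrightarrow> decays f"
  unfolding schwartz_def by (metis foldr_Nil id_apply)

lemma schwartz_partial: "schwartz f \<Longrightarrow> schwartz (partial k f)"
  unfolding schwartz_def
proof safe
  fix ks assume "\<forall>ks. decays (foldr partial ks f)"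
  then have "decays (foldr partial (ks @ [k]) f)" by blast
  then show "decays (foldr partial ks (partial k f))" by simp
qed (rule smooth_partial)

lemma schwartz_add: "schwartz f \<Longrightarrow> schwartz g \<Longrightarrow> schwartz (\<lambda>x. f x + g x)"
  by (simp add: schwartz_def smooth_add foldr_partial_add decays_add)

lemma schwartz_cmult: "schwartz f \<Longrightarrow> schwartz (\<lambda>x. c * f x)"
  by (simp add: schwartz_def smooth_cmult foldr_partial_cmult decays_cmult)

lemma schwartz_Dk: "schwartz f \<Longrightarrow> schwartz (Dk k f)"
  unfolding Dk_def by (intro schwartz_cmult schwartz_partial)

lemma schwartz_zero: "schwartz (\<lambda>x. 0)"
proof -
  have "foldr partial ks (\<lambda>x :: real^'a. 0) = (\<lambda>x. 0)" for ks
    by (induction ks) auto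
  moreover have "decays (\<lambda>x :: real^'a. 0)" unfolding decays_def by (intro exI[of _ 0]) simp
  ultimately show ?thesis by (simp add: schwartz_def smooth_const)
qed

lemma schwartz_sum:
  assumes "\<And>i. i \<in> I \<Longrightarrow> schwartz (f i)"
  shows "schwartz (\<lambda>x. \<Sum>i\<in>I. f i x)"
  using assms by (induction I rule: infinite_finite_induct) (auto intro: schwartz_add schwartz_zero)

lemma schwartz_foldr_Dk: "schwartz f \<Longrightarrow> schwartz (foldr Dk ks f)"
  by (induction ks) (auto intro: schwartz_Dk)

lemma schwartz_continuous: "schwartz f \<Longrightarrow> continuous_on A f"
  by (simp add: schwartz_def smooth_continuous)

lemma schwartz_integrable: "schwartz f \<Longrightarrow> integrable lborel f"
  by (simp add: decays_integrable schwartz_decays schwartz_continuous)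

lemma schwartz_measurable: "schwartz f \<Longrightarrow> f \<in> borel_measurable borel"
  by (intro borel_measurable_continuous_onI schwartz_continuous)

text \<open>Integrating the increment \<open>h (x + e) - h x\<close> over \<open>x\<close> gives \<open>0\<close> by translation
  invariance, and the integral of the derivative by Fubini.\<close>

lemma integral_partial_zero:
  fixes h :: "real^'n \<Rightarrow> complex"
  assumes diff: "\<And>x. h differentiable (at x)" and int: "integrable lborel h"
    and cont: "continuous_on UNIV (partial k h)" and int': "integrable lborel (partial k h)"
  shows "(\<integral>x. partial k h x \<partial>lborel) = 0"
proof -
  define e where "e = (axis k 1 :: real^'n)"
  define p where "p = partial k h"
  have [measurable]: "p \<in> borel_measurable borel" using int' by (simp add: p_def)
  have [measurable]: "h \<in> borel_measurable borel" using int by simp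
  let ?f = "\<lambda>x t. indicator {0..1} t *\<^sub>R p (x + t *\<^sub>R e)"
  have tr: "integral\<^sup>L lborel F = (\<integral>x. F (x + c) \<partial>lborel)" 
    if "F \<in> borel_measurable borel" for F :: "real^'n \<Rightarrow> complex" and c
    using lborel_integral_affine[of 1 F c] that by (simp add: add.commute)
  have tri: "integrable lborel (\<lambda>x. F (x + c))" if "integrable lborel F" for F :: "real^'n \<Rightarrow> complex" and c
    using lborel_integrable_affine[of 1 F c] that by (simp add: add.commute)
  have ftc: "(\<integral>t. ?f x t \<partial>lborel) = h (x + e) - h x" for x
  proof -
    have "(\<integral>t. ?f x t \<partial>lborel) = h (x + 1 *\<^sub>R e) - h (x + 0 *\<^sub>R e)"
    proof (rule integral_FTC_Icc)
      show "((\<lambda>t. h (x + t *\<^sub>R e)) has_vector_derivative p (x + t *\<^sub>R e)) (at t within {0..1})" for t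
        unfolding p_def e_def
        using has_derivative_partial_line[OF diff] has_vector_derivative_at_within by blast
      show "continuous_on {0..1} (\<lambda>t. p (x + t *\<^sub>R e))"
        using cont unfolding p_def by (auto intro!: continuous_on_compose2[of UNIV "partial k h"] continuous_intros)
    qed simp
    then show ?thesis by simp
  qed
  \<comment> \<open>Absolute integrability for Fubini: every slice at fixed \<open>t\<close> in the
    unit interval has the mass of \<open>p\<close>, by translation invariance.\<close>
  have "(\<integral>\<^sup>+z. norm (case_prod ?f z) \<partial>(lborel \<Otimes>\<^sub>M lborel)) = (\<integral>\<^sup>+t. \<integral>\<^sup>+x. norm (?f x t) \<partial>lborel \<partial>lborel)"
    by (subst lborel.nn_integral_fst[symmetric], measurable, subst lborel_pair.Fubini[symmetric]) auto
  also have "\<dots> = (\<integral>\<^sup>+t. indicator {0..1} t * (\<integral>\<^sup>+x. norm (p x) \<partial>lborel) \<partial>(lborel :: real measure))"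
  proof (intro nn_integral_cong)
    fix t :: real
    have "(\<integral>\<^sup>+x. norm (?f x t) \<partial>lborel) = indicator {0..1} t * (\<integral>\<^sup>+x. norm (p (t *\<^sub>R e + x)) \<partial>lborel)"
      by (subst nn_integral_cmult[symmetric]) (auto simp: indicator_def add.commute intro!: nn_integral_cong)
    then show "(\<integral>\<^sup>+x. norm (?f x t) \<partial>lborel) = indicator {0..1} t * (\<integral>\<^sup>+x. norm (p x) \<partial>lborel)"
      using nn_integral_lborel_translate[of "\<lambda>x. ennreal (norm (p x))" "t *\<^sub>R e"] by simp
  qed
  also have "\<dots> = (\<integral>\<^sup>+x. norm (p x) \<partial>lborel)"
    by (subst nn_integral_multc) auto
  also have "\<dots> < \<infinity>" using int' by (simp add: integrable_iff_bounded p_def)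
  finally have I: "integrable (lborel \<Otimes>\<^sub>M lborel) (case_prod ?f)"
    by (intro integrableI_bounded) auto
  have "0 = (\<integral>x. h (x + e) - h x \<partial>lborel)"
    using int tri[OF int, of e] tr[of h e] by simp
  also have "\<dots> = (\<integral>x. \<integral>t. ?f x t \<partial>lborel \<partial>lborel)"
    by (simp add: ftc)
  also have "\<dots> = (\<integral>t. \<integral>x. ?f x t \<partial>lborel \<partial>lborel)"
    by (rule lborel_pair.Fubini_integral[OF I, symmetric])
  also have "\<dots> = (\<integral>t. indicator {0..1} t *\<^sub>R integral\<^sup>L lborel p \<partial>(lborel :: real measure))"
    by (simp only: integral_scaleR_right tr[OF \<open>p \<in> borel_measurable borel\<close>, symmetric])
  also have "\<dots> = integral\<^sup>L lborel p"
    by simp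
  finally show ?thesis by (simp add: p_def)
qed

text \<open>Not normalised by any power of \<open>2 * pi\<close>; the constant is left to
  \<open>FT_inversion\<close>.\<close>

definition FT :: "(real^'n \<Rightarrow> complex) \<Rightarrow> real^'n \<Rightarrow> complex" where
  "FT g \<xi> = (\<integral>y. g y * cis (- (\<xi> \<bullet> y)) \<partial>lborel)"

lemma cis_inner_deriv:
  fixes \<xi> x :: "real^'n"
  shows "(\<lambda>x. cis (\<xi> \<bullet> x)) differentiable (at x)"
    and "partial k (\<lambda>x. cis (\<xi> \<bullet> x)) x = \<i> * (\<xi> $ k) * cis (\<xi> \<bullet> x)"
proof -
  have d: "((\<lambda>x. \<i> * complex_of_real (\<xi> \<bullet> x)) has_derivative (\<lambda>h. \<i> * complex_of_real (\<xi> \<bullet> h))) (at x)"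
    by (intro bounded_linear_imp_has_derivative bounded_linear_const_mult
        bounded_linear_compose[OF bounded_linear_of_real] bounded_linear_inner_right)
  then have d': "(\<lambda>x. \<i> * complex_of_real (\<xi> \<bullet> x)) differentiable (at x)" by (rule differentiableI)
  show "(\<lambda>x. cis (\<xi> \<bullet> x)) differentiable (at x)"
    using partial_exp(1)[OF d'] by (simp add: cis_conv_exp)
  show "partial k (\<lambda>x. cis (\<xi> \<bullet> x)) x = \<i> * (\<xi> $ k) * cis (\<xi> \<bullet> x)"
    using partial_exp(2)[OF d', of k] partial_has_derivative[OF d]
    by (simp add: cis_conv_exp inner_axis)
qed

lemma continuous_cis_inner: "continuous_on A (\<lambda>x. cis (\<xi> \<bullet> x))"
  unfolding cis_conv_exp by (intro continuous_intros)

lemma measurable_cis [measurable]: "cis \<in> borel_measurable borel"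
  by (intro borel_measurable_continuous_onI) (auto simp: cis_conv_exp intro!: continuous_intros)

lemma integrable_mult_cis:
  assumes "integrable M f" "u \<in> borel_measurable M"
  shows "integrable M (\<lambda>x. f x * cis (u x))"
proof (rule Bochner_Integration.integrable_bound[OF assms(1)])
  show "(\<lambda>x. f x * cis (u x)) \<in> borel_measurable M" using assms by measurable
qed (auto simp: norm_mult)

text \<open>Integration by parts: the partial of \<open>g\<close> times the character has integral
  zero, and the product rule splits it into the two sides.\<close>

lemma FT_partial:
  assumes g: "schwartz g"
  shows "FT (partial k g) \<xi> = \<i> * (\<xi> $ k) * FT g \<xi>"
proof -
  let ?c = "\<lambda>x. cis (- \<xi> \<bullet> x)"
  let ?h = "\<lambda>x. g x * ?c x"
  have dg: "g differentiable (at x)" for x using g by (simp add: schwartz_def smooth_differentiable)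
  have p: "partial k ?h x = partial k g x * ?c x - \<i> * (\<xi> $ k) * (g x * ?c x)" for x
    using partial_mult[OF dg cis_inner_deriv(1)[of "-\<xi>"]] cis_inner_deriv(2)[of k "-\<xi>" x]
    by (simp add: algebra_simps)
  have i1: "integrable lborel (\<lambda>x. g x * ?c x)" "integrable lborel (\<lambda>x. partial k g x * ?c x)"
    using schwartz_integrable[OF g] schwartz_integrable[OF schwartz_partial[OF g]]
    by (auto intro!: integrable_mult_cis)
  have "(\<integral>x. partial k ?h x \<partial>lborel) = 0"
  proof (rule integral_partial_zero)
    show "?h differentiable (at x)" for x
      using dg cis_inner_deriv(1)[of "-\<xi>"] by (rule differentiable_mult)
    show "integrable lborel ?h" using i1 by simp
    show "continuous_on UNIV (partial k ?h)"
      unfolding p using schwartz_continuous[OF g] schwartz_continuous[OF schwartz_partial[OF g]]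
      by (intro continuous_intros continuous_cis_inner)
    show "integrable lborel (partial k ?h)" unfolding p using i1 by auto
  qed
  then have "(\<integral>x. partial k g x * ?c x \<partial>lborel) - \<i> * (\<xi> $ k) * (\<integral>x. g x * ?c x \<partial>lborel) = 0"
    unfolding p using i1 by simp
  then show ?thesis by (simp add: FT_def)
qed

lemma FT_add: "schwartz f \<Longrightarrow> schwartz g \<Longrightarrow> FT (\<lambda>x. f x + g x) \<xi> = FT f \<xi> + FT g \<xi>"
  unfolding FT_def distrib_right
  by (intro Bochner_Integration.integral_add integrable_mult_cis schwartz_integrable) auto

lemma FT_cmult: "FT (\<lambda>x. c * f x) \<xi> = c * FT f \<xi>"
  unfolding FT_def by (simp add: mult.assoc)

lemma FT_sum:
  assumes "finite I" "\<And>i. i \<in> I \<Longrightarrow> schwartz (f i)"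
  shows "FT (\<lambda>x. \<Sum>i\<in>I. f i x) \<xi> = (\<Sum>i\<in>I. FT (f i) \<xi>)"
  unfolding FT_def sum_distrib_right
  using assms by (intro Bochner_Integration.integral_sum integrable_mult_cis schwartz_integrable) auto

lemma FT_Dk: "schwartz g \<Longrightarrow> FT (Dk k g) \<xi> = (\<xi> $ k) * FT g \<xi>"
  unfolding Dk_def using FT_cmult[of "- \<i>" "partial k g" \<xi>] by (simp add: FT_partial mult.assoc[symmetric])

lemma FT_Dmulti:
  assumes "schwartz g"
  shows "FT (Dmulti \<alpha> g) \<xi> = (\<Prod>k\<in>UNIV. of_real (\<xi> $ k) ^ \<alpha> k) * FT g \<xi>"
proof -
  have "FT (foldr Dk ks g) \<xi> = prod_list (map (\<lambda>k. of_real (\<xi> $ k)) ks) * FT g \<xi>" for ks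
    by (induction ks) (auto simp: FT_Dk schwartz_foldr_Dk assms)
  then show ?thesis by (simp add: Dmulti_dlist prod_list_dlist)
qed

lemma schwartz_Dmulti: "schwartz g \<Longrightarrow> schwartz (Dmulti \<alpha> g)"
  by (simp add: Dmulti_dlist schwartz_foldr_Dk)

text \<open>Multiplication by a coordinate corresponds to \<open>Dk\<close>, so a polynomial
  multiple of a transform is again a transform. As transforms are bounded, this yields their rapid
  decay.\<close>

lemma cpoly_FT:
  fixes Q :: "real^'n \<Rightarrow> complex"
  assumes "cpoly Q" "schwartz g"
  shows "\<exists>g'. schwartz g' \<and> (\<forall>\<xi>. Q \<xi> * FT g \<xi> = FT g' \<xi>)"
  using assms
proof (induction arbitrary: g rule: cpoly.induct)
  case (cpoly_const c)
  then show ?case by (intro exI[of _ "\<lambda>x. c * g x"]) (auto simp: FT_cmult schwartz_cmult)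
next
  case (cpoly_coord k)
  then show ?case by (intro exI[of _ "Dk k g"]) (auto simp: FT_Dk schwartz_Dk)
next
  case (cpoly_add P Q)
  then obtain p q where "schwartz p" "schwartz q" "\<And>\<xi>. P \<xi> * FT g \<xi> = FT p \<xi>" "\<And>\<xi>. Q \<xi> * FT g \<xi> = FT q \<xi>"
    by metis
  then show ?case by (intro exI[of _ "\<lambda>x. p x + q x"]) (auto simp: FT_add schwartz_add algebra_simps)
next
  case (cpoly_mult P Q)
  then obtain q where q: "schwartz q" "\<And>\<xi>. Q \<xi> * FT g \<xi> = FT q \<xi>" by metis
  then obtain p where "schwartz p" "\<And>\<xi>. P \<xi> * FT q \<xi> = FT p \<xi>" using cpoly_mult by metis
  then show ?case using q by (intro exI[of _ p]) (auto simp: mult.assoc)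
qed

lemma FT_bounded:
  assumes "schwartz g" shows "cmod (FT g \<xi>) \<le> (\<integral>x. cmod (g x) \<partial>lborel)"
  unfolding FT_def
  using integral_norm_bound[of lborel "\<lambda>y. g y * cis (- (\<xi> \<bullet> y))"] by (simp add: norm_mult)

lemma cpoly_inverse_weight:
  "cpoly (\<lambda>x::real^'n. complex_of_real (1 / weight x))"
proof -
  have eq: "(\<lambda>x::real^'n. complex_of_real (1 / weight x)) = (\<lambda>x. \<Prod>b\<in>Basis. 1 + of_real (x \<bullet> b) ^ 2)"
    by (auto simp: weight_def prod_dividef)
  have "cpoly (\<lambda>x::real^'n. complex_of_real (x \<bullet> b))" if "b \<in> Basis" for b
  proof -
    obtain k where "b = axis k 1" using \<open>b \<in> Basis\<close> by (auto simp: Basis_vec_def)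
    then show ?thesis by (simp add: inner_axis cpoly_coord)
  qed
  then show ?thesis
    unfolding eq by (intro cpoly_prod cpoly_add cpoly_const cpoly_power)
qed

text \<open>The reciprocal of \<open>weight\<close> is itself an admissible
  \<open>Q\<close>.\<close>

lemma decays_of_cpoly_bound:
  fixes f :: "real^'n \<Rightarrow> complex"
  assumes "\<And>Q. cpoly Q \<Longrightarrow> \<exists>C. \<forall>x. cmod (Q x * f x) \<le> C"
  shows "decays f"
proof -
  obtain C where C: "\<And>x. cmod (of_real (1 / weight x) * f x) \<le> C"
    using assms[OF cpoly_inverse_weight] by auto
  have "cmod (f x) \<le> C * weight x" for x
    using C[of x] weight_pos[of x] by (simp add: norm_mult norm_divide pos_divide_le_eq)
  then show ?thesis by (auto simp: decays_def)
qed

lemma decays_FT: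
  fixes Q :: "real^'n \<Rightarrow> complex"
  assumes "schwartz g" "cpoly Q" shows "decays (\<lambda>\<xi>. Q \<xi> * FT g \<xi>)"
proof (rule decays_of_cpoly_bound)
  fix P :: "real^'n \<Rightarrow> complex" assume "cpoly P"
  then have "cpoly (\<lambda>\<xi>. P \<xi> * Q \<xi>)" using assms by (auto intro: cpoly.intros)
  then obtain g' where "schwartz g'" "\<And>\<xi>. (P \<xi> * Q \<xi>) * FT g \<xi> = FT g' \<xi>"
    using cpoly_FT[OF _ assms(1)] by blast
  then show "\<exists>C. \<forall>x. cmod (P x * (Q x * FT g x)) \<le> C"
    using FT_bounded[of g'] by (auto simp: mult.assoc)
qed

lemma continuous_FT:
  assumes "schwartz g" shows "continuous_on A (FT g)"
proof -
  have "continuous_on UNIV (FT g)"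
    unfolding continuous_on_eq_continuous_within continuous_within_sequentially o_def
  proof (intro ballI allI impI, elim conjE)
    fix \<xi> and s :: "nat \<Rightarrow> real^'a" assume s: "s \<longlonglongrightarrow> \<xi>"
    show "(\<lambda>n. FT g (s n)) \<longlonglongrightarrow> FT g \<xi>"
      unfolding FT_def
    proof (rule integral_dominated_convergence[where w = "\<lambda>x. cmod (g x)"])
      show "integrable lborel (\<lambda>x. cmod (g x))" using schwartz_integrable[OF assms] by simp
      show "AE y in lborel. (\<lambda>i. g y * cis (- (s i \<bullet> y))) \<longlonglongrightarrow> g y * cis (- (\<xi> \<bullet> y))"
        unfolding cis_conv_exp by (intro AE_I2 tendsto_intros s)
    qed (use schwartz_measurable[OF assms] in \<open>auto simp: norm_mult\<close>)
  qed
  then show ?thesis using continuous_on_subset by blast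
qed

lemma integrable_cpoly_FT:
  assumes "schwartz g" "cpoly Q" shows "integrable lborel (\<lambda>\<xi>. Q \<xi> * FT g \<xi>)"
  using assms by (intro decays_integrable decays_FT continuous_intros continuous_FT cpoly_continuous)

lemma integrable_FT: "schwartz g \<Longrightarrow> integrable lborel (FT g)"
  using integrable_cpoly_FT[OF _ cpoly_const[of 1]] by simp

text \<open>The set where \<open>f\<close> is nonzero is open and negligible, hence empty.\<close>

lemma AE_lborel_continuous_zero:
  fixes f :: "'a::euclidean_space \<Rightarrow> 'b::real_normed_vector"
  assumes ae: "AE x in lborel. f x = 0" and cont: "continuous_on UNIV f"
  shows "f x = 0"
proof (rule ccontr)
  assume "f x \<noteq> 0"
  have "open (f -` (- {0}))" using cont by (intro open_vimage) auto
  moreover have "x \<in> f -` (- {0})" using \<open>f x \<noteq> 0\<close> by simp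
  moreover have "negligible (f -` (- {0}))"
  proof -
    have "f -` (- {0}) \<in> null_sets lborel"
      using ae \<open>open (f -` (- {0}))\<close> by (subst AE_iff_null_sets) (auto elim: AE_mp)
    then show ?thesis by (simp add: negligible_iff_null_sets null_sets_completionI)
  qed
  ultimately show False using open_not_negligible by blast
qed

lemma test_function_schwartz:
  fixes f :: "real^'n \<Rightarrow> complex"
  assumes "f \<in> test_functions UNIV" shows "schwartz f"
proof -
  define K where "K = closure {x. f x \<noteq> 0}"
  have K: "compact K" and sm: "smooth f" using assms by (auto simp: test_functions_def K_def)
  \<comment> \<open>Off the closed set \<open>K\<close> the function vanishes on a neighbourhood, so
    each further derivative vanishes as well.\<close>
  have z: "foldr partial ks f x = 0" if "x \<notin> K" for ks x
    using that
  proof (induction ks arbitrary: x)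
    case Nil
    then show ?case using closure_subset[of "{x. f x \<noteq> 0}"] by (auto simp: K_def)
  next
    case (Cons k ks)
    have "((\<lambda>x. 0) has_derivative (\<lambda>h. 0)) (at x)" by simp
    then have "(foldr partial ks f has_derivative (\<lambda>h. 0)) (at x)"
      by (rule has_derivative_transform_within_open[where s="- K"])
         (use Cons K compact_imp_closed in \<open>auto simp: open_Compl\<close>)
    then show ?case using partial_has_derivative by fastforce
  qed
  have "decays (foldr partial ks f)" for ks
  proof (rule decays_of_cpoly_bound)
    fix Q :: "real^'n \<Rightarrow> complex" assume Q: "cpoly Q"
    let ?h = "\<lambda>x. Q x * foldr partial ks f x"
    have "continuous_on K ?h"
      using Q sm by (intro continuous_intros cpoly_continuous smooth_continuous smooth_foldr_partial)
    then have "bounded (?h ` K)" using K compact_continuous_image compact_imp_bounded by blast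
    then obtain C where C: "\<And>x. x \<in> K \<Longrightarrow> cmod (?h x) \<le> C" by (auto simp: bounded_iff)
    have "cmod (?h x) \<le> max C 0" for x
      using C[of x] z[of x ks] by (cases "x \<in> K") auto
    then show "\<exists>C. \<forall>x. cmod (?h x) \<le> C" by blast
  qed
  then show ?thesis using sm by (simp add: schwartz_def)
qed

text \<open>Polynomials times \<open>exp (- E x)\<close> are closed under partials, and the
  coercivity of \<open>Re (E x)\<close> makes the exponential beat every polynomial. Both the
  Gaussian and the heat multipliers arise this way.\<close>

lemma schwartz_cpoly_exp:
  fixes E Q :: "real^'n \<Rightarrow> complex"
  assumes E: "cpoly E" and Q: "cpoly Q" and \<delta>: "0 < \<delta>" "1 \<le> m" and
    lb: "\<And>x. \<delta> * norm x ^ m \<le> Re (E x)"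
  shows "schwartz (\<lambda>x. Q x * exp (- E x))"
proof -
  define F where "F f \<longleftrightarrow> (\<exists>Q. cpoly Q \<and> f = (\<lambda>x. Q x * exp (- E x)))" for f :: "real^'n \<Rightarrow> complex"
  have dE: "(\<lambda>x. - E x) differentiable (at x)" for x
    using cpoly_differentiable[OF E] by (intro derivative_intros)
  have de: "(\<lambda>x. exp (- E x)) differentiable (at x)" for x using partial_exp(1)[OF dE] .
  have pE: "partial k (\<lambda>x. exp (- E x)) x = - partial k E x * exp (- E x)" for k x
    using partial_exp(2)[OF dE, of k x] partial_cmult[OF cpoly_differentiable[OF E], of k "-1" x] by simp
  have F0: "F (\<lambda>x. Q x * exp (- E x))" using Q by (auto simp: F_def)
  have F1: "f differentiable (at x)" if "F f" for f x
    using that cpoly_differentiable de by (auto simp: F_def intro!: differentiable_mult)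
  have F2: "F (partial k f)" if Ff: "F f" for f k
  proof -
    obtain P where P: "cpoly P" "f = (\<lambda>x. P x * exp (- E x))" using Ff by (auto simp: F_def)
    have "partial k f = (\<lambda>x. (partial k P x + (-1) * (P x * partial k E x)) * exp (- E x))"
      unfolding P(2) using partial_mult[OF cpoly_differentiable[OF P(1)] de] pE
      by (auto simp: algebra_simps)
    moreover have "cpoly (\<lambda>x. partial k P x + (-1) * (P x * partial k E x))"
      using P(1) E by (intro cpoly_add cpoly_mult cpoly_const cpoly_partial)
    ultimately show ?thesis unfolding F_def by blast
  qed
  have F3: "decays f" if Ff: "F f" for f
  proof (rule decays_of_cpoly_bound)
    fix R :: "real^'n \<Rightarrow> complex" assume R: "cpoly R"
    obtain P where P: "cpoly P" "f = (\<lambda>x. P x * exp (- E x))" using Ff by (auto simp: F_def)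
    obtain C k where C: "0 \<le> C" "\<And>x. cmod (R x * P x) \<le> C * (1 + norm x) ^ k"
      using cpoly_bound[OF cpoly_mult[OF R P(1)]] by auto
    \<comment> \<open>Chosen so that the product of \<open>Suc k\<close> copies of
      \<open>exp (d * (1 + norm x))\<close> is exactly
      \<open>exp (\<delta> * (1 + norm x))\<close>.\<close>
    define d where "d = \<delta> / real (Suc k)"
    have d: "d > 0" using \<delta> by (simp add: d_def)
    have "cmod (R x * f x) \<le> C * (exp (2 * \<delta>) / d ^ Suc k)" for x
    proof -
      let ?s = "norm x"
      have "(1 + ?s) ^ k \<le> (1 + ?s) ^ Suc k" by (rule power_increasing) auto
      also have "(d * (1 + ?s)) ^ Suc k \<le> exp (d * (1 + ?s)) ^ Suc k"
        using d exp_ge_add_one_self[of "d * (1 + ?s)"]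
        by (intro power_mono mult_nonneg_nonneg add_nonneg_nonneg norm_ge_zero) linarith+
      then have "(1 + ?s) ^ Suc k \<le> exp (\<delta> * (1 + ?s)) / d ^ Suc k"
      proof -
        have "exp (d * (1 + ?s)) ^ Suc k = exp (real (Suc k) * (d * (1 + ?s)))"
          by (rule exp_of_nat_mult[symmetric])
        also have "real (Suc k) * (d * (1 + ?s)) = \<delta> * (1 + ?s)"
          by (simp add: d_def del: of_nat_Suc)
        finally show ?thesis
          using \<open>(d * (1 + ?s)) ^ Suc k \<le> exp (d * (1 + ?s)) ^ Suc k\<close> d
          by (simp only: power_mult_distrib pos_le_divide_eq[OF zero_less_power[OF d]] mult.commute)
      qed
      finally have 1: "(1 + ?s) ^ k \<le> exp (\<delta> * (1 + ?s)) / d ^ Suc k" .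
      \<comment> \<open>A linear lower bound for the exponent is enough:
        \<open>\<delta> * (1 + ?s)\<close> and \<open>\<delta> * (?s - 1)\<close> differ by the
        constant \<open>2 * \<delta>\<close>.\<close>
      have "?s - 1 \<le> ?s ^ m"
      proof (cases "?s \<le> 1")
        case True then show ?thesis by (smt (verit) norm_ge_zero zero_le_power)
      next
        case False then have "?s ^ 1 \<le> ?s ^ m" using \<delta>(2) by (intro power_increasing) auto
        then show ?thesis by simp
      qed
      then have "\<delta> * (?s - 1) \<le> Re (E x)" using \<delta>(1) lb[of x] by (meson mult_left_mono less_imp_le order_trans)
      then have 2: "exp (- Re (E x)) \<le> exp (- \<delta> * (?s - 1))" by simp
      have "cmod (R x * f x) = cmod (R x * P x) * exp (- Re (E x))"
        by (simp add: P(2) norm_mult norm_exp_eq_Re)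
      also have "\<dots> \<le> (C * (1 + ?s) ^ k) * exp (- \<delta> * (?s - 1))"
        using C 2 by (intro mult_mono) auto
      also have "\<dots> \<le> (C * (exp (\<delta> * (1 + ?s)) / d ^ Suc k)) * exp (- \<delta> * (?s - 1))"
        using C(1) 1 by (intro mult_right_mono mult_left_mono) auto
      also have "\<dots> = C * (exp (2 * \<delta>) / d ^ Suc k)"
        by (simp add: exp_add[symmetric] algebra_simps flip: exp_add)
      finally show ?thesis .
    qed
    then show "\<exists>C. \<forall>x. cmod (R x * f x) \<le> C" by blast
  qed
  have "F (foldr partial ks (\<lambda>x. Q x * exp (- E x)))" for ks
    by (rule smooth_closed_class(1)[of F]) (use F0 F1 F2 in auto)
  moreover have "smooth (\<lambda>x. Q x * exp (- E x))"
    by (rule smooth_closed_class(2)[of F]) (use F0 F1 F2 in auto)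
  ultimately show ?thesis using F3 by (auto simp: schwartz_def)
qed

section \<open>Multipliers as superpositions of translates, and Fourier inversion\<close>

lemma FT_uminus: "FT S (- z) = (\<integral>\<eta>. S \<eta> * cis (\<eta> \<bullet> z) \<partial>lborel)"
  by (simp add: FT_def inner_commute)

lemma integrable_pair_cis:
  fixes S g :: "real^'n \<Rightarrow> complex"
  assumes S: "integrable lborel S" and g: "integrable lborel g"
  shows "integrable (lborel \<Otimes>\<^sub>M lborel) (\<lambda>(\<eta>, z). S \<eta> * (g z * cis (\<eta> \<bullet> z)))"
proof -
  have [measurable]: "S \<in> borel_measurable borel" "g \<in> borel_measurable borel" using S g by auto
  show ?thesis
  proof (rule lborel_pair.Fubini_integrable)
    show "integrable lborel (\<lambda>\<eta>. \<integral>z. norm (case (\<eta>, z) of (\<eta>, z) \<Rightarrow> S \<eta> * (g z * cis (\<eta> \<bullet> z))) \<partial>lborel)"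
      using S g by (simp add: norm_mult)
    show "AE \<eta> in lborel. integrable lborel (\<lambda>z. case (\<eta>, z) of (\<eta>, z) \<Rightarrow> S \<eta> * (g z * cis (\<eta> \<bullet> z)))"
      using integrable_mult_cis[OF g, of "\<lambda>z. _ \<bullet> z"] by (intro AE_I2) simp
  qed measurable
qed

text \<open>Substituting \<open>y = x - r z\<close> in the transform of \<open>g\<close> moves the
  dilation from the multiplier to the translates; Fubini then transforms \<open>S\<close>. No
  inversion formula enters, so inversion can be derived from this identity.\<close>

lemma FT_multiplier:
  fixes S g :: "real^'n \<Rightarrow> complex"
  assumes S: "integrable lborel S" and g: "schwartz g" and r: "0 < r"
  shows "(\<integral>\<xi>. S (r *\<^sub>R \<xi>) * (cis (x \<bullet> \<xi>) * FT g \<xi>) \<partial>lborel)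
    = (\<integral>z. FT S (- z) * g (x - r *\<^sub>R z) \<partial>lborel)"
proof -
  let ?n = "DIM(real^'n)"
  define h where "h z = g (x - r *\<^sub>R z)" for z
  have g': "integrable lborel g" using g by (rule schwartz_integrable)
  have [measurable]: "S \<in> borel_measurable borel" "g \<in> borel_measurable borel" using S g' by auto
  have h: "integrable lborel h"
    using lborel_integrable_affine[OF _ g', of "-r" x] r by (simp add: h_def[abs_def])
  then have [measurable]: "h \<in> borel_measurable borel" by auto
  define G where "G \<eta> = (\<integral>z. h z * cis (\<eta> \<bullet> z) \<partial>lborel)" for \<eta>
  have [measurable]: "G \<in> borel_measurable borel" unfolding G_def by measurable
  have "cis (x \<bullet> \<xi>) * FT g \<xi> = r ^ ?n *\<^sub>R G (r *\<^sub>R \<xi>)" for \<xi>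
  proof -
    have "FT g \<xi> = r ^ ?n *\<^sub>R (\<integral>z. h z * cis (- (\<xi> \<bullet> (x - r *\<^sub>R z))) \<partial>lborel)"
      unfolding FT_def using r
      by (subst lborel_integral_affine[of "-r" _ x]) (auto simp: h_def)
    then have "cis (x \<bullet> \<xi>) * FT g \<xi> = r ^ ?n *\<^sub>R (\<integral>z. cis (x \<bullet> \<xi>) * (h z * cis (- (\<xi> \<bullet> (x - r *\<^sub>R z)))) \<partial>lborel)"
      by simp
    also have "(\<lambda>z. cis (x \<bullet> \<xi>) * (h z * cis (- (\<xi> \<bullet> (x - r *\<^sub>R z))))) = (\<lambda>z. h z * cis (r *\<^sub>R \<xi> \<bullet> z))"
      by (auto simp: cis_mult inner_diff_right inner_commute algebra_simps)
    finally show ?thesis by (simp add: G_def)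
  qed
  then have "(\<integral>\<xi>. S (r *\<^sub>R \<xi>) * (cis (x \<bullet> \<xi>) * FT g \<xi>) \<partial>lborel)
     = r ^ ?n *\<^sub>R (\<integral>\<xi>. S (r *\<^sub>R \<xi>) * G (r *\<^sub>R \<xi>) \<partial>lborel)"
    by (simp add: mult_scaleR_right)
  also have "\<dots> = (\<integral>\<eta>. S \<eta> * G \<eta> \<partial>lborel)"
    using r by (subst (2) lborel_integral_affine[of r _ 0]) auto
  also have "\<dots> = (\<integral>\<eta>. \<integral>z. S \<eta> * (h z * cis (\<eta> \<bullet> z)) \<partial>lborel \<partial>lborel)"
    by (simp add: G_def)
  also have "\<dots> = (\<integral>z. \<integral>\<eta>. S \<eta> * (h z * cis (\<eta> \<bullet> z)) \<partial>lborel \<partial>lborel)"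
    by (rule lborel_pair.Fubini_integral[symmetric]) (rule integrable_pair_cis[OF S h])
  also have "\<dots> = (\<integral>z. FT S (- z) * h z \<partial>lborel)"
  proof (rule Bochner_Integration.integral_cong)
    fix z
    have "(\<integral>\<eta>. S \<eta> * (h z * cis (\<eta> \<bullet> z)) \<partial>lborel) = (\<integral>\<eta>. h z * (S \<eta> * cis (\<eta> \<bullet> z)) \<partial>lborel)"
      by (simp add: ac_simps)
    then show "(\<integral>\<eta>. S \<eta> * (h z * cis (\<eta> \<bullet> z)) \<partial>lborel) = FT S (- z) * h z"
      by (simp add: FT_uminus)
  qed simp
  finally show ?thesis by (simp add: h_def)
qed

text \<open>Let \<open>r\<close> tend to 0 in \<open>FT_multiplier\<close>: dominated convergence
  replaces \<open>S (r \<xi>)\<close> by \<open>S 0\<close> on one side and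
  \<open>g (x - r z)\<close> by \<open>g x\<close> on the other.\<close>

lemma FT_inversion_limit:
  fixes S g :: "real^'n \<Rightarrow> complex"
  assumes S: "schwartz S" and g: "schwartz g"
  shows "(\<integral>z. FT S (- z) \<partial>lborel) * g x = S 0 * (\<integral>\<xi>. cis (x \<bullet> \<xi>) * FT g \<xi> \<partial>lborel)"
proof -
  define r where "r n = inverse (real (Suc n))" for n
  have r0: "r \<longlonglongrightarrow> 0" unfolding r_def by (rule LIMSEQ_inverse_real_of_nat)
  have rpos: "0 < r n" for n by (simp add: r_def)
  obtain B where B: "\<And>x. cmod (S x) \<le> B" using schwartz_decays[OF S] decays_bounded by metis
  obtain D where D: "\<And>x. cmod (g x) \<le> D" using schwartz_decays[OF g] decays_bounded by metis
  have [measurable]: "S \<in> borel_measurable borel" "g \<in> borel_measurable borel"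
    "FT g \<in> borel_measurable borel" "FT S \<in> borel_measurable borel"
    by (rule schwartz_measurable[OF S] schwartz_measurable[OF g]
        borel_measurable_continuous_onI[OF continuous_FT[OF g]]
        borel_measurable_continuous_onI[OF continuous_FT[OF S]])+
  have iS: "integrable lborel (\<lambda>z. FT S (- z))"
    using lborel_integrable_affine[OF _ integrable_FT[OF S], of "-1" 0] by simp
  have lim1: "(\<lambda>n. \<integral>\<xi>. S (r n *\<^sub>R \<xi>) * (cis (x \<bullet> \<xi>) * FT g \<xi>) \<partial>lborel)
      \<longlonglongrightarrow> (\<integral>\<xi>. S 0 * (cis (x \<bullet> \<xi>) * FT g \<xi>) \<partial>lborel)"
  proof (rule integral_dominated_convergence[where w = "\<lambda>\<xi>. B * cmod (FT g \<xi>)"])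
    show "integrable lborel (\<lambda>\<xi>. B * cmod (FT g \<xi>))" using integrable_FT[OF g] by simp
    have c: "isCont S 0" using schwartz_continuous[OF S, of UNIV] by (simp add: continuous_on_eq_continuous_at)
    show "AE \<xi> in lborel. (\<lambda>n. S (r n *\<^sub>R \<xi>) * (cis (x \<bullet> \<xi>) * FT g \<xi>)) \<longlonglongrightarrow> S 0 * (cis (x \<bullet> \<xi>) * FT g \<xi>)"
    proof (intro AE_I2 tendsto_intros isCont_tendsto_compose[OF c])
      fix \<xi> :: "real^'n"
      show "(\<lambda>n. r n *\<^sub>R \<xi>) \<longlonglongrightarrow> 0" using tendsto_scaleR[OF r0 tendsto_const, of \<xi>] by simp
    qed
    show "AE \<xi> in lborel. norm (S (r n *\<^sub>R \<xi>) * (cis (x \<bullet> \<xi>) * FT g \<xi>)) \<le> B * cmod (FT g \<xi>)" for n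
      using B by (auto simp: norm_mult intro!: mult_right_mono)
  qed measurable
  have lim2: "(\<lambda>n. \<integral>z. FT S (- z) * g (x - r n *\<^sub>R z) \<partial>lborel)
      \<longlonglongrightarrow> (\<integral>z. FT S (- z) * g x \<partial>lborel)"
  proof (rule integral_dominated_convergence[where w = "\<lambda>z. cmod (FT S (- z)) * D"])
    show "integrable lborel (\<lambda>z. cmod (FT S (- z)) * D)" using iS by simp
    have c: "isCont g x" using schwartz_continuous[OF g, of UNIV] by (simp add: continuous_on_eq_continuous_at)
    show "AE z in lborel. (\<lambda>n. FT S (- z) * g (x - r n *\<^sub>R z)) \<longlonglongrightarrow> FT S (- z) * g x"
    proof (intro AE_I2 tendsto_intros isCont_tendsto_compose[OF c])
      fix z :: "real^'n"
      show "(\<lambda>n. x - r n *\<^sub>R z) \<longlonglongrightarrow> x"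
        using tendsto_diff[OF tendsto_const tendsto_scaleR[OF r0 tendsto_const, of z], of x] by simp
    qed
    show "AE z in lborel. norm (FT S (- z) * g (x - r n *\<^sub>R z)) \<le> cmod (FT S (- z)) * D" for n
      using D by (auto simp: norm_mult intro!: mult_left_mono)
  qed measurable
  have "(\<integral>z. FT S (- z) * g x \<partial>lborel) = (\<integral>\<xi>. S 0 * (cis (x \<bullet> \<xi>) * FT g \<xi>) \<partial>lborel)"
    using LIMSEQ_unique[OF lim2] lim1
    by (simp add: FT_multiplier[OF schwartz_integrable[OF S] g rpos])
  then show ?thesis by simp
qed

text \<open>The value \<open>(2\<pi>)\<^sup>n\<close> of the constant is irrelevant. Were it \<open>0\<close>, pairing the inversion formula
  for the Gaussian with the Gaussian itself would give a vanishing \<open>L\<^sup>2\<close> norm of its transform.\<close>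

lemma FT_inversion:
  obtains \<kappa> :: complex where "\<kappa> \<noteq> 0"
    "\<And>g (x :: real^'n). schwartz g \<Longrightarrow> \<kappa> * g x = (\<integral>\<xi>. cis (x \<bullet> \<xi>) * FT g \<xi> \<partial>lborel)"
proof -
  \<comment> \<open>The factor \<open>1\<close> is the polynomial \<open>Q\<close> of
    \<open>schwartz_cpoly_exp\<close>.\<close>
  define S :: "real^'n \<Rightarrow> complex" where "S x = 1 * exp (- (\<Sum>k\<in>UNIV. of_real (x $ k) ^ 2))" for x
  have Seq: "S x = of_real (exp (- (norm x)\<^sup>2))" for x
    by (simp add: S_def norm_vec_def L2_set_def sum_nonneg exp_of_real[symmetric])
  have S: "schwartz S"
    unfolding S_def
  proof (rule schwartz_cpoly_exp[where \<delta> = 1 and m = 2])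
    show "1 * (norm x)\<^sup>2 \<le> Re (\<Sum>k\<in>UNIV. complex_of_real (x $ k) ^ 2)" for x :: "real^'n"
      by (simp add: norm_vec_def L2_set_def sum_nonneg flip: of_real_power)
  qed (auto intro!: cpoly_sum cpoly_power cpoly_coord cpoly_const)
  define \<kappa> where "\<kappa> = (\<integral>z. FT S (- z) \<partial>lborel)"
  have inv: "\<kappa> * g x = (\<integral>\<xi>. cis (x \<bullet> \<xi>) * FT g \<xi> \<partial>lborel)" if "schwartz g" for g and x :: "real^'n"
    using FT_inversion_limit[OF S that, of x] by (simp add: \<kappa>_def Seq)
  have [measurable]: "S \<in> borel_measurable borel" "FT S \<in> borel_measurable borel"
    by (rule schwartz_measurable[OF S] borel_measurable_continuous_onI[OF continuous_FT[OF S]])+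
  have "\<kappa> \<noteq> 0"
  proof
    assume "\<kappa> = 0"
    have cont: "continuous_on UNIV (FT S)" by (rule continuous_FT[OF S])
    obtain C where C: "\<And>x. cmod (FT S x) \<le> C" using FT_bounded[OF S] by blast
    have I2: "integrable lborel (\<lambda>\<xi>. (cmod (FT S \<xi>))\<^sup>2)"
    proof (rule Bochner_Integration.integrable_bound)
      show "integrable lborel (\<lambda>\<xi>. C * cmod (FT S \<xi>))" using integrable_FT[OF S] by simp
      show "AE \<xi> in lborel. norm ((cmod (FT S \<xi>))\<^sup>2) \<le> norm (C * cmod (FT S \<xi>))"
        using C by (auto simp: power2_eq_square abs_mult intro!: mult_right_mono order_trans[OF C])
    qed measurable
    have rS: "cnj (S x) = S x" for x by (simp add: Seq)
    have cnj: "(\<integral>x. S x * cis (\<xi> \<bullet> x) \<partial>lborel) = cnj (FT S \<xi>)" for \<xi>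
      using Bochner_Integration.integral_cnj[of lborel "\<lambda>y. S y * cis (- (\<xi> \<bullet> y))"] unfolding FT_def by (simp add: rS cis_cnj)
    \<comment> \<open>A Plancherel computation: after exchanging the integrals the inner one is the
      conjugate of \<open>FT S\<close>, because \<open>S\<close> is real.\<close>
    have "0 = (\<integral>x. S x * (\<integral>\<xi>. cis (x \<bullet> \<xi>) * FT S \<xi> \<partial>lborel) \<partial>lborel)"
      using inv[OF S] \<open>\<kappa> = 0\<close> by simp
    also have "\<dots> = (\<integral>x. \<integral>\<xi>. S x * (FT S \<xi> * cis (x \<bullet> \<xi>)) \<partial>lborel \<partial>lborel)"
      by (simp add: ac_simps)
    also have "\<dots> = (\<integral>\<xi>. \<integral>x. S x * (FT S \<xi> * cis (x \<bullet> \<xi>)) \<partial>lborel \<partial>lborel)"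
      by (rule lborel_pair.Fubini_integral[symmetric])
         (rule integrable_pair_cis[OF schwartz_integrable[OF S] integrable_FT[OF S]])
    also have "\<dots> = (\<integral>\<xi>. FT S \<xi> * (\<integral>x. S x * cis (\<xi> \<bullet> x) \<partial>lborel) \<partial>lborel)"
      by (subst integral_mult_right_zero[symmetric]) (simp add: ac_simps inner_commute)
    also have "\<dots> = (\<integral>\<xi>. of_real ((cmod (FT S \<xi>))\<^sup>2) \<partial>lborel)"
      by (simp only: cnj complex_norm_square)
    also have "\<dots> = of_real (\<integral>\<xi>. (cmod (FT S \<xi>))\<^sup>2 \<partial>lborel)"
      using I2 by (rule integral_of_real)
    finally have z: "(\<integral>\<xi>. (cmod (FT S \<xi>))\<^sup>2 \<partial>lborel) = 0" by simp
    have "AE \<xi> in lborel. (cmod (FT S \<xi>))\<^sup>2 = 0"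
      using z integral_nonneg_eq_0_iff_AE[OF I2] by auto
    then have "AE \<xi> in lborel. FT S \<xi> = 0" by simp
    \<comment> \<open>The value at 0 is the integral of the Gaussian, which is positive everywhere;
      this is the contradiction.\<close>
    then have "FT S 0 = 0" using cont by (rule AE_lborel_continuous_zero)
    moreover have i: "integrable lborel (\<lambda>y::real^'n. exp (- (norm y)\<^sup>2))"
      using integrable_norm[OF schwartz_integrable[OF S]] by (simp add: Seq)
    moreover have "(\<integral>y. complex_of_real (exp (- (norm (y :: real^'n))\<^sup>2)) \<partial>lborel)
        = of_real (\<integral>y. exp (- (norm (y :: real^'n))\<^sup>2) \<partial>lborel)"
      using i by (rule integral_of_real)
    ultimately have z: "(\<integral>y. exp (- (norm (y :: real^'n))\<^sup>2) \<partial>lborel) = 0"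
      by (simp add: FT_def Seq del: integral_of_real)
    then have "AE y in lborel. exp (- (norm (y :: real^'n))\<^sup>2) = 0"
      using integral_nonneg_eq_0_iff_AE[OF i] by auto
    then have "AE y in (lborel :: (real^'n) measure). False" by simp
    then have "exp (0::real) = 0" by (intro AE_lborel_continuous_zero[of "\<lambda>x::real^'n. exp (0::real)"]) auto
    then show False by simp
  qed
  then show ?thesis using that inv by blast
qed

section \<open>The heat kernel of an elliptic symbol\<close>

text \<open>The antiderivative in \<open>r\<close> is \<open>- exp (- (r ^ (2*l) * E))\<close>. The
  endpoint 0 is excluded so that \<open>FT_multiplier\<close>, which requires \<open>0 < r\<close>,
  applies throughout the interval.\<close>

lemma heat_FTC:
  fixes E \<rho> :: real
  assumes "1 \<le> l" "0 \<le> \<rho>"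
  shows "has_bochner_integral lborel
    (\<lambda>r. indicator {0<..\<rho>} r *\<^sub>R (2 * real l * r ^ (2*l - 1) * E * exp (- (r ^ (2*l) * E))))
    (1 - exp (- (\<rho> ^ (2*l) * E)))"
proof -
  let ?F = "\<lambda>r. - exp (- (r ^ (2*l) * E))"
  let ?f = "\<lambda>r. 2 * real l * r ^ (2*l - 1) * E * exp (- (r ^ (2*l) * E))"
  have "has_bochner_integral lborel (\<lambda>r. indicator {0..\<rho>} r *\<^sub>R ?f r) (?F \<rho> - ?F 0)"
  proof (rule has_bochner_integral_FTC_Icc)
    show "(?F has_vector_derivative ?f r) (at r within {0..\<rho>})" for r
      unfolding has_real_derivative_iff_has_vector_derivative[symmetric]
      by (auto intro!: derivative_eq_intros)
    show "continuous_on {0..\<rho>} ?f" by (intro continuous_intros)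
  qed (use assms in auto)
  \<comment> \<open>Dropping the endpoint is exact: since \<open>2*l - 1\<close> is positive, the
    integrand vanishes at \<open>r = 0\<close>.\<close>
  moreover have "(\<lambda>r. indicator {0..\<rho>} r *\<^sub>R ?f r) = (\<lambda>r. indicator {0<..\<rho>} r *\<^sub>R ?f r)"
    using assms by (auto simp: indicator_def fun_eq_iff power_0_left)
  ultimately show ?thesis using assms by (simp add: power_0_left)
qed

text \<open>A superposition of the translates \<open>h (x - r z)\<close>. The exponent is
  \<open>2*l - 1\<close> from \<open>heat_FTC\<close> minus the degree \<open>d + l\<close> of the
  symbol built into \<open>K\<close>.\<close>

definition heat_smoothing ::
    "real \<Rightarrow> nat \<Rightarrow> nat \<Rightarrow> (real^'n \<Rightarrow> complex) \<Rightarrow> (real^'n \<Rightarrow> complex) \<Rightarrow> real^'n \<Rightarrow> complex" where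
  "heat_smoothing \<rho> l d K h x =
    (\<integral>r. indicator {0<..\<rho>} r *\<^sub>R (of_real (2 * real l * r ^ (l - 1 - d)) *
       (\<integral>z. K z * h (x - r *\<^sub>R z) \<partial>lborel)) \<partial>lborel)"

text \<open>Ellipticity enters as a uniform lower bound with constant \<delta>, which makes the heat
  multipliers decay; \<open>elliptic_imp_family\<close> obtains it by compactness.\<close>

locale elliptic_family =
  fixes J :: "'j set" and P :: "'j \<Rightarrow> real^'n \<Rightarrow> complex" and l :: nat and \<delta> :: real
  assumes finite_J: "finite J" and l: "1 \<le> l" and \<delta>: "0 < \<delta>"
    and P_poly: "\<And>j. j \<in> J \<Longrightarrow> cpoly (P j)"
    and P_homogeneous: "\<And>j r \<xi>. j \<in> J \<Longrightarrow> P j (r *\<^sub>R \<xi>) = of_real r ^ l * P j \<xi>"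
    and P_elliptic: "\<And>\<xi>. \<delta> * norm \<xi> ^ (2*l) \<le> (\<Sum>j\<in>J. (cmod (P j \<xi>))\<^sup>2)"
begin

definition E :: "real^'n \<Rightarrow> real" where "E \<xi> = (\<Sum>j\<in>J. (cmod (P j \<xi>))\<^sup>2)"

lemma E_nonneg: "0 \<le> E \<xi>" unfolding E_def by (intro sum_nonneg) auto

lemma E_homogeneous: "E (r *\<^sub>R \<xi>) = r ^ (2*l) * E \<xi>"
  unfolding E_def sum_distrib_left
  by (intro sum.cong)
     (auto simp: P_homogeneous norm_mult norm_power power_mult_distrib power_even_eq simp flip: power_abs)

lemma E_complex: "complex_of_real (E \<xi>) = (\<Sum>j\<in>J. P j \<xi> * cnj (P j \<xi>))"
  unfolding E_def of_real_sum complex_norm_square ..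

lemma E_poly: "cpoly (\<lambda>\<xi>. complex_of_real (E \<xi>))"
  unfolding E_complex by (intro cpoly_sum cpoly_mult cpoly_cnj P_poly)

text \<open>The multiplier at scale one. By homogeneity of \<open>E\<close> its dilates give every
  scale, so a single integrable kernel serves all \<open>r\<close>.\<close>

definition heat :: "(real^'n \<Rightarrow> complex) \<Rightarrow> real^'n \<Rightarrow> complex" where
  "heat Q \<xi> = Q \<xi> * exp (- of_real (E \<xi>))"

lemma schwartz_heat: "cpoly Q \<Longrightarrow> schwartz (heat Q)"
  unfolding heat_def
  by (rule schwartz_cpoly_exp[where \<delta> = \<delta> and m = "2*l"])
     (use E_poly \<delta> l P_elliptic in \<open>auto simp: E_def\<close>)

lemma heat_scale:
  assumes "\<And>r \<xi>. Q (r *\<^sub>R \<xi>) = of_real r ^ d * Q \<xi>"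
  shows "heat Q (r *\<^sub>R \<xi>) = of_real (r ^ d * exp (- (r ^ (2*l) * E \<xi>))) * Q \<xi>"
  unfolding heat_def assms E_homogeneous by (simp flip: exp_of_real)

text \<open>The frequency side of \<open>heat_smoothing\<close>: \<open>FT_multiplier\<close> treats
  each fixed \<open>r\<close>, and Fubini moves the \<open>r\<close>-integral onto the multiplier.
  Integrability is recorded because these integrals are summed over \<open>j\<close> later.\<close>

lemma heat_smoothing_eq:
  assumes j: "j \<in> J" and A: "cpoly A" "\<And>r \<xi>. A (r *\<^sub>R \<xi>) = of_real r ^ d * A \<xi>" and d: "d < l"
    and h: "schwartz h" and \<rho>: "0 < \<rho>" "\<rho> \<le> 1"
  defines "m \<equiv> \<lambda>r \<xi>. indicator {0<..\<rho>} r *\<^sub>R of_real (2 * real l * r ^ (2*l - 1) * exp (- (r ^ (2*l) * E \<xi>))) :: complex"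
  shows "heat_smoothing \<rho> l d (\<lambda>z. FT (heat (\<lambda>\<xi>. A \<xi> * cnj (P j \<xi>))) (- z)) h x =
    (\<integral>\<xi>. (\<integral>r. m r \<xi> \<partial>lborel) * (A \<xi> * cnj (P j \<xi>) * (cis (x \<bullet> \<xi>) * FT h \<xi>)) \<partial>lborel)"
    and "integrable lborel (\<lambda>\<xi>. (\<integral>r. m r \<xi> \<partial>lborel) * (A \<xi> * cnj (P j \<xi>) * (cis (x \<bullet> \<xi>) * FT h \<xi>)))"
proof -
  define Q where "Q \<xi> = A \<xi> * cnj (P j \<xi>)" for \<xi>
  have Q: "cpoly Q" unfolding Q_def using A(1) P_poly[OF j] by (intro cpoly_mult cpoly_cnj)
  have Qh: "Q (r *\<^sub>R \<xi>) = of_real r ^ (d + l) * Q \<xi>" for r \<xi>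
    by (simp add: Q_def A P_homogeneous[OF j] power_add)
  define G where "G \<xi> = Q \<xi> * (cis (x \<bullet> \<xi>) * FT h \<xi>)" for \<xi>
  have "integrable lborel (\<lambda>\<xi>. Q \<xi> * FT h \<xi> * cis (x \<bullet> \<xi>))"
    by (intro integrable_mult_cis integrable_cpoly_FT h Q) simp
  then have G: "integrable lborel G" unfolding G_def by (simp add: ac_simps)
  have [measurable]: "G \<in> borel_measurable borel" using G by auto
  have contE: "continuous_on UNIV E"
    unfolding E_def using cpoly_continuous[OF P_poly] by (intro continuous_intros) auto
  have [measurable]: "E \<in> borel_measurable borel" by (rule borel_measurable_continuous_onI[OF contE])
  \<comment> \<open>A bound uniform in the frequency, valid because \<open>\<rho> \<le> 1\<close>
    and \<open>E\<close> is nonnegative; it supplies the majorant for Fubini.\<close>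
  have mb: "cmod (m r \<xi>) \<le> indicator {0<..\<rho>} r * (2 * real l)" for r \<xi>
  proof (cases "r \<in> {0<..\<rho>}")
    case True
    then have "r ^ (2*l - 1) \<le> 1" using \<rho> by (intro power_le_one) auto
    moreover have "exp (- (r ^ (2*l) * E \<xi>)) \<le> 1" using True E_nonneg[of \<xi>] by auto
    ultimately have "r ^ (2*l - 1) * exp (- (r ^ (2*l) * E \<xi>)) \<le> 1"
      using True by (intro mult_le_one) auto
    then have "2 * real l * (r ^ (2*l - 1) * exp (- (r ^ (2*l) * E \<xi>))) \<le> 2 * real l * 1"
      by (intro mult_left_mono) auto
    then show ?thesis using True unfolding m_def by (simp add: norm_mult norm_power mult.assoc)
  qed (simp add: m_def)
  have [measurable]: "(\<lambda>(r, \<xi>). m r \<xi>) \<in> borel_measurable (borel \<Otimes>\<^sub>M borel)"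
    unfolding m_def by measurable
  have I: "integrable (lborel \<Otimes>\<^sub>M lborel) (\<lambda>(r, \<xi>). m r \<xi> * G \<xi>)"
  proof (rule Bochner_Integration.integrable_bound)
    show "integrable (lborel \<Otimes>\<^sub>M lborel)
      (\<lambda>(r::real, \<xi>). indicator {0<..\<rho>} r * (2 * real l) * cmod (G \<xi>))"
    proof (rule lborel_pair.Fubini_integrable)
      show "integrable lborel (\<lambda>r::real. \<integral>\<xi>. norm (case (r, \<xi>) of (r, \<xi>) \<Rightarrow> indicator {0<..\<rho>} r * (2 * real l) * cmod (G \<xi>)) \<partial>lborel)"
        using \<rho> by (simp add: abs_mult)
    qed (use G in \<open>auto intro!: AE_I2\<close>)
    show "AE z in lborel \<Otimes>\<^sub>M lborel. norm (case z of (r, \<xi>) \<Rightarrow> m r \<xi> * G \<xi>)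
       \<le> norm (case z of (r::real, \<xi>) \<Rightarrow> indicator {0<..\<rho>} r * (2 * real l) * cmod (G \<xi>))"
      using mult_right_mono[OF mb] by (intro AE_I2) (auto simp: norm_mult split: prod.splits)
  qed measurable
  have inner: "indicator {0<..\<rho>} r *\<^sub>R (of_real (2 * real l * r ^ (l - 1 - d)) *
       (\<integral>z. FT (heat Q) (- z) * h (x - r *\<^sub>R z) \<partial>lborel)) = (\<integral>\<xi>. m r \<xi> * G \<xi> \<partial>lborel)" for r
  proof (cases "r \<in> {0<..\<rho>}")
    case True
    then have r: "0 < r" by simp
    \<comment> \<open>Homogeneity of \<open>Q\<close> supplies \<open>r ^ (d + l)\<close>; the
      truncated subtraction is exact since \<open>d < l\<close>.\<close>
    have e: "r ^ (l - 1 - d) * r ^ (d + l) = r ^ (2*l - 1)"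
      using d l by (simp add: mult_2 flip: power_add)
    have "(\<integral>z. FT (heat Q) (- z) * h (x - r *\<^sub>R z) \<partial>lborel)
       = (\<integral>\<xi>. heat Q (r *\<^sub>R \<xi>) * (cis (x \<bullet> \<xi>) * FT h \<xi>) \<partial>lborel)"
      by (rule FT_multiplier[symmetric]) (use schwartz_integrable[OF schwartz_heat[OF Q]] h r in auto)
    then have "of_real (2 * real l * r ^ (l - 1 - d)) * (\<integral>z. FT (heat Q) (- z) * h (x - r *\<^sub>R z) \<partial>lborel)
       = (\<integral>\<xi>. of_real (2 * real l * r ^ (l - 1 - d)) * (heat Q (r *\<^sub>R \<xi>) * (cis (x \<bullet> \<xi>) * FT h \<xi>)) \<partial>lborel)"
      by simp
    also have "\<dots> = (\<integral>\<xi>. m r \<xi> * G \<xi> \<partial>lborel)"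
    proof (rule Bochner_Integration.integral_cong)
      fix \<xi>
      have "of_real (2 * real l * r ^ (l - 1 - d)) * (heat Q (r *\<^sub>R \<xi>) * (cis (x \<bullet> \<xi>) * FT h \<xi>))
        = of_real (2 * real l * (r ^ (l - 1 - d) * r ^ (d + l)) * exp (- (r ^ (2*l) * E \<xi>))) * G \<xi>"
        unfolding heat_scale[OF Qh] G_def by simp
      moreover have "m r \<xi> = of_real (2 * real l * r ^ (2*l - 1) * exp (- (r ^ (2*l) * E \<xi>)))"
        using True by (simp add: m_def)
      ultimately show "of_real (2 * real l * r ^ (l - 1 - d)) * (heat Q (r *\<^sub>R \<xi>) * (cis (x \<bullet> \<xi>) * FT h \<xi>)) = m r \<xi> * G \<xi>"
        unfolding e by simp
    qed simp
    finally show ?thesis using True by simp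
  qed (simp add: m_def)
  have swap: "m r \<xi> * G \<xi> = m r \<xi> * (A \<xi> * cnj (P j \<xi>) * (cis (x \<bullet> \<xi>) * FT h \<xi>))" for r \<xi>
    by (simp add: G_def Q_def)
  have "heat_smoothing \<rho> l d (\<lambda>z. FT (heat Q) (- z)) h x = (\<integral>r. \<integral>\<xi>. m r \<xi> * G \<xi> \<partial>lborel \<partial>lborel)"
    unfolding heat_smoothing_def inner ..
  also have "\<dots> = (\<integral>\<xi>. \<integral>r. m r \<xi> * G \<xi> \<partial>lborel \<partial>lborel)"
    by (rule lborel_pair.Fubini_integral[symmetric]) (rule I)
  finally have 1: "heat_smoothing \<rho> l d (\<lambda>z. FT (heat Q) (- z)) h x = (\<integral>\<xi>. (\<integral>r. m r \<xi> \<partial>lborel) * G \<xi> \<partial>lborel)"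
    by simp
  then show "heat_smoothing \<rho> l d (\<lambda>z. FT (heat (\<lambda>\<xi>. A \<xi> * cnj (P j \<xi>))) (- z)) h x =
    (\<integral>\<xi>. (\<integral>r. m r \<xi> \<partial>lborel) * (A \<xi> * cnj (P j \<xi>) * (cis (x \<bullet> \<xi>) * FT h \<xi>)) \<partial>lborel)"
    unfolding G_def Q_def .
  have "integrable lborel (\<lambda>\<xi>. \<integral>r. m r \<xi> * G \<xi> \<partial>lborel)"
    using lborel_pair.integrable_snd[OF I] by simp
  then show "integrable lborel (\<lambda>\<xi>. (\<integral>r. m r \<xi> \<partial>lborel) * (A \<xi> * cnj (P j \<xi>) * (cis (x \<bullet> \<xi>) * FT h \<xi>)))"
    unfolding G_def Q_def by simp
qed

lemma heat_representation:
  assumes A: "cpoly A" "\<And>r \<xi>. A (r *\<^sub>R \<xi>) = of_real r ^ d * A \<xi>" and d: "d < l"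
    and f: "schwartz f" and \<rho>: "0 < \<rho>" "\<rho> \<le> 1"
    and h: "\<And>j. j \<in> J \<Longrightarrow> schwartz (h j)" "\<And>j \<xi>. j \<in> J \<Longrightarrow> FT (h j) \<xi> = P j \<xi> * FT f \<xi>"
  shows "(\<integral>\<xi>. cis (x \<bullet> \<xi>) * (A \<xi> * FT f \<xi>) \<partial>lborel) =
      of_real (1 / \<rho> ^ d) * (\<integral>z. FT (heat A) (- z) * f (x - \<rho> *\<^sub>R z) \<partial>lborel)
      + (\<Sum>j\<in>J. heat_smoothing \<rho> l d (\<lambda>z. FT (heat (\<lambda>\<xi>. A \<xi> * cnj (P j \<xi>))) (- z)) (h j) x)"
proof -
  define m :: "real \<Rightarrow> real^'n \<Rightarrow> complex"
    where "m = (\<lambda>r \<xi>. indicator {0<..\<rho>} r *\<^sub>R of_real (2 * real l * r ^ (2*l - 1) * exp (- (r ^ (2*l) * E \<xi>))))"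
  define G where "G \<xi> = cis (x \<bullet> \<xi>) * (A \<xi> * FT f \<xi>)" for \<xi>
  have "integrable lborel (\<lambda>\<xi>. A \<xi> * FT f \<xi> * cis (x \<bullet> \<xi>))"
    by (intro integrable_mult_cis integrable_cpoly_FT f A) simp
  then have G: "integrable lborel G" unfolding G_def by (simp add: ac_simps)
  have [measurable]: "G \<in> borel_measurable borel" using G by auto
  have contE: "continuous_on UNIV E"
    unfolding E_def using cpoly_continuous[OF P_poly] by (intro continuous_intros) auto
  have [measurable]: "E \<in> borel_measurable borel" by (rule borel_measurable_continuous_onI[OF contE])
  let ?e = "\<lambda>\<xi>. complex_of_real (exp (- (\<rho> ^ (2*l) * E \<xi>)))"
  have "(\<integral>z. FT (heat A) (- z) * f (x - \<rho> *\<^sub>R z) \<partial>lborel)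
       = (\<integral>\<xi>. heat A (\<rho> *\<^sub>R \<xi>) * (cis (x \<bullet> \<xi>) * FT f \<xi>) \<partial>lborel)"
    by (rule FT_multiplier[symmetric]) (use schwartz_integrable[OF schwartz_heat[OF A(1)]] f \<rho> in auto)
  then have "of_real (1 / \<rho> ^ d) * (\<integral>z. FT (heat A) (- z) * f (x - \<rho> *\<^sub>R z) \<partial>lborel)
    = (\<integral>\<xi>. of_real (1 / \<rho> ^ d) * (heat A (\<rho> *\<^sub>R \<xi>) * (cis (x \<bullet> \<xi>) * FT f \<xi>)) \<partial>lborel)" by simp
  also have "\<dots> = (\<integral>\<xi>. ?e \<xi> * G \<xi> \<partial>lborel)"
    unfolding heat_scale[OF A(2)] G_def using \<rho>
    by (intro Bochner_Integration.integral_cong) (auto simp: field_simps)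
  finally have T1: "of_real (1 / \<rho> ^ d) * (\<integral>z. FT (heat A) (- z) * f (x - \<rho> *\<^sub>R z) \<partial>lborel)
     = (\<integral>\<xi>. ?e \<xi> * G \<xi> \<partial>lborel)" .
  have i1: "integrable lborel (\<lambda>\<xi>. ?e \<xi> * G \<xi>)"
  proof (rule Bochner_Integration.integrable_bound[OF G])
    show "AE \<xi> in lborel. norm (?e \<xi> * G \<xi>) \<le> norm (G \<xi>)"
    proof (intro AE_I2)
      fix \<xi>
      have "cmod (?e \<xi>) \<le> 1" using \<rho> E_nonneg[of \<xi>] by simp
      then show "norm (?e \<xi> * G \<xi>) \<le> norm (G \<xi>)"
        using mult_right_mono[of "cmod (?e \<xi>)" 1 "cmod (G \<xi>)"] by (simp add: norm_mult)
    qed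
  qed measurable
  \<comment> \<open>Kept as a product with \<open>E\<close>, so that nothing is divided by
    \<open>E\<close> at the zero frequency.\<close>
  have m: "(\<integral>r. m r \<xi> \<partial>lborel) * of_real (E \<xi>) = 1 - ?e \<xi>" for \<xi>
  proof -
    have "(\<integral>r. m r \<xi> \<partial>lborel) * of_real (E \<xi>) = (\<integral>r. m r \<xi> * of_real (E \<xi>) \<partial>lborel)" by simp
    also have "\<dots> = (\<integral>r. of_real (indicator {0<..\<rho>} r *\<^sub>R (2 * real l * r ^ (2*l - 1) * E \<xi> * exp (- (r ^ (2*l) * E \<xi>)))) \<partial>lborel)"
      unfolding m_def by (intro Bochner_Integration.integral_cong) (auto simp: indicator_def)
    also have "\<dots> = of_real (1 - exp (- (\<rho> ^ (2*l) * E \<xi>)))"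
      using heat_FTC[OF l, of \<rho> "E \<xi>"] \<rho>
      by (intro has_bochner_integral_integral_eq has_bochner_integral_of_real) simp
    finally show ?thesis by simp
  qed
  let ?s = "\<lambda>j \<xi>. (\<integral>r. m r \<xi> \<partial>lborel) * (A \<xi> * cnj (P j \<xi>) * (cis (x \<bullet> \<xi>) * FT (h j) \<xi>))"
  have i2: "integrable lborel (?s j)" and
    T2: "heat_smoothing \<rho> l d (\<lambda>z. FT (heat (\<lambda>\<xi>. A \<xi> * cnj (P j \<xi>))) (- z)) (h j) x = (\<integral>\<xi>. ?s j \<xi> \<partial>lborel)"
    if "j \<in> J" for j
    unfolding m_def using heat_smoothing_eq[OF that A d h(1)[OF that] \<rho>, of x] by auto
  have "(\<Sum>j\<in>J. ?s j \<xi>) = (1 - ?e \<xi>) * G \<xi>" for \<xi>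
  proof -
    \<comment> \<open>The conjugate symbols recombine with \<open>FT (h j)\<close> to
      \<open>E\<close> times \<open>FT f\<close>, which \<open>m\<close> then turns into the
      complement of the exponential.\<close>
    have "(\<Sum>j\<in>J. ?s j \<xi>) = (\<Sum>j\<in>J. P j \<xi> * cnj (P j \<xi>)) * ((\<integral>r. m r \<xi> \<partial>lborel) * G \<xi>)"
      unfolding sum_distrib_right by (intro sum.cong) (auto simp: h(2) G_def)
    then show ?thesis using m[of \<xi>] by (simp add: E_complex[symmetric] ac_simps)
  qed
  then have "G \<xi> = ?e \<xi> * G \<xi> + (\<Sum>j\<in>J. ?s j \<xi>)" for \<xi> by (simp add: algebra_simps)
  then have "(\<integral>\<xi>. G \<xi> \<partial>lborel) = (\<integral>\<xi>. ?e \<xi> * G \<xi> + (\<Sum>j\<in>J. ?s j \<xi>) \<partial>lborel)" by presburger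
  also have "\<dots> = (\<integral>\<xi>. ?e \<xi> * G \<xi> \<partial>lborel) + (\<Sum>j\<in>J. \<integral>\<xi>. ?s j \<xi> \<partial>lborel)"
    using i1 i2 by (subst Bochner_Integration.integral_add) (auto intro!: Bochner_Integration.integrable_sum Bochner_Integration.integral_sum)
  finally show ?thesis unfolding T1 G_def using T2 by simp
qed

end

section \<open>The \<open>L\<^sup>p\<close> norm\<close>

abbreviation Lp :: "ennreal \<Rightarrow> (real^'n \<Rightarrow> complex) \<Rightarrow> ennreal" where
  "Lp p f \<equiv> Lp_norm p UNIV f"

text \<open>By convexity the power lies above its tangent at \<open>c\<close>. For
  \<open>1 < P\<close> this is Young's inequality with conjugate exponents \<open>P\<close> and
  \<open>P / (P - 1)\<close>.\<close>

lemma powr_tangent: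
  fixes c u P :: real
  assumes "1 \<le> P" "0 < c" "0 \<le> u"
  shows "P * c powr (P - 1) * u \<le> u powr P + (P - 1) * c powr P"
proof (cases "P = 1")
  case False
  then have P: "1 < P" using assms by simp
  define q where "q = P / (P - 1)"
  have "u * c powr (P - 1) \<le> u powr P / P + (c powr (P - 1)) powr q / q"
    by (rule Youngs_inequality) (use P assms in \<open>auto simp: q_def field_simps\<close>)
  also have "(c powr (P - 1)) powr q = c powr P" using P by (simp add: powr_powr q_def)
  finally show ?thesis using P by (simp add: q_def field_simps)
qed (use assms in simp)

text \<open>Jensen's inequality for a density of mass at most \<open>K\<close>, obtained by
  integrating a tangent inequality. The right-hand side may be infinite, and \<open>a\<close> need
  only lie below the weighted integral.\<close>

lemma powr_jensen:
  fixes w u :: "'m \<Rightarrow> real"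
  assumes [measurable]: "w \<in> borel_measurable M" "u \<in> borel_measurable M"
    and w: "\<And>m. 0 \<le> w m" and u: "\<And>m. 0 \<le> u m" and P: "1 \<le> P" and K: "0 < K" and a: "0 \<le> a"
    and wK: "(\<integral>\<^sup>+m. w m \<partial>M) \<le> ennreal K" and au: "ennreal a \<le> (\<integral>\<^sup>+m. w m * u m \<partial>M)"
  shows "ennreal (a powr P) \<le> ennreal (K powr (P - 1)) * (\<integral>\<^sup>+m. w m * u m powr P \<partial>M)"
proof (cases "a = 0")
  case False
  then have a: "0 < a" using a by simp
  \<comment> \<open>The tangent point is the mean value. With it the left side splits so that the
    finite term \<open>(P - 1) * c powr P * K\<close> cancels.\<close>
  define c where "c = a / K"
  have c: "0 < c" using a K by (simp add: c_def)
  let ?B = "\<integral>\<^sup>+m. w m * u m powr P \<partial>M"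
  have "ennreal (P * c powr (P - 1) * a) \<le> ennreal (P * c powr (P - 1)) * (\<integral>\<^sup>+m. w m * u m \<partial>M)"
    using au P a by (subst ennreal_mult) (auto intro!: mult_left_mono simp del: ennreal_mult')
  also have "\<dots> = (\<integral>\<^sup>+m. ennreal (P * c powr (P - 1)) * ennreal (w m * u m) \<partial>M)"
    by (rule nn_integral_cmult[symmetric]) measurable
  also have "\<dots> \<le> (\<integral>\<^sup>+m. ennreal (w m * u m powr P) + ennreal ((P - 1) * c powr P) * ennreal (w m) \<partial>M)"
  proof (intro nn_integral_mono)
    fix m
    have "w m * (P * c powr (P - 1) * u m) \<le> w m * (u m powr P + (P - 1) * c powr P)"
      by (intro mult_left_mono powr_tangent P c u w)
    then have "ennreal (P * c powr (P - 1) * (w m * u m))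
       \<le> ennreal (w m * u m powr P + (P - 1) * c powr P * w m)"
      by (intro ennreal_leI) (simp add: algebra_simps)
    also have "\<dots> = ennreal (w m * u m powr P) + ennreal ((P - 1) * c powr P) * ennreal (w m)"
      using P w[of m] by (subst ennreal_plus) (auto intro!: ennreal_mult mult_nonneg_nonneg)
    finally show "ennreal (P * c powr (P - 1)) * ennreal (w m * u m)
       \<le> ennreal (w m * u m powr P) + ennreal ((P - 1) * c powr P) * ennreal (w m)"
      using P w[of m] u[of m] by (subst ennreal_mult[symmetric]) auto
  qed
  also have "\<dots> = ?B + ennreal ((P - 1) * c powr P) * (\<integral>\<^sup>+m. w m \<partial>M)"
    by (subst nn_integral_add) (auto simp: nn_integral_cmult)
  also have "\<dots> \<le> ?B + ennreal ((P - 1) * c powr P * K)"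
    using wK P K by (auto simp: ennreal_mult intro!: add_left_mono mult_left_mono)
  finally have *: "ennreal (P * c powr (P - 1) * a) \<le> ?B + ennreal ((P - 1) * c powr P * K)" .
  have "c powr (P - 1) * a = c powr P * K"
    using a K by (simp add: powr_diff c_def)
  then have "P * c powr (P - 1) * a = c powr P * K + (P - 1) * c powr P * K"
    by (simp add: algebra_simps)
  then have "ennreal (c powr P * K) + ennreal ((P - 1) * c powr P * K) \<le> ?B + ennreal ((P - 1) * c powr P * K)"
    using * P K by (simp add: ennreal_plus[symmetric] del: ennreal_plus)
  then have **: "ennreal (c powr P * K) \<le> ?B"
    by (simp add: ennreal_add_left_cancel_le add.commute)
  have "a powr P = K powr (P - 1) * (c powr P * K)"
    using K a by (simp add: c_def powr_divide powr_diff)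
  then have "ennreal (a powr P) = ennreal (K powr (P - 1)) * ennreal (c powr P * K)"
    by (simp add: ennreal_mult')
  also have "\<dots> \<le> ennreal (K powr (P - 1)) * ?B" using ** by (rule mult_left_mono) simp
  finally show ?thesis .
qed simp

lemma Lp_infinity_le_iff:
  assumes "f \<in> borel_measurable lebesgue" "0 \<le> C"
  shows "Lp \<infinity> f \<le> ennreal C \<longleftrightarrow> (AE x in lborel. norm (f x) \<le> C)"
proof
  have m: "(\<lambda>x. ennreal (norm (f x))) \<in> borel_measurable lebesgue" using assms by measurable
  show "AE x in lborel. norm (f x) \<le> C" if "Lp \<infinity> f \<le> ennreal C"
  proof -
    have "AE x in lebesgue. ennreal (norm (f x)) \<le> Lp \<infinity> f"
      unfolding Lp_norm_def lebesgue_on_UNIV_eq using esssup_AE by simp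
    then have "AE x in lebesgue. norm (f x) \<le> C"
    proof (rule AE_mp, intro AE_I2 impI)
      fix x assume "ennreal (norm (f x)) \<le> Lp \<infinity> f"
      then have "ennreal (norm (f x)) \<le> ennreal C" using that by (rule order_trans)
      then show "norm (f x) \<le> C" using assms by (simp add: ennreal_le_iff)
    qed
    then show ?thesis by (simp add: AE_completion_iff)
  qed
  show "Lp \<infinity> f \<le> ennreal C" if "AE x in lborel. norm (f x) \<le> C"
  proof -
    have "AE x in lebesgue. ennreal (norm (f x)) \<le> ennreal C"
      using that assms by (simp add: AE_completion_iff ennreal_le_iff)
    then show ?thesis unfolding Lp_norm_def lebesgue_on_UNIV_eq using m by (simp add: esssup_I)
  qed
qed

lemma enn2real_ge_1: "1 \<le> p \<Longrightarrow> p \<noteq> \<infinity> \<Longrightarrow> 1 \<le> enn2real p"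
  by (metis enn2real_1 enn2real_mono infinity_ennreal_def top.not_eq_extremum)

text \<open>Norms are compared only with finite constants; this removes the root and the infinite
  case from the definition, as \<open>Lp_infinity_le_iff\<close> removes the essential
  supremum.\<close>

lemma Lp_finite_le_iff:
  assumes "1 \<le> p" "p \<noteq> \<infinity>" "0 \<le> C"
  shows "Lp p f \<le> ennreal C \<longleftrightarrow>
    (\<integral>\<^sup>+x. ennreal (norm (f x) powr enn2real p) \<partial>lborel) \<le> ennreal (C powr enn2real p)"
proof -
  define P where "P = enn2real p"
  define I where "I = (\<integral>\<^sup>+x. ennreal (norm (f x) powr P) \<partial>lborel)"
  have P: "0 < P" using enn2real_ge_1[OF assms(1,2)] by (simp add: P_def)
  have L: "Lp p f = (if I = \<infinity> then \<infinity> else ennreal (enn2real I powr (1 / P)))"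
    using assms(2) unfolding Lp_norm_def I_def P_def lebesgue_on_UNIV_eq nn_integral_completion Let_def by simp
  have "ennreal (i powr (1 / P)) \<le> ennreal C \<longleftrightarrow> ennreal i \<le> ennreal (C powr P)" if "0 \<le> i" for i
  proof -
    have "i powr (1 / P) \<le> C \<longleftrightarrow> i \<le> C powr P"
    proof
      assume "i powr (1 / P) \<le> C"
      then have "(i powr (1 / P)) powr P \<le> C powr P" using P by (intro powr_mono2) auto
      then show "i \<le> C powr P" using P that by (simp add: powr_powr)
    next
      assume "i \<le> C powr P"
      then have "i powr (1 / P) \<le> (C powr P) powr (1 / P)" using P that by (intro powr_mono2) auto
      then show "i powr (1 / P) \<le> C" using P assms(3) by (simp add: powr_powr)
    qed
    then show ?thesis using that assms(3) by (simp add: ennreal_le_iff)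
  qed
  then have "Lp p f \<le> ennreal C \<longleftrightarrow> I \<le> ennreal (C powr P)"
    unfolding L by (cases I) (auto simp: top_unique)
  then show ?thesis unfolding I_def P_def .
qed

lemma Lp_cases:
  obtains "Lp p f = \<infinity>" | C where "0 \<le> C" "Lp p f = ennreal C"
  by (cases "Lp p f") auto

lemma Lp_dominated:
  assumes p: "1 \<le> p" and meas: "f \<in> borel_measurable lebesgue" "g \<in> borel_measurable lebesgue"
    and K: "0 \<le> K" and ae: "AE x in lborel. norm (g x) \<le> K * norm (f x)"
  shows "Lp p g \<le> ennreal K * Lp p f"
proof -
  \<comment> \<open>The alternative \<open>K = 0\<close> covers the product of 0 with an infinite
    norm of \<open>f\<close>, where no finite \<open>C\<close> bounds \<open>f\<close>.\<close>
  have fin: "Lp p g \<le> ennreal (K * C)" if C: "0 \<le> C" "K = 0 \<or> Lp p f \<le> ennreal C" for C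
  proof (cases "p = \<infinity>")
    case True
    have "AE x in lborel. K * norm (f x) \<le> K * C"
    proof (cases "K = 0")
      case False
      then have "AE x in lborel. norm (f x) \<le> C" using C True Lp_infinity_le_iff[OF meas(1) C(1)] by simp
      then show ?thesis by eventually_elim (rule mult_left_mono[OF _ K])
    qed simp
    with ae have "AE x in lborel. norm (g x) \<le> K * C" by eventually_elim linarith
    then show ?thesis using Lp_infinity_le_iff[OF meas(2), of "K * C"] C K True by simp
  next
    case False
    let ?P = "enn2real p"
    have P: "1 \<le> ?P" using p False by (rule enn2real_ge_1)
    have "(\<integral>\<^sup>+x. ennreal (norm (g x) powr ?P) \<partial>lborel) \<le> (\<integral>\<^sup>+x. ennreal (K powr ?P) * ennreal (norm (f x) powr ?P) \<partial>lborel)"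
    proof (rule nn_integral_mono_AE, use ae in eventually_elim)
      case (elim x)
      then have "norm (g x) powr ?P \<le> (K * norm (f x)) powr ?P" using P by (intro powr_mono2) auto
      then show ?case
        using K by (simp add: powr_mult ennreal_mult[symmetric] ennreal_leI)
    qed
    also have "\<dots> = (\<integral>\<^sup>+x. ennreal (K powr ?P) * ennreal (norm (f x) powr ?P) \<partial>lebesgue)"
      by (simp add: nn_integral_completion)
    also have "\<dots> = ennreal (K powr ?P) * (\<integral>\<^sup>+x. ennreal (norm (f x) powr ?P) \<partial>lebesgue)"
      by (rule nn_integral_cmult) (use meas in measurable)
    also have "\<dots> = ennreal (K powr ?P) * (\<integral>\<^sup>+x. ennreal (norm (f x) powr ?P) \<partial>lborel)"
      by (simp add: nn_integral_completion)
    also have "\<dots> \<le> ennreal (K powr ?P) * ennreal (C powr ?P)"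
      using C Lp_finite_le_iff[OF p False C(1), of f] P by (cases "K = 0") (auto intro!: mult_left_mono)
    also have "\<dots> = ennreal ((K * C) powr ?P)" using K C by (simp add: powr_mult ennreal_mult)
    finally show ?thesis using Lp_finite_le_iff[OF p False, of "K * C" g] K C by simp
  qed
  show ?thesis
  proof (cases "K = 0")
    case True then show ?thesis using fin[of 0] by simp
  next
    case False
    show ?thesis
    proof (cases rule: Lp_cases[of p f])
      case 1 then show ?thesis using False K by (simp add: ennreal_mult_top)
    next
      case (2 C) then show ?thesis using fin[of C] K by (simp add: ennreal_mult)
    qed
  qed
qed

lemma Lp_mono:
  assumes "1 \<le> p" "f \<in> borel_measurable lebesgue" "g \<in> borel_measurable lebesgue"
    and "AE x in lborel. norm (g x) \<le> norm (f x)"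
  shows "Lp p g \<le> Lp p f"
  using Lp_dominated[OF assms(1-3), of 1] assms(4) by simp

lemma Lp_zero: "1 \<le> p \<Longrightarrow> Lp p (\<lambda>x. 0) = 0"
  using Lp_dominated[of p "\<lambda>x. 0" "\<lambda>x. 0" 0] by simp

text \<open>A quasi-triangle inequality. One factor 2 comes from bounding the sum by twice the
  maximum, the other from
  \<open>C powr P + D powr P \<le> 2 powr P * (C + D) powr P\<close>.\<close>

lemma Lp_add:
  assumes p: "1 \<le> p" and meas: "f \<in> borel_measurable lebesgue" "g \<in> borel_measurable lebesgue"
  shows "Lp p (\<lambda>x. f x + g x) \<le> 4 * (Lp p f + Lp p g)"
proof (cases rule: Lp_cases[of p f])
  case (2 C)
  show ?thesis
  proof (cases rule: Lp_cases[of p g])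
    case (2 D)
    note C = \<open>0 \<le> C\<close> \<open>Lp p f = ennreal C\<close>
    note D = 2
    have "Lp p (\<lambda>x. f x + g x) \<le> ennreal (4 * (C + D))"
    proof (cases "p = \<infinity>")
      case True
      have "AE x in lborel. norm (f x) \<le> C" "AE x in lborel. norm (g x) \<le> D"
        using Lp_infinity_le_iff[OF meas(1) C(1)] Lp_infinity_le_iff[OF meas(2) D(1)] C D True by auto
      then have "AE x in lborel. norm (f x + g x) \<le> 4 * (C + D)"
        by eventually_elim (use C(1) D(1) norm_triangle_mono in fastforce)
      then show ?thesis using Lp_infinity_le_iff[of "\<lambda>x. f x + g x" "4 * (C + D)"] meas C D True by simp
    next
      case False
      let ?P = "enn2real p"
      have P: "1 \<le> ?P" using p False by (rule enn2real_ge_1)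
      have m: "(\<lambda>x. ennreal (norm (f x) powr ?P)) \<in> borel_measurable lebesgue"
        "(\<lambda>x. ennreal (norm (g x) powr ?P)) \<in> borel_measurable lebesgue" using meas by measurable
      have "(\<integral>\<^sup>+x. ennreal (norm (f x + g x) powr ?P) \<partial>lborel)
         \<le> (\<integral>\<^sup>+x. ennreal (2 powr ?P) * (ennreal (norm (f x) powr ?P) + ennreal (norm (g x) powr ?P)) \<partial>lborel)"
      proof (intro nn_integral_mono)
        fix x
        let ?M = "max (norm (f x)) (norm (g x))"
        have "norm (f x + g x) \<le> 2 * ?M" using norm_triangle_ineq[of "f x" "g x"] by linarith
        then have "norm (f x + g x) powr ?P \<le> (2 * ?M) powr ?P" using P by (intro powr_mono2) auto
        also have "\<dots> = 2 powr ?P * ?M powr ?P" by (rule powr_mult)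
        also have "?M powr ?P \<le> norm (f x) powr ?P + norm (g x) powr ?P" by (simp add: max_def)
        finally show "ennreal (norm (f x + g x) powr ?P)
            \<le> ennreal (2 powr ?P) * (ennreal (norm (f x) powr ?P) + ennreal (norm (g x) powr ?P))"
          by (simp add: ennreal_mult[symmetric] ennreal_plus[symmetric] ennreal_leI del: ennreal_plus)
      qed
      also have "\<dots> = ennreal (2 powr ?P) * ((\<integral>\<^sup>+x. ennreal (norm (f x) powr ?P) \<partial>lborel)
         + (\<integral>\<^sup>+x. ennreal (norm (g x) powr ?P) \<partial>lborel))"
        unfolding nn_integral_completion[symmetric, of lborel] using m
        by (subst nn_integral_cmult, measurable, subst nn_integral_add) auto
      also have "\<dots> \<le> ennreal (2 powr ?P) * (ennreal (C powr ?P) + ennreal (D powr ?P))"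
        using C D Lp_finite_le_iff[OF p False C(1), of f] Lp_finite_le_iff[OF p False D(1), of g]
        by (intro mult_left_mono add_mono) auto
      also have "\<dots> = ennreal (2 powr ?P * (C powr ?P + D powr ?P))"
        by (simp add: ennreal_mult[symmetric] ennreal_plus[symmetric] del: ennreal_plus)
      also have "\<dots> \<le> ennreal ((4 * (C + D)) powr ?P)"
      proof (rule ennreal_leI)
        have "C powr ?P + D powr ?P \<le> (C + D) powr ?P + (C + D) powr ?P"
          using C D P by (intro add_mono powr_mono2) auto
        also have "\<dots> = 2 powr 1 * (C + D) powr ?P" by simp
        also have "\<dots> \<le> 2 powr ?P * (C + D) powr ?P" using P by (intro mult_right_mono powr_mono) auto
        finally have "2 powr ?P * (C powr ?P + D powr ?P) \<le> 2 powr ?P * (2 powr ?P * (C + D) powr ?P)"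
          by (intro mult_left_mono) auto
        also have "\<dots> = (4 * (C + D)) powr ?P" using C D by (simp add: powr_mult flip: powr_mult)
        finally show "2 powr ?P * (C powr ?P + D powr ?P) \<le> (4 * (C + D)) powr ?P" .
      qed
      finally have fin: "(\<integral>\<^sup>+x. ennreal (norm (f x + g x) powr ?P) \<partial>lborel) \<le> ennreal ((4 * (C + D)) powr ?P)" .
      show ?thesis by (rule iffD2[OF Lp_finite_le_iff[OF p False] fin]) (use C D in simp)
    qed
    then show ?thesis using C D by (simp add: ennreal_mult)
  qed (simp add: ennreal_mult_top)
qed (simp add: ennreal_mult_top)

lemma Lp_sum:
  assumes p: "1 \<le> p" and "finite I" and "\<And>i. i \<in> I \<Longrightarrow> f i \<in> borel_measurable lebesgue"
  shows "Lp p (\<lambda>x. \<Sum>i\<in>I. f i x) \<le> 4 ^ card I * (\<Sum>i\<in>I. Lp p (f i))"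
  using assms(2,3)
proof (induction I rule: finite_induct)
  case empty
  then show ?case using Lp_zero[OF p] by simp
next
  case (insert i I)
  have "Lp p (\<lambda>x. \<Sum>i\<in>insert i I. f i x) \<le> 4 * (Lp p (f i) + Lp p (\<lambda>x. \<Sum>i\<in>I. f i x))"
    using insert Lp_add[OF p, of "f i" "\<lambda>x. \<Sum>i\<in>I. f i x"] by simp
  also have "\<dots> \<le> 4 * (4 ^ card I * Lp p (f i) + 4 ^ card I * (\<Sum>i\<in>I. Lp p (f i)))"
    using insert mult_right_mono[of 1 "4 ^ card I" "Lp p (f i)"] by (intro mult_left_mono add_mono) auto
  finally show ?case using insert by (simp add: algebra_simps)
qed

text \<open>A superposition of translates, the form in which Young's convolution inequality is needed.\<close>

lemma Lp_translates:
  fixes g :: "real^'n \<Rightarrow> complex" and H :: "'m \<Rightarrow> complex"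
  assumes p: "1 \<le> p" and M: "sigma_finite_measure M"
    and H[measurable]: "H \<in> borel_measurable M" and \<tau>[measurable]: "\<tau> \<in> borel_measurable M"
    and K: "0 < K" "(\<integral>\<^sup>+m. norm (H m) \<partial>M) \<le> ennreal K"
    and g: "continuous_on UNIV g"
  shows "Lp p (\<lambda>x. \<integral>m. H m * g (x - \<tau> m) \<partial>M) \<le> ennreal K * Lp p g"
proof -
  interpret sigma_finite_measure M by (rule M)
  interpret pair_sigma_finite M "lborel :: (real^'n) measure" ..
  let ?F = "\<lambda>x. \<integral>m. H m * g (x - \<tau> m) \<partial>M"
  have gm[measurable]: "g \<in> borel_measurable borel" using g by (rule borel_measurable_continuous_onI)
  have "?F \<in> borel_measurable borel" by measurable
  then have Fm: "?F \<in> borel_measurable lebesgue" by (intro measurable_completion) simp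
  have gl: "g \<in> borel_measurable lebesgue" by (intro measurable_completion) simp
  \<comment> \<open>If the integrand is not integrable, the Bochner integral is 0 by convention and
    the bound still holds.\<close>
  have nF: "ennreal (norm (?F x)) \<le> (\<integral>\<^sup>+m. norm (H m) * norm (g (x - \<tau> m)) \<partial>M)" for x
  proof (cases "integrable M (\<lambda>m. H m * g (x - \<tau> m))")
    case True
    then show ?thesis using integral_norm_bound_ennreal[OF True] by (simp add: norm_mult)
  qed (simp add: not_integrable_integral_eq)
  show ?thesis
  proof (cases rule: Lp_cases[of p g])
    case 1
    then show ?thesis using K by (simp add: ennreal_mult_top)
  next
    case (2 C)
    have "Lp p ?F \<le> ennreal (K * C)"
    proof (cases "p = \<infinity>")
      case True
      have "AE x in lborel. norm (g x) \<le> C"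
        using Lp_infinity_le_iff[OF gl 2(1)] 2(2) True by simp
      \<comment> \<open>Continuity upgrades the essential bound to a pointwise one, so no null set
        has to be followed through the translations.\<close>
      then have "AE x in lborel. max (norm (g x) - C) 0 = 0" by eventually_elim auto
      moreover have "continuous_on UNIV (\<lambda>x. max (norm (g x) - C) 0)"
        using g by (intro continuous_intros)
      ultimately have "max (norm (g x) - C) 0 = 0" for x by (rule AE_lborel_continuous_zero)
      then have gC: "norm (g x) \<le> C" for x by (metis diff_le_0_iff_le max.cobounded1)
      have "norm (?F x) \<le> K * C" for x
      proof -
        have "ennreal (norm (?F x)) \<le> (\<integral>\<^sup>+m. norm (H m) * norm (g (x - \<tau> m)) \<partial>M)" by (rule nF)
        also have "\<dots> \<le> (\<integral>\<^sup>+m. ennreal C * norm (H m) \<partial>M)"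
          using 2(1) gC by (intro nn_integral_mono)
            (auto simp: ennreal_mult[symmetric] mult.commute[of C] intro!: ennreal_leI mult_left_mono)
        also have "\<dots> = ennreal C * (\<integral>\<^sup>+m. norm (H m) \<partial>M)" by (rule nn_integral_cmult) measurable
        also have "\<dots> \<le> ennreal C * ennreal K" using K by (intro mult_left_mono) auto
        also have "\<dots> = ennreal (K * C)" using K 2 by (simp add: ennreal_mult mult.commute)
        finally show ?thesis using K 2 by (simp add: ennreal_le_iff)
      qed
      then show ?thesis using Lp_infinity_le_iff[OF Fm, of "K * C"] K 2 True by simp
    next
      case False
      let ?P = "enn2real p"
      have P: "1 \<le> ?P" using p False by (rule enn2real_ge_1)
      let ?N = "\<integral>\<^sup>+x. ennreal (norm (g x) powr ?P) \<partial>lborel"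
      have N: "?N \<le> ennreal (C powr ?P)" using Lp_finite_le_iff[OF p False 2(1), of g] 2(2) by simp
      \<comment> \<open>Jensen with density \<open>norm (H m)\<close> gives
        \<open>K powr (P - 1)\<close>; Tonelli and translation invariance give the missing factor
        \<open>K\<close>.\<close>
      have "(\<integral>\<^sup>+x. ennreal (norm (?F x) powr ?P) \<partial>lborel)
        \<le> (\<integral>\<^sup>+x. ennreal (K powr (?P - 1)) * (\<integral>\<^sup>+m. norm (H m) * norm (g (x - \<tau> m)) powr ?P \<partial>M) \<partial>lborel)"
        by (intro nn_integral_mono powr_jensen) (use P K nF in auto)
      also have "\<dots> = ennreal (K powr (?P - 1)) * (\<integral>\<^sup>+x. \<integral>\<^sup>+m. norm (H m) * norm (g (x - \<tau> m)) powr ?P \<partial>M \<partial>lborel)"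
        by (rule nn_integral_cmult) measurable
      also have "(\<integral>\<^sup>+x. \<integral>\<^sup>+m. norm (H m) * norm (g (x - \<tau> m)) powr ?P \<partial>M \<partial>lborel)
        = (\<integral>\<^sup>+m. \<integral>\<^sup>+x. norm (H m) * norm (g (x - \<tau> m)) powr ?P \<partial>lborel \<partial>M)"
        by (rule Fubini'[where f = "\<lambda>m x. ennreal (norm (H m) * norm (g (x - \<tau> m)) powr ?P)"]) measurable
      also have "\<dots> = (\<integral>\<^sup>+m. norm (H m) * ?N \<partial>M)"
      proof (intro nn_integral_cong)
        fix m
        have "(\<integral>\<^sup>+x. norm (H m) * norm (g (x - \<tau> m)) powr ?P \<partial>lborel)
          = norm (H m) * (\<integral>\<^sup>+x. norm (g (- \<tau> m + x)) powr ?P \<partial>lborel)"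
          by (simp add: ennreal_mult nn_integral_cmult)
        then show "(\<integral>\<^sup>+x. norm (H m) * norm (g (x - \<tau> m)) powr ?P \<partial>lborel) = norm (H m) * ?N"
          using nn_integral_lborel_translate[of "\<lambda>x. ennreal (norm (g x) powr ?P)" "- \<tau> m"] by simp
      qed
      also have "\<dots> = (\<integral>\<^sup>+m. norm (H m) \<partial>M) * ?N" by (rule nn_integral_multc) measurable
      also have "ennreal (K powr (?P - 1)) * \<dots> \<le> ennreal (K powr (?P - 1)) * (ennreal K * ennreal (C powr ?P))"
        using K N by (intro mult_left_mono mult_mono) auto
      also have "\<dots> = ennreal (K powr (?P - 1) * K * C powr ?P)" using K by (simp add: ennreal_mult ac_simps)
      also have "K powr (?P - 1) * K * C powr ?P = (K * C) powr ?P" using K 2 by (simp add: powr_mult powr_diff)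
      finally show ?thesis using Lp_finite_le_iff[OF p False, of "K * C" ?F] K 2 by simp
    qed
    then show ?thesis using 2 K by (simp add: ennreal_mult)
  qed
qed

lemma borel_lebesgue_measurable: "f \<in> borel_measurable borel \<Longrightarrow> f \<in> borel_measurable lebesgue"
  by (intro measurable_completion) simp

lemma continuous_lebesgue_measurable: "continuous_on UNIV f \<Longrightarrow> f \<in> borel_measurable lebesgue"
  by (intro borel_lebesgue_measurable borel_measurable_continuous_onI)

text \<open>Finiteness is what licenses the subtraction in \<open>ennreal_absorb\<close>.\<close>

lemma Lp_schwartz_finite:
  fixes g :: "real^'n \<Rightarrow> complex"
  assumes p: "1 \<le> p" and g: "schwartz g" shows "Lp p g < \<infinity>"
proof -
  obtain C where C: "0 \<le> C" "\<And>x. norm (g x) \<le> C * weight x"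
    using schwartz_decays[OF g] by (rule decaysE) blast
  have gm: "g \<in> borel_measurable lebesgue" by (rule continuous_lebesgue_measurable[OF schwartz_continuous[OF g]])
  show ?thesis
  proof (cases "p = \<infinity>")
    case True
    have "norm (g x) \<le> C" for x using C(2)[of x] mult_left_le[OF weight_le_1[of x] C(1)] by linarith
    then have "Lp p g \<le> ennreal C" using Lp_infinity_le_iff[OF gm C(1)] True by simp
    then show ?thesis by (simp add: order_le_less_trans)
  next
    case False
    let ?P = "enn2real p"
    have P: "1 \<le> ?P" using p False by (rule enn2real_ge_1)
    have "(\<integral>\<^sup>+x. ennreal (norm (g x) powr ?P) \<partial>lborel) \<le> (\<integral>\<^sup>+x. ennreal (C powr ?P * weight x) \<partial>(lborel :: (real^'n) measure))"
    proof (intro nn_integral_mono ennreal_leI)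
      fix x
      have "norm (g x) powr ?P \<le> (C * weight x) powr ?P" using C P by (intro powr_mono2) auto
      also have "\<dots> = C powr ?P * weight x powr ?P" by (rule powr_mult)
      \<comment> \<open>The weight lies between 0 and 1, so raising it to a power at least 1 only
        decreases it.\<close>
      also have "weight x powr ?P \<le> weight x powr 1"
        using P weight_pos[of x] weight_le_1[of x] by (intro powr_mono') auto
      finally show "norm (g x) powr ?P \<le> C powr ?P * weight x"
        using weight_pos[of x] by (simp add: mult_left_mono)
    qed
    also have "\<dots> < \<infinity>"
      by (subst nn_integral_eq_integral)
         (auto intro!: AE_I2 mult_nonneg_nonneg less_imp_le[OF weight_pos] integrable_weight)
    finally show ?thesis using False unfolding Lp_norm_def lebesgue_on_UNIV_eq nn_integral_completion
      by (simp add: Let_def)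
  qed
qed

section \<open>Interpolation of lower order derivatives for elliptic systems\<close>

text \<open>The double integral is one superposition over pairs \<open>(r, z)\<close> with
  translation \<open>r z\<close>. Since \<open>r ^ (l - 1 - d) \<le> 1\<close> for
  \<open>r \<le> 1\<close>, its mass is at most \<open>2 * l * B\<close> times the length
  \<rho>.\<close>

lemma Lp_heat_smoothing:
  fixes h :: "real^'n \<Rightarrow> complex"
  assumes p: "1 \<le> p" and K: "integrable lborel K" and B: "0 < B" "(\<integral>z. norm (K z) \<partial>lborel) \<le> B"
    and h: "schwartz h" and \<rho>: "0 < \<rho>" "\<rho> \<le> 1" and l: "1 \<le> l"
  shows "Lp p (heat_smoothing \<rho> l d K h) \<le> ennreal (2 * real l * \<rho> * B) * Lp p h"
proof -
  let ?M = "lborel \<Otimes>\<^sub>M lborel :: (real \<times> (real^'n)) measure"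
  define H where "H = (\<lambda>(r::real, z::real^'n). indicator {0<..\<rho>} r *\<^sub>R (of_real (2 * real l * r ^ (l - 1 - d)) * K z))"
  define \<tau> where "\<tau> = (\<lambda>(r::real, z::real^'n). r *\<^sub>R z)"
  have [measurable]: "K \<in> borel_measurable borel" using K by auto
  have [measurable]: "h \<in> borel_measurable borel" by (rule schwartz_measurable[OF h])
  have [measurable]: "H \<in> borel_measurable ?M" unfolding H_def by measurable
  have [measurable]: "\<tau> \<in> borel_measurable ?M" unfolding \<tau>_def by measurable
  have Hb: "norm (H (r, z)) \<le> indicator {0<..\<rho>} r * (2 * real l) * norm (K z)" for r z
  proof (cases "r \<in> {0<..\<rho>}")
    case True
    then have "r ^ (l - 1 - d) \<le> 1" using \<rho> by (intro power_le_one) auto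
    then have "2 * real l * r ^ (l - 1 - d) * norm (K z) \<le> 2 * real l * 1 * norm (K z)"
      by (intro mult_right_mono mult_left_mono) auto
    then show ?thesis using True by (simp add: H_def norm_mult norm_power)
  qed (simp add: H_def)
  have KB: "(\<integral>\<^sup>+z. norm (K z) \<partial>lborel) \<le> ennreal B"
    using B K by (subst nn_integral_eq_integral) (auto intro!: ennreal_leI)
  have "(\<integral>\<^sup>+m. norm (H m) \<partial>?M) = (\<integral>\<^sup>+r. \<integral>\<^sup>+z. norm (H (r, z)) \<partial>lborel \<partial>lborel)"
    by (rule lborel.nn_integral_fst[symmetric]) measurable
  also have "\<dots> \<le> (\<integral>\<^sup>+r. \<integral>\<^sup>+z. ennreal (2 * real l) * indicator {0<..\<rho>} r * norm (K z) \<partial>lborel \<partial>(lborel :: real measure))"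
  proof (intro nn_integral_mono)
    fix r z show "ennreal (norm (H (r, z))) \<le> ennreal (2 * real l) * indicator {0<..\<rho>} r * norm (K z)"
      using ennreal_leI[OF Hb[of r z]] by (auto simp: indicator_def ennreal_mult split: if_splits)
  qed
  also have "\<dots> = ennreal (2 * real l) * ennreal \<rho> * (\<integral>\<^sup>+z. norm (K z) \<partial>lborel)"
    using \<rho> by (simp add: nn_integral_cmult nn_integral_multc)
  also have "\<dots> \<le> ennreal (2 * real l) * ennreal \<rho> * ennreal B" using KB by (rule mult_left_mono) simp
  also have "\<dots> = ennreal (2 * real l * \<rho> * B)" using \<rho> B by (simp add: ennreal_mult)
  finally have HB: "(\<integral>\<^sup>+m. norm (H m) \<partial>?M) \<le> ennreal (2 * real l * \<rho> * B)" .
  have intH: "integrable ?M H"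
    using HB by (intro integrableI_bounded) (auto simp: order_le_less_trans)
  obtain D where D: "\<And>x. norm (h x) \<le> D" using schwartz_decays[OF h] decays_bounded by blast
  have "heat_smoothing \<rho> l d K h x = (\<integral>m. H m * h (x - \<tau> m) \<partial>?M)" for x
  proof -
    have I: "integrable ?M (\<lambda>m. H m * h (x - \<tau> m))"
    proof (rule Bochner_Integration.integrable_bound)
      show "integrable ?M (\<lambda>m. H m * of_real D)" using intH by simp
      show "AE m in ?M. norm (H m * h (x - \<tau> m)) \<le> norm (H m * complex_of_real D)"
        using D by (auto simp: norm_mult intro!: mult_left_mono AE_I2 order_trans[OF D abs_ge_self])
    qed measurable
    have "heat_smoothing \<rho> l d K h x = (\<integral>r. \<integral>z. H (r, z) * h (x - \<tau> (r, z)) \<partial>lborel \<partial>lborel)"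
      unfolding heat_smoothing_def H_def \<tau>_def by (simp add: mult.assoc)
    also have "\<dots> = (\<integral>m. H m * h (x - \<tau> m) \<partial>?M)"
      using lborel_pair.integral_fst'[OF I] by simp
    finally show ?thesis .
  qed
  then have "heat_smoothing \<rho> l d K h = (\<lambda>x. \<integral>m. H m * h (x - \<tau> m) \<partial>?M)" by auto
  moreover have "sigma_finite_measure ?M" by (simp add: lborel_prod sigma_finite_lborel)
  ultimately show ?thesis
    using Lp_translates[OF p _ _ _ _ HB, of \<tau> h] \<rho> B l schwartz_continuous[OF h] by simp
qed

lemma ennreal_distrib_4:
  assumes "0 \<le> k" "0 \<le> u" "0 \<le> v"
  shows "ennreal k * (4 * (ennreal u * X + ennreal v * Y)) = ennreal (k * 4 * v) * Y + ennreal (k * 4 * u) * X"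
  using assms by (simp add: ennreal_mult distrib_left add.commute mult.assoc)

text \<open>\<open>heat_representation\<close> and inversion express \<open>F\<close>;
  \<open>Lp_translates\<close> and \<open>Lp_heat_smoothing\<close> bound the pieces.
  \<open>F\<close> and \<open>h\<close> are described by their transforms only, so the estimate is
  independent of how the operators are written. \<rho> can be chosen after the kernel masses are
  fixed.\<close>

lemma (in elliptic_family) Lp_lower_order:
  fixes A :: "real^'n \<Rightarrow> complex"
  assumes p: "1 \<le> p" and A: "cpoly A" "\<And>r \<xi>. A (r *\<^sub>R \<xi>) = of_real r ^ d * A \<xi>" and d: "d < l"
    and \<epsilon>: "0 < \<epsilon>"
  shows "\<exists>C\<ge>0. \<forall>f F h. schwartz f \<longrightarrow> schwartz F \<longrightarrow> (\<forall>\<xi>. FT F \<xi> = A \<xi> * FT f \<xi>) \<longrightarrow>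
     (\<forall>j\<in>J. schwartz (h j) \<and> (\<forall>\<xi>. FT (h j) \<xi> = P j \<xi> * FT f \<xi>)) \<longrightarrow>
     Lp p F \<le> ennreal \<epsilon> * (\<Sum>j\<in>J. Lp p (h j)) + ennreal C * Lp p f"
proof -
  obtain \<kappa> where \<kappa>: "\<kappa> \<noteq> 0"
    "\<And>g (x :: real^'n). schwartz g \<Longrightarrow> \<kappa> * g x = (\<integral>\<xi>. cis (x \<bullet> \<xi>) * FT g \<xi> \<partial>lborel)"
    using FT_inversion by metis
  define k where "k = cmod (1 / \<kappa>)"
  have k: "0 < k" using \<kappa> by (simp add: k_def)
  define K0 where "K0 z = FT (heat A) (- z)" for z
  define K where "K j = (\<lambda>z. FT (heat (\<lambda>\<xi>. A \<xi> * cnj (P j \<xi>))) (- z))" for j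
  have iFT: "integrable lborel (\<lambda>z. FT (heat Q) (- z))" if "cpoly Q" for Q
    using lborel_integrable_affine[OF _ integrable_FT[OF schwartz_heat[OF that]], of "-1" 0] by simp
  have iK0: "integrable lborel K0" unfolding K0_def using iFT[OF A(1)] .
  have iK: "integrable lborel (K j)" if "j \<in> J" for j
    unfolding K_def using A(1) P_poly[OF that] by (intro iFT cpoly_mult cpoly_cnj)
  \<comment> \<open>The added 1 makes the mass bound strictly positive, as
    \<open>Lp_translates\<close> requires.\<close>
  define B0 where "B0 = (\<integral>z. norm (K0 z) \<partial>lborel) + 1"
  define B where "B = (\<Sum>j\<in>J. \<integral>z. norm (K j z) \<partial>lborel) + 1"
  have B0: "0 < B0" unfolding B0_def by (intro add_nonneg_pos integral_nonneg) auto
  have B: "0 < B" unfolding B_def by (intro add_nonneg_pos sum_nonneg integral_nonneg) auto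
  have KB: "(\<integral>z. norm (K j z) \<partial>lborel) \<le> B" if "j \<in> J" for j
    using member_le_sum[OF that, of "\<lambda>j. \<integral>z. norm (K j z) \<partial>lborel"] finite_J by (auto simp: B_def)
  define N :: real where "N = 4 ^ card J"
  have N: "0 < N" by (simp add: N_def)
  \<comment> \<open>Everything that multiplies \<rho> in front of the norms of the
    \<open>h j\<close>: the inversion constant, 4 for splitting off \<open>T0\<close>,
    \<open>N\<close> for summing over \<open>J\<close>, and the mass bound.\<close>
  define Z where "Z = k * 4 * N * (2 * real l * B)"
  have Z: "0 < Z" using k N l B by (simp add: Z_def)
  define \<rho> where "\<rho> = min 1 (\<epsilon> / Z)"
  have \<rho>: "0 < \<rho>" "\<rho> \<le> 1" "\<rho> * Z \<le> \<epsilon>" using \<epsilon> Z by (auto simp: \<rho>_def min_def field_simps)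
  define C where "C = k * 4 * (1 / \<rho> ^ d * B0)"
  have C: "0 \<le> C" using k \<rho> B0 by (simp add: C_def)
  show ?thesis
  proof (intro exI[of _ C] conjI C allI impI)
    fix f F h
    assume f: "schwartz f" and F: "schwartz F" and FTF: "\<forall>\<xi>. FT F \<xi> = A \<xi> * FT f \<xi>"
      and h: "\<forall>j\<in>J. schwartz (h j) \<and> (\<forall>\<xi>. FT (h j) \<xi> = P j \<xi> * FT f \<xi>)"
    define T0 where "T0 x = (\<integral>z. K0 z * f (x - \<rho> *\<^sub>R z) \<partial>lborel)" for x
    define c where "c = complex_of_real (1 / \<rho> ^ d)"
    define T where "T j = heat_smoothing \<rho> l d (K j) (h j)" for j
    have rep: "\<kappa> * F x = c * T0 x + (\<Sum>j\<in>J. T j x)" for x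
      using \<kappa>(2)[OF F, of x] heat_representation[OF A d f \<rho>(1,2), of h x] h
      by (simp add: FTF T0_def T_def K0_def K_def c_def)
    have [measurable]: "f \<in> borel_measurable borel" "K0 \<in> borel_measurable borel"
      using schwartz_measurable[OF f] iK0 by auto
    have T0m: "T0 \<in> borel_measurable lebesgue"
      unfolding T0_def by (intro borel_lebesgue_measurable) measurable
    have Tm: "T j \<in> borel_measurable lebesgue" if "j \<in> J" for j
    proof -
      have [measurable]: "h j \<in> borel_measurable borel" "K j \<in> borel_measurable borel"
        using schwartz_measurable h iK that by auto
      show ?thesis unfolding T_def heat_smoothing_def by (intro borel_lebesgue_measurable) measurable
    qed
    have Fm: "F \<in> borel_measurable lebesgue" by (rule continuous_lebesgue_measurable[OF schwartz_continuous[OF F]])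
    have Sm: "(\<lambda>x. \<Sum>j\<in>J. T j x) \<in> borel_measurable lebesgue" using Tm by (intro borel_measurable_sum)
    have cTm: "(\<lambda>x. c * T0 x) \<in> borel_measurable lebesgue" using T0m by measurable
    have fm: "f \<in> borel_measurable lebesgue" by (intro borel_lebesgue_measurable) measurable
    have "Lp p T0 \<le> ennreal B0 * Lp p f"
      unfolding T0_def
    proof (rule Lp_translates[OF p sigma_finite_lborel])
      show "(\<integral>\<^sup>+z. norm (K0 z) \<partial>lborel) \<le> ennreal B0"
        using iK0 by (subst nn_integral_eq_integral) (auto simp: B0_def intro!: ennreal_leI)
    qed (use B0 schwartz_continuous[OF f] in auto)
    then have "ennreal (1 / \<rho> ^ d) * Lp p T0 \<le> ennreal (1 / \<rho> ^ d) * (ennreal B0 * Lp p f)"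
      by (rule mult_left_mono) simp
    moreover have "Lp p (\<lambda>x. c * T0 x) \<le> ennreal (1 / \<rho> ^ d) * Lp p T0"
      using \<rho> by (intro Lp_dominated[OF p T0m cTm]) (auto simp: c_def norm_mult norm_divide norm_power)
    ultimately have "Lp p (\<lambda>x. c * T0 x) \<le> ennreal (1 / \<rho> ^ d) * (ennreal B0 * Lp p f)"
      by (rule order_trans[rotated])
    then have t0: "Lp p (\<lambda>x. c * T0 x) \<le> ennreal (1 / \<rho> ^ d * B0) * Lp p f"
      using \<rho> B0 by (subst ennreal_mult) (auto simp: mult.assoc)
    have "Lp p (T j) \<le> ennreal (2 * real l * \<rho> * B) * Lp p (h j)" if "j \<in> J" for j
      unfolding T_def using Lp_heat_smoothing[OF p iK[OF that] B KB[OF that] _ \<rho>(1,2) l] h that by auto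
    then have "(\<Sum>j\<in>J. Lp p (T j)) \<le> ennreal (2 * real l * \<rho> * B) * (\<Sum>j\<in>J. Lp p (h j))"
      unfolding sum_distrib_left by (rule sum_mono)
    then have "ennreal N * (\<Sum>j\<in>J. Lp p (T j)) \<le> ennreal N * (ennreal (2 * real l * \<rho> * B) * (\<Sum>j\<in>J. Lp p (h j)))"
      by (rule mult_left_mono) simp
    moreover have "Lp p (\<lambda>x. \<Sum>j\<in>J. T j x) \<le> ennreal N * (\<Sum>j\<in>J. Lp p (T j))"
      using Lp_sum[OF p finite_J Tm] by (simp add: N_def flip: ennreal_power)
    ultimately have t1: "Lp p (\<lambda>x. \<Sum>j\<in>J. T j x) \<le> ennreal (N * (2 * real l * \<rho> * B)) * (\<Sum>j\<in>J. Lp p (h j))"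
      using N \<rho> B by (simp add: ennreal_mult mult.assoc)
    have "F x = (1 / \<kappa>) * (c * T0 x + (\<Sum>j\<in>J. T j x))" for x using rep[of x] \<kappa>(1) by (simp add: field_simps)
    then have "Lp p F \<le> ennreal k * Lp p (\<lambda>x. c * T0 x + (\<Sum>j\<in>J. T j x))"
      using k cTm Sm Fm by (intro Lp_dominated[OF p]) (auto simp: k_def norm_mult norm_divide)
    also have "\<dots> \<le> ennreal k * (4 * (Lp p (\<lambda>x. c * T0 x) + Lp p (\<lambda>x. \<Sum>j\<in>J. T j x)))"
      by (intro mult_left_mono Lp_add[OF p cTm Sm]) simp
    also have "\<dots> \<le> ennreal k * (4 * (ennreal (1 / \<rho> ^ d * B0) * Lp p f
        + ennreal (N * (2 * real l * \<rho> * B)) * (\<Sum>j\<in>J. Lp p (h j))))"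
      by (intro mult_left_mono add_mono t0 t1) auto
    also have "\<dots> = ennreal (k * 4 * (N * (2 * real l * \<rho> * B))) * (\<Sum>j\<in>J. Lp p (h j)) + ennreal C * Lp p f"
      unfolding C_def using k \<rho> B0 B N by (intro ennreal_distrib_4) auto
    also have "\<dots> \<le> ennreal \<epsilon> * (\<Sum>j\<in>J. Lp p (h j)) + ennreal C * Lp p f"
      using \<rho>(3) by (intro add_mono mult_right_mono ennreal_leI) (auto simp: Z_def ac_simps)
    finally show "Lp p F \<le> ennreal \<epsilon> * (\<Sum>j\<in>J. Lp p (h j)) + ennreal C * Lp p f" .
  qed
qed

text \<open>Uses the constants \<open>c\<close>, so it maps rapidly decreasing functions to such
  functions and has a transform, whereas the coefficients in \<open>diff_op\<close> are merely
  measurable.\<close>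

definition principal_op :: "nat \<Rightarrow> ('n::finite multiindex \<Rightarrow> complex) \<Rightarrow> (real^'n \<Rightarrow> complex) \<Rightarrow> real^'n \<Rightarrow> complex" where
  "principal_op l c f x = (\<Sum>\<alpha> | mi_abs \<alpha> = l. c \<alpha> * Dmulti \<alpha> f x)"

lemma schwartz_principal_op: "schwartz f \<Longrightarrow> schwartz (principal_op l c f)"
  unfolding principal_op_def by (intro schwartz_sum schwartz_cmult schwartz_Dmulti)

lemma FT_principal_op:
  assumes "schwartz f"
  shows "FT (principal_op l c f) \<xi> = principal_symbol l c \<xi> * FT f \<xi>"
proof -
  have "FT (principal_op l c f) \<xi> = (\<Sum>\<alpha> | mi_abs \<alpha> = l. FT (\<lambda>x. c \<alpha> * Dmulti \<alpha> f x) \<xi>)"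
    unfolding principal_op_def by (rule FT_sum) (auto intro: finite_mi_eq schwartz_cmult schwartz_Dmulti assms)
  then show ?thesis
    by (simp add: FT_cmult FT_Dmulti assms principal_symbol_def sum_distrib_right mult.assoc)
qed

lemma monomial_homogeneous:
  "(\<Prod>k\<in>UNIV. complex_of_real ((r *\<^sub>R \<xi>) $ k) ^ \<alpha> k)
    = of_real r ^ mi_abs \<alpha> * (\<Prod>k\<in>UNIV. complex_of_real (\<xi> $ k) ^ \<alpha> k)"
  by (simp add: power_mult_distrib prod.distrib mi_abs_def power_sum)

lemma cpoly_monomial: "cpoly (\<lambda>\<xi>::real^'n. \<Prod>k\<in>UNIV. complex_of_real (\<xi> $ k) ^ \<alpha> k)"
  by (intro cpoly_prod cpoly_power cpoly_coord)

lemma cpoly_principal_symbol: "cpoly (principal_symbol l c)"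
  unfolding principal_symbol_def by (intro cpoly_sum cpoly_mult cpoly_const cpoly_monomial)

lemma principal_symbol_homogeneous:
  "principal_symbol l c (r *\<^sub>R \<xi>) = of_real r ^ l * principal_symbol l c \<xi>"
  unfolding principal_symbol_def sum_distrib_left
  by (intro sum.cong refl) (simp add: monomial_homogeneous del: vector_scaleR_component)

text \<open>The sum of squared symbols attains a positive minimum on the unit sphere, and
  homogeneity of degree \<open>2*l\<close> spreads this bound to all frequencies.\<close>

lemma elliptic_imp_family:
  fixes c :: "nat \<Rightarrow> 'n::finite multiindex \<Rightarrow> complex"
  assumes ell: "elliptic l N c" and l: "1 \<le> l"
  shows "\<exists>\<delta>. elliptic_family {1..N} (\<lambda>j. principal_symbol l (c j) :: real^'n \<Rightarrow> complex) l \<delta>"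
proof -
  define E where "E \<xi> = (\<Sum>j\<in>{1..N}. (cmod (principal_symbol l (c j) \<xi>))\<^sup>2)" for \<xi> :: "real^'n"
  have cont: "continuous_on (sphere 0 1) E"
    unfolding E_def using cpoly_continuous[OF cpoly_principal_symbol] by (intro continuous_intros)
  have "sphere (0 :: real^'n) 1 \<noteq> {}" by simp
  then obtain u where u: "u \<in> sphere 0 1" "\<And>v. v \<in> sphere 0 1 \<Longrightarrow> E u \<le> E v"
    using continuous_attains_inf[OF compact_sphere _ cont] by blast
  have "u \<noteq> 0" using u(1) by auto
  then obtain j where j: "j \<in> {1..N}" "principal_symbol l (c j) u \<noteq> 0"
    using ell by (auto simp: elliptic_def)
  have "0 < (cmod (principal_symbol l (c j) u))\<^sup>2" using j by simp
  also have "\<dots> \<le> E u" unfolding E_def using j by (intro member_le_sum) auto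
  finally have pos: "0 < E u" .
  have hom: "E (r *\<^sub>R \<xi>) = r ^ (2*l) * E \<xi>" for r \<xi>
    unfolding E_def sum_distrib_left
    by (intro sum.cong refl)
       (simp add: principal_symbol_homogeneous norm_mult norm_power power_mult_distrib power_even_eq flip: power_abs)
  have "E u * norm \<xi> ^ (2*l) \<le> E \<xi>" for \<xi>
  proof (cases "\<xi> = 0")
    case True
    then show ?thesis using l by (simp add: E_def power_0_left sum_nonneg)
  next
    case False
    define v where "v = (1 / norm \<xi>) *\<^sub>R \<xi>"
    have v: "v \<in> sphere 0 1" "\<xi> = norm \<xi> *\<^sub>R v" using False by (auto simp: v_def)
    have "E u * norm \<xi> ^ (2*l) \<le> E v * norm \<xi> ^ (2*l)" using u(2)[OF v(1)] by (intro mult_right_mono) auto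
    also have "\<dots> = E \<xi>" using hom[of "norm \<xi>" v] v(2) by (simp add: mult.commute)
    finally show ?thesis .
  qed
  then have "elliptic_family {1..N} (\<lambda>j. principal_symbol l (c j)) l (E u)"
    using l pos by unfold_locales (auto simp: cpoly_principal_symbol principal_symbol_homogeneous E_def)
  then show ?thesis by blast
qed

section \<open>Absorption of bounded lower order terms\<close>

definition lower_norm :: "ennreal \<Rightarrow> nat \<Rightarrow> (real^'n::finite \<Rightarrow> complex) \<Rightarrow> ennreal" where
  "lower_norm p l f = (\<Sum>\<alpha> | mi_abs \<alpha> < l. Lp p (Dmulti \<alpha> f))"

text \<open>The operators are a parameter, so that the full operators and their principal parts are
  measured alike.\<close>

definition system_norm :: "ennreal \<Rightarrow> nat \<Rightarrow> (nat \<Rightarrow> (real^'n::finite \<Rightarrow> complex) \<Rightarrow> (real^'n \<Rightarrow> complex)) \<Rightarrow> (real^'n \<Rightarrow> complex) \<Rightarrow> ennreal" where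
  "system_norm p N T f = (\<Sum>j\<in>{1..N}. Lp p (T j f))"

lemma finite_mi_less: "finite {\<alpha> :: 'n::finite multiindex. mi_abs \<alpha> < l}"
  by (rule finite_subset[OF _ finite_mi[of l]]) auto

lemma elliptic_lower_norm:
  fixes c :: "nat \<Rightarrow> 'n::finite multiindex \<Rightarrow> complex"
  assumes ell: "elliptic l N c" and l: "1 \<le> l" and p: "1 \<le> p" and \<epsilon>: "0 < \<epsilon>"
  shows "\<exists>C\<ge>0. \<forall>f::real^'n \<Rightarrow> complex. schwartz f \<longrightarrow>
    lower_norm p l f \<le> ennreal \<epsilon> * system_norm p N (\<lambda>j. principal_op l (c j)) f + ennreal C * Lp p f"
proof -
  obtain \<delta> where "elliptic_family {1..N} (\<lambda>j. principal_symbol l (c j) :: real^'n \<Rightarrow> complex) l \<delta>"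
    using elliptic_imp_family[OF ell l] by blast
  then interpret elliptic_family "{1..N}" "\<lambda>j. principal_symbol l (c j) :: real^'n \<Rightarrow> complex" l \<delta> .
  let ?I = "{\<alpha> :: 'n multiindex. mi_abs \<alpha> < l}"
  \<comment> \<open>The small constant is shared among the finitely many multi-indices; the added 1
    keeps the divisor positive.\<close>
  define m where "m = real (card ?I) + 1"
  have m: "0 < m" by (simp add: m_def)
  let ?S = "\<lambda>f. system_norm p N (\<lambda>j. principal_op l (c j)) f"
  have "\<exists>C\<ge>0. \<forall>f. schwartz f \<longrightarrow> Lp p (Dmulti \<alpha> f) \<le> ennreal (\<epsilon> / m) * ?S f + ennreal C * Lp p f"
    if "\<alpha> \<in> ?I" for \<alpha>
  proof -
    have "mi_abs \<alpha> < l" using that by simp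
    moreover have "0 < \<epsilon> / m" using \<epsilon> m by simp
    ultimately obtain C where C: "0 \<le> C" "\<And>f F h. schwartz f \<longrightarrow> schwartz F \<longrightarrow>
       (\<forall>\<xi>. FT F \<xi> = (\<Prod>k\<in>UNIV. complex_of_real (\<xi> $ k) ^ \<alpha> k) * FT f \<xi>) \<longrightarrow>
       (\<forall>j\<in>{1..N}. schwartz (h j) \<and> (\<forall>\<xi>. FT (h j) \<xi> = principal_symbol l (c j) \<xi> * FT f \<xi>)) \<longrightarrow>
       Lp p F \<le> ennreal (\<epsilon> / m) * (\<Sum>j\<in>{1..N}. Lp p (h j)) + ennreal C * Lp p f"
      using Lp_lower_order[OF p cpoly_monomial[of \<alpha>] monomial_homogeneous] by meson
    have "Lp p (Dmulti \<alpha> f) \<le> ennreal (\<epsilon> / m) * ?S f + ennreal C * Lp p f" if "schwartz f" for f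
      using C(2)[of f "Dmulti \<alpha> f" "\<lambda>j. principal_op l (c j) f"] that
      by (simp add: schwartz_Dmulti FT_Dmulti schwartz_principal_op FT_principal_op system_norm_def)
    then show ?thesis using C(1) by blast
  qed
  then obtain C where C: "\<And>\<alpha>. \<alpha> \<in> ?I \<Longrightarrow> 0 \<le> C \<alpha>"
    "\<And>\<alpha> f. \<alpha> \<in> ?I \<Longrightarrow> schwartz f \<Longrightarrow> Lp p (Dmulti \<alpha> f) \<le> ennreal (\<epsilon> / m) * ?S f + ennreal (C \<alpha>) * Lp p f"
    by metis
  have "lower_norm p l f \<le> ennreal \<epsilon> * ?S f + ennreal (\<Sum>\<alpha>\<in>?I. C \<alpha>) * Lp p f" if f: "schwartz f" for f
  proof -
    have "lower_norm p l f \<le> (\<Sum>\<alpha>\<in>?I. ennreal (\<epsilon> / m) * ?S f + ennreal (C \<alpha>) * Lp p f)"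
      unfolding lower_norm_def using C(2) f by (intro sum_mono) auto
    also have "\<dots> = ennreal (real (card ?I)) * (ennreal (\<epsilon> / m) * ?S f) + ennreal (\<Sum>\<alpha>\<in>?I. C \<alpha>) * Lp p f"
    proof -
      have "(\<Sum>\<alpha>\<in>?I. ennreal (C \<alpha>)) = ennreal (\<Sum>\<alpha>\<in>?I. C \<alpha>)" by (rule sum_ennreal) (rule C(1))
      then have "(\<Sum>\<alpha>\<in>?I. ennreal (C \<alpha>) * Lp p f) = ennreal (\<Sum>\<alpha>\<in>?I. C \<alpha>) * Lp p f"
        by (simp only: sum_distrib_right[symmetric])
      then show ?thesis
        by (simp only: sum.distrib sum_constant ennreal_of_nat_eq_real_of_nat)
    qed
    also have "ennreal (real (card ?I)) * (ennreal (\<epsilon> / m) * ?S f) \<le> ennreal \<epsilon> * ?S f"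
    proof -
      have "real (card ?I) * (\<epsilon> / m) \<le> \<epsilon>" using \<epsilon> m by (simp add: m_def field_simps)
      then have "ennreal (real (card ?I) * (\<epsilon> / m)) * ?S f \<le> ennreal \<epsilon> * ?S f"
        by (intro mult_right_mono ennreal_leI) auto
      then show ?thesis using \<epsilon> m by (subst (asm) ennreal_mult) (auto simp: mult.assoc)
    qed
    finally show ?thesis by simp
  qed
  moreover have "0 \<le> (\<Sum>\<alpha>\<in>?I. C \<alpha>)" using C(1) by (rule sum_nonneg)
  ultimately show ?thesis by blast
qed

lemma Lp_cong_AE:
  assumes "1 \<le> p" "f \<in> borel_measurable lebesgue" "g \<in> borel_measurable lebesgue"
    and ae: "AE x in lborel. f x = g x"
  shows "Lp p f = Lp p g"
proof (rule antisym)
  show "Lp p f \<le> Lp p g" using ae by (intro Lp_mono assms) (auto elim: AE_mp)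
  show "Lp p g \<le> Lp p f" using ae by (intro Lp_mono assms) (auto elim: AE_mp)
qed

lemma Linf_bound:
  assumes "b \<in> Linf UNIV"
  shows "b \<in> borel_measurable lebesgue" "\<exists>K\<ge>0. AE x in lborel. norm (b x) \<le> K"
proof -
  show m: "b \<in> borel_measurable lebesgue" using assms by (simp add: Linf_def lebesgue_on_UNIV_eq)
  have fin: "Lp \<infinity> b < \<infinity>" using assms by (simp add: Linf_def)
  show "\<exists>K\<ge>0. AE x in lborel. norm (b x) \<le> K"
  proof (cases rule: Lp_cases[of \<infinity> b])
    case (2 C)
    then show ?thesis using Lp_infinity_le_iff[OF m 2(1)] by auto
  qed (use fin in simp)
qed

lemma Lp_lower_terms:
  fixes b :: "'n::finite coeffs"
  assumes p: "1 \<le> p" and b: "\<And>\<alpha>. b \<alpha> \<in> Linf UNIV"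
  shows "\<exists>M\<ge>0. \<forall>f. schwartz f \<longrightarrow>
    Lp p (\<lambda>x. \<Sum>\<alpha> | mi_abs \<alpha> < l. b \<alpha> x * Dmulti \<alpha> f x) \<le> ennreal M * lower_norm p l f"
proof -
  let ?I = "{\<alpha> :: 'n multiindex. mi_abs \<alpha> < l}"
  have fin: "finite ?I" by (rule finite_mi_less)
  obtain K where K: "\<And>\<alpha>. 0 \<le> K \<alpha>" "\<And>\<alpha>. AE x in lborel. norm (b \<alpha> x) \<le> K \<alpha>"
    using Linf_bound(2)[OF b] by metis
  define M where "M = (\<Sum>\<alpha>\<in>?I. K \<alpha>)"
  have M: "0 \<le> M" "\<And>\<alpha>. \<alpha> \<in> ?I \<Longrightarrow> K \<alpha> \<le> M"
    unfolding M_def using K(1) fin by (auto intro: sum_nonneg member_le_sum)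
  have "Lp p (\<lambda>x. \<Sum>\<alpha>\<in>?I. b \<alpha> x * Dmulti \<alpha> f x) \<le> ennreal (4 ^ card ?I * M) * lower_norm p l f" if f: "schwartz f" for f
  proof -
    have Dm: "Dmulti \<alpha> f \<in> borel_measurable lebesgue" for \<alpha>
      by (rule continuous_lebesgue_measurable[OF schwartz_continuous[OF schwartz_Dmulti[OF f]]])
    have bm: "b \<alpha> \<in> borel_measurable lebesgue" for \<alpha> by (rule Linf_bound(1)[OF b])
    have bD: "(\<lambda>x. b \<alpha> x * Dmulti \<alpha> f x) \<in> borel_measurable lebesgue" for \<alpha>
      by (intro borel_measurable_times bm Dm)
    have "Lp p (\<lambda>x. b \<alpha> x * Dmulti \<alpha> f x) \<le> ennreal M * Lp p (Dmulti \<alpha> f)" if "\<alpha> \<in> ?I" for \<alpha>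
    proof (rule Lp_dominated[OF p Dm bD M(1)])
      show "AE x in lborel. norm (b \<alpha> x * Dmulti \<alpha> f x) \<le> M * norm (Dmulti \<alpha> f x)"
        using K(2)[of \<alpha>] by eventually_elim (use M(2)[OF that] in \<open>simp add: norm_mult mult_right_mono\<close>)
    qed
    then have "4 ^ card ?I * (\<Sum>\<alpha>\<in>?I. Lp p (\<lambda>x. b \<alpha> x * Dmulti \<alpha> f x)) \<le> 4 ^ card ?I * (ennreal M * lower_norm p l f)"
      unfolding lower_norm_def sum_distrib_left[of "ennreal M"] by (intro mult_left_mono sum_mono) auto
    moreover have "Lp p (\<lambda>x. \<Sum>\<alpha>\<in>?I. b \<alpha> x * Dmulti \<alpha> f x) \<le> 4 ^ card ?I * (\<Sum>\<alpha>\<in>?I. Lp p (\<lambda>x. b \<alpha> x * Dmulti \<alpha> f x))"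
      by (rule Lp_sum[OF p fin bD])
    moreover have "ennreal (4 ^ card ?I * M) = 4 ^ card ?I * ennreal M"
      using M by (subst ennreal_mult) (auto simp flip: ennreal_power)
    ultimately show ?thesis by (simp add: mult.assoc)
  qed
  moreover have "0 \<le> 4 ^ card ?I * M" using M(1) by simp
  ultimately show ?thesis by blast
qed

lemma ennreal_factor:
  assumes "0 \<le> K"
  shows "numeral w * (ennreal K * X + ennreal K * Y) = ennreal (numeral w * K) * (X + Y)"
  using assms by (simp add: ennreal_mult distrib_left mult.assoc)

text \<open>Almost everywhere the two operators differ by lower order terms with bounded
  coefficients. Both directions are needed: one to reach the principal parts from a system, one to
  return.\<close>

lemma Lp_diff_op_principal_op:
  fixes b :: "'n::finite coeffs"
  assumes p: "1 \<le> p" and ord: "order_le l b" and b: "\<And>\<alpha>. b \<alpha> \<in> Linf UNIV"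
    and pr: "\<And>\<alpha>. mi_abs \<alpha> = l \<Longrightarrow> AE x in lebesgue. b \<alpha> x = c \<alpha>"
  shows "\<exists>M\<ge>1. \<forall>f. schwartz f \<longrightarrow>
    Lp p (diff_op b f) \<le> ennreal M * (Lp p (principal_op l c f) + lower_norm p l f) \<and>
    Lp p (principal_op l c f) \<le> ennreal M * (Lp p (diff_op b f) + lower_norm p l f)"
proof -
  let ?R = "\<lambda>f x. \<Sum>\<alpha> | mi_abs \<alpha> < l. b \<alpha> x * Dmulti \<alpha> f x"
  from Lp_lower_terms[of p b l, OF p b] obtain M where M: "0 \<le> M"
    and M': "\<forall>f. schwartz f \<longrightarrow> Lp p (?R f) \<le> ennreal M * lower_norm p l f"
    by (elim exE conjE)
  \<comment> \<open>Stated for an abstract remainder \<open>r\<close>, which is instantiated by the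
    lower order sum and by its negative.\<close>
  have bound: "Lp p u \<le> ennreal (4 * (1 + M)) * (Lp p v + lower_norm p l f)"
    if f: "schwartz f" and m: "u \<in> borel_measurable lebesgue" "v \<in> borel_measurable lebesgue"
      "r \<in> borel_measurable lebesgue" and ae: "AE x in lborel. u x = v x + r x"
      and r: "\<And>x. norm (r x) = norm (?R f x)" and Rm: "?R f \<in> borel_measurable lebesgue" for f u v r
  proof -
    have "Lp p r \<le> Lp p (?R f)" using r by (intro Lp_mono p Rm m) auto
    then have r': "Lp p r \<le> ennreal M * lower_norm p l f" using M'[rule_format, OF f] by (rule order_trans)
    have "Lp p u = Lp p (\<lambda>x. v x + r x)" using m ae by (intro Lp_cong_AE p) auto
    also have "\<dots> \<le> 4 * (Lp p v + Lp p r)" by (rule Lp_add[OF p m(2,3)])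
    also have "\<dots> \<le> 4 * (ennreal (1 + M) * Lp p v + ennreal (1 + M) * lower_norm p l f)"
    proof (intro mult_left_mono add_mono)
      show "Lp p v \<le> ennreal (1 + M) * Lp p v"
        using M mult_right_mono[of 1 "ennreal (1 + M)" "Lp p v"] by simp
      show "Lp p r \<le> ennreal (1 + M) * lower_norm p l f"
        by (rule order_trans[OF r']) (intro mult_right_mono ennreal_leI, use M in auto)
    qed simp
    also have "\<dots> = ennreal (4 * (1 + M)) * (Lp p v + lower_norm p l f)"
      using M by (intro ennreal_factor) simp
    finally show ?thesis .
  qed
  have "Lp p (diff_op b f) \<le> ennreal (4 * (1 + M)) * (Lp p (principal_op l c f) + lower_norm p l f) \<and>
    Lp p (principal_op l c f) \<le> ennreal (4 * (1 + M)) * (Lp p (diff_op b f) + lower_norm p l f)" if f: "schwartz f" for f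
  proof -
    have Dm: "Dmulti \<alpha> f \<in> borel_measurable lebesgue" for \<alpha>
      by (rule continuous_lebesgue_measurable[OF schwartz_continuous[OF schwartz_Dmulti[OF f]]])
    have bm: "b \<alpha> \<in> borel_measurable lebesgue" for \<alpha> by (rule Linf_bound(1)[OF b])
    have bD: "(\<lambda>x. b \<alpha> x * Dmulti \<alpha> f x) \<in> borel_measurable lebesgue" for \<alpha>
      by (intro borel_measurable_times bm Dm)
    have Rm: "?R f \<in> borel_measurable lebesgue" by (intro borel_measurable_sum bD)
    have dm: "diff_op b f \<in> borel_measurable lebesgue"
      unfolding diff_op_order_le[OF ord, abs_def] by (intro borel_measurable_sum bD)
    have pm: "principal_op l c f \<in> borel_measurable lebesgue"
      by (rule continuous_lebesgue_measurable[OF schwartz_continuous[OF schwartz_principal_op[OF f]]])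
    have "AE x in lborel. \<forall>\<alpha>\<in>{\<alpha>. mi_abs \<alpha> = l}. b \<alpha> x = c \<alpha>"
      using pr finite_mi_eq by (intro AE_finite_allI) (auto simp: AE_completion_iff)
    then have ae: "AE x in lborel. diff_op b f x = principal_op l c f x + ?R f x"
    proof eventually_elim
      case (elim x)
      have "diff_op b f x = (\<Sum>\<alpha>\<in>{\<alpha>. mi_abs \<alpha> = l} \<union> {\<alpha>. mi_abs \<alpha> < l}. b \<alpha> x * Dmulti \<alpha> f x)"
        unfolding diff_op_order_le[OF ord] by (rule sum.cong) auto
      also have "\<dots> = (\<Sum>\<alpha> | mi_abs \<alpha> = l. b \<alpha> x * Dmulti \<alpha> f x) + ?R f x"
        by (rule sum.union_disjoint) (auto simp: finite_mi_eq finite_mi_less)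
      also have "(\<Sum>\<alpha> | mi_abs \<alpha> = l. b \<alpha> x * Dmulti \<alpha> f x) = principal_op l c f x"
        unfolding principal_op_def using elim by (intro sum.cong) auto
      finally show ?case .
    qed
    then have ae': "AE x in lborel. principal_op l c f x = diff_op b f x + (- ?R f x)"
      by eventually_elim simp
    show ?thesis
      using bound[OF f dm pm Rm ae _ Rm] bound[OF f pm dm _ ae' _ Rm] Rm by simp
  qed
  moreover have "1 \<le> 4 * (1 + M)" using M by simp
  ultimately show ?thesis by blast
qed

lemma system_norm_principal_op:
  fixes a :: "nat \<Rightarrow> 'n::finite coeffs"
  assumes p: "1 \<le> p" and a: "Linf_system UNIV l N a"
    and pr: "\<forall>j\<in>{1..N}. \<forall>\<alpha>. mi_abs \<alpha> = l \<longrightarrow> (AE x in lebesgue. a j \<alpha> x = c j \<alpha>)"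
  shows "\<exists>M\<ge>1. \<forall>f. schwartz f \<longrightarrow>
    system_norm p N (\<lambda>j. diff_op (a j)) f
      \<le> ennreal M * (system_norm p N (\<lambda>j. principal_op l (c j)) f + ennreal (real N) * lower_norm p l f) \<and>
    system_norm p N (\<lambda>j. principal_op l (c j)) f
      \<le> ennreal M * (system_norm p N (\<lambda>j. diff_op (a j)) f + ennreal (real N) * lower_norm p l f)"
proof -
  have "\<exists>M\<ge>1. \<forall>f. schwartz f \<longrightarrow>
    Lp p (diff_op (a j) f) \<le> ennreal M * (Lp p (principal_op l (c j) f) + lower_norm p l f) \<and>
    Lp p (principal_op l (c j) f) \<le> ennreal M * (Lp p (diff_op (a j) f) + lower_norm p l f)" if "j \<in> {1..N}" for j
    using a pr that by (intro Lp_diff_op_principal_op p) (auto simp: Linf_system_def)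
  then obtain m where m: "\<And>j. j \<in> {1..N} \<Longrightarrow> 1 \<le> m j"
    "\<And>j f. j \<in> {1..N} \<Longrightarrow> schwartz f \<Longrightarrow> Lp p (diff_op (a j) f) \<le> ennreal (m j) * (Lp p (principal_op l (c j) f) + lower_norm p l f)"
    "\<And>j f. j \<in> {1..N} \<Longrightarrow> schwartz f \<Longrightarrow> Lp p (principal_op l (c j) f) \<le> ennreal (m j) * (Lp p (diff_op (a j) f) + lower_norm p l f)"
    by metis
  define M where "M = (\<Sum>j\<in>{1..N}. m j) + 1"
  have mM: "m j \<le> M" if "j \<in> {1..N}" for j
  proof -
    have "m j \<le> (\<Sum>j\<in>{1..N}. m j)" using that m(1) by (intro member_le_sum) (auto intro: order_trans[OF zero_le_one])
    then show ?thesis by (simp add: M_def)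
  qed
  have M: "1 \<le> M" unfolding M_def using m(1) by (auto intro!: sum_nonneg intro: order_trans[OF zero_le_one])
  have *: "system_norm p N S f \<le> ennreal M * (system_norm p N T f + ennreal (real N) * lower_norm p l f)"
    if "\<And>j. j \<in> {1..N} \<Longrightarrow> Lp p (S j f) \<le> ennreal (m j) * (Lp p (T j f) + lower_norm p l f)" for S T f
  proof -
    have "system_norm p N S f \<le> (\<Sum>j\<in>{1..N}. ennreal M * (Lp p (T j f) + lower_norm p l f))"
      unfolding system_norm_def
    proof (rule sum_mono)
      fix j assume j: "j \<in> {1..N}"
      have "ennreal (m j) * (Lp p (T j f) + lower_norm p l f) \<le> ennreal M * (Lp p (T j f) + lower_norm p l f)"
        using mM[OF j] by (intro mult_right_mono ennreal_leI) auto
      then show "Lp p (S j f) \<le> ennreal M * (Lp p (T j f) + lower_norm p l f)" using that[OF j] by (rule order_trans[rotated])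
    qed
    then show ?thesis
      by (simp add: sum_distrib_left[symmetric] sum.distrib system_norm_def ennreal_of_nat_eq_real_of_nat)
  qed
  show ?thesis
  proof (intro exI[of _ M] conjI allI impI M)
    fix f :: "real^'n \<Rightarrow> complex" assume f: "schwartz f"
    show "system_norm p N (\<lambda>j. diff_op (a j)) f
      \<le> ennreal M * (system_norm p N (\<lambda>j. principal_op l (c j)) f + ennreal (real N) * lower_norm p l f)"
      using m(2)[OF _ f] by (rule *)
    show "system_norm p N (\<lambda>j. principal_op l (c j)) f
      \<le> ennreal M * (system_norm p N (\<lambda>j. diff_op (a j)) f + ennreal (real N) * lower_norm p l f)"
      using m(3)[OF _ f] by (rule *)
  qed
qed

text \<open>For infinite \<open>S\<close> the first assumption holds trivially, so finiteness is
  essential to the subtraction.\<close>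

lemma ennreal_absorb:
  fixes S X :: ennreal
  assumes "S \<le> X + ennreal (1/2) * S" "S < \<infinity>"
  shows "S \<le> 2 * X"
proof (cases X)
  case (real x)
  obtain s where s: "0 \<le> s" "S = ennreal s" using assms(2) by (cases S) auto
  have "X + ennreal (1/2) * S = ennreal x + ennreal (1/2 * s)"
    unfolding real s by (subst ennreal_mult) (use s in auto)
  also have "\<dots> = ennreal (x + 1/2 * s)" using real s by (intro ennreal_plus[symmetric]) auto
  finally have "ennreal s \<le> ennreal (x + 1/2 * s)" using assms(1) s by simp
  then have "s \<le> 2 * x" using real s by (subst (asm) ennreal_le_iff) auto
  then have "ennreal s \<le> ennreal (2 * x)" by (rule ennreal_leI)
  then show ?thesis using real s by (simp add: ennreal_mult)
qed simp

text \<open>The principal parts are bounded by the operators plus lower order terms, and those by a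
  small multiple of the principal parts plus \<open>f\<close>. The loop closes by
  absorption.\<close>

lemma elliptic_system_norm:
  fixes a :: "nat \<Rightarrow> 'n::finite coeffs"
  assumes ell: "elliptic l N c" and l: "1 \<le> l" and p: "1 \<le> p" and a: "Linf_system UNIV l N a"
    and pr: "\<forall>j\<in>{1..N}. \<forall>\<alpha>. mi_abs \<alpha> = l \<longrightarrow> (AE x in lebesgue. a j \<alpha> x = c j \<alpha>)"
  shows "\<exists>C\<ge>0. \<forall>f. schwartz f \<longrightarrow>
    system_norm p N (\<lambda>j. principal_op l (c j)) f + ennreal (real N) * lower_norm p l f
      \<le> ennreal C * (system_norm p N (\<lambda>j. diff_op (a j)) f + Lp p f)"
proof -
  let ?S = "system_norm p N (\<lambda>j. principal_op l (c j)) :: (real^'n \<Rightarrow> complex) \<Rightarrow> ennreal"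
  let ?T = "system_norm p N (\<lambda>j. diff_op (a j))"
  obtain M where M: "1 \<le> M" "\<And>f. schwartz f \<Longrightarrow> ?S f \<le> ennreal M * (?T f + ennreal (real N) * lower_norm p l f)"
    using system_norm_principal_op[OF p a pr] by blast
  define R where "R = real N + 1"
  have R: "0 < R" "real N \<le> R" by (auto simp: R_def)
  \<comment> \<open>Makes \<open>M * R * \<epsilon>\<close> equal to one half, the coefficient that
    \<open>ennreal_absorb\<close> removes.\<close>
  define \<epsilon> where "\<epsilon> = 1 / (2 * M * R)"
  have \<epsilon>: "0 < \<epsilon>" using M R by (simp add: \<epsilon>_def)
  obtain C where C: "0 \<le> C" "\<And>f::real^'n \<Rightarrow> complex. schwartz f \<Longrightarrow> lower_norm p l f \<le> ennreal \<epsilon> * ?S f + ennreal C * Lp p f"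
    using elliptic_lower_norm[OF ell l p \<epsilon>] by (elim exE conjE) simp
  define D where "D = 2 * (M + M * R * C)"
  have D: "0 \<le> D" using M R C by (simp add: D_def)
  have main: "?S f + ennreal (real N) * lower_norm p l f \<le> ennreal (2 * D + R * C) * (?T f + Lp p f)"
    if f: "schwartz f" for f
  proof -
    have fin: "?S f < \<infinity>"
      unfolding system_norm_def using Lp_schwartz_finite[OF p schwartz_principal_op[OF f]] by simp
    have L: "ennreal (real N) * lower_norm p l f \<le> ennreal (R * \<epsilon>) * ?S f + ennreal (R * C) * Lp p f"
    proof -
      have "ennreal (real N) * lower_norm p l f \<le> ennreal R * (ennreal \<epsilon> * ?S f + ennreal C * Lp p f)"
        using C(2)[OF f] R by (intro mult_mono ennreal_leI) auto
      then show ?thesis using R \<epsilon> C(1) by (simp add: ennreal_mult distrib_left mult.assoc)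
    qed
    have "?S f \<le> ennreal M * (?T f + (ennreal (R * \<epsilon>) * ?S f + ennreal (R * C) * Lp p f))"
      using M(2)[OF f] by (rule order_trans) (intro mult_left_mono add_left_mono L, simp)
    also have "\<dots> = (ennreal M * ?T f + ennreal (M * R * C) * Lp p f) + ennreal (M * (R * \<epsilon>)) * ?S f"
      using M R \<epsilon> C(1) by (simp add: ennreal_mult distrib_left mult.assoc add.assoc add.commute)
    also have "M * (R * \<epsilon>) = 1 / 2" using M R by (simp add: \<epsilon>_def)
    finally have "?S f \<le> 2 * (ennreal M * ?T f + ennreal (M * R * C) * Lp p f)"
      using fin by (rule ennreal_absorb)
    also have "\<dots> \<le> 2 * (ennreal (M + M * R * C) * ?T f + ennreal (M + M * R * C) * Lp p f)"
      using M R C(1) by (intro mult_left_mono add_mono mult_right_mono ennreal_leI) auto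
    also have "\<dots> = ennreal D * (?T f + Lp p f)"
      unfolding D_def using M R C(1) by (intro ennreal_factor) simp
    finally have S: "?S f \<le> ennreal D * (?T f + Lp p f)" .
    have "R * \<epsilon> \<le> 1" using M R by (simp add: \<epsilon>_def)
    then have "ennreal (R * \<epsilon>) * ?S f \<le> ?S f"
      using mult_right_mono[of "ennreal (R * \<epsilon>)" 1 "?S f"] by simp
    then have "ennreal (real N) * lower_norm p l f \<le> ennreal D * (?T f + Lp p f) + ennreal (R * C) * (?T f + Lp p f)"
      using S by (intro order_trans[OF L] add_mono mult_left_mono) auto
    then have "?S f + ennreal (real N) * lower_norm p l f
        \<le> ennreal D * (?T f + Lp p f) + (ennreal D * (?T f + Lp p f) + ennreal (R * C) * (?T f + Lp p f))"
      using S by (intro add_mono)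
    also have "\<dots> = (ennreal D + (ennreal D + ennreal (R * C))) * (?T f + Lp p f)"
      by (simp only: distrib_right)
    also have "ennreal D + (ennreal D + ennreal (R * C)) = ennreal (2 * D + R * C)"
      using D R C(1) by (simp add: ennreal_plus[symmetric] del: ennreal_plus)
    finally show ?thesis .
  qed
  have "0 \<le> 2 * D + R * C" using D R C(1) by simp
  then show ?thesis using main by blast
qed

text \<open>Norms of the system \<open>r\<close> pass to the common principal parts with lower order
  terms, and from there by ellipticity to the system \<open>a\<close> and \<open>f\<close>. Equality
  of the spaces follows by exchanging \<open>a\<close> and \<open>r\<close>.\<close>

lemma elliptic_imp_L0_subset:
  fixes a r :: "nat \<Rightarrow> 'n::finite coeffs"
  assumes ell: "elliptic l N c" and l: "1 \<le> l" and p: "1 \<le> p"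
    and a: "Linf_system UNIV l N a" and r: "Linf_system UNIV l N r"
    and pa: "\<forall>j\<in>{1..N}. \<forall>\<alpha>. mi_abs \<alpha> = l \<longrightarrow> (AE x in lebesgue. a j \<alpha> x = c j \<alpha>)"
    and pr: "\<forall>j\<in>{1..N}. \<forall>\<alpha>. mi_abs \<alpha> = l \<longrightarrow> (AE x in lebesgue. r j \<alpha> x = c j \<alpha>)"
  shows "L0 p UNIV N r \<subseteq> L0 p UNIV N a"
proof
  fix q assume q: "q \<in> L0 p UNIV N r"
  then obtain C1 C2 where C: "\<And>f. f \<in> test_functions UNIV \<Longrightarrow>
      Lp p (diff_op q f) \<le> ennreal C1 * system_norm p N (\<lambda>j. diff_op (r j)) f + ennreal C2 * Lp p f"
    unfolding L0_def system_norm_def by auto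
  obtain B where B: "0 \<le> B" "\<And>f. schwartz f \<Longrightarrow>
    system_norm p N (\<lambda>j. principal_op l (c j)) f + ennreal (real N) * lower_norm p l f
      \<le> ennreal B * (system_norm p N (\<lambda>j. diff_op (a j)) f + Lp p f)"
    using elliptic_system_norm[OF ell l p a pa] by blast
  obtain M where M: "1 \<le> M" "\<And>f. schwartz f \<Longrightarrow> system_norm p N (\<lambda>j. diff_op (r j)) f
      \<le> ennreal M * (system_norm p N (\<lambda>j. principal_op l (c j)) f + ennreal (real N) * lower_norm p l f)"
    using system_norm_principal_op[OF p r pr] by blast
  \<comment> \<open>The constants in \<open>L0\<close> may be negative, and \<open>ennreal\<close>
    truncates those to 0; \<open>max\<close> makes this explicit.\<close>
  define D where "D = max C1 0 * (M * B)"
  have "Lp p (diff_op q f) \<le> ennreal D * system_norm p N (\<lambda>j. diff_op (a j)) f + ennreal (D + max C2 0) * Lp p f"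
    if t: "f \<in> test_functions UNIV" for f
  proof -
    let ?T = "system_norm p N (\<lambda>j. diff_op (a j)) f"
    have f: "schwartz f" by (rule test_function_schwartz[OF t])
    have "system_norm p N (\<lambda>j. diff_op (r j)) f \<le> ennreal M * (ennreal B * (?T + Lp p f))"
      by (rule order_trans[OF M(2)[OF f]]) (intro mult_left_mono B f, simp)
    then have "ennreal (max C1 0) * system_norm p N (\<lambda>j. diff_op (r j)) f \<le> ennreal (max C1 0) * (ennreal M * (ennreal B * (?T + Lp p f)))"
      by (intro mult_left_mono) auto
    also have "\<dots> = ennreal D * (?T + Lp p f)"
      using M(1) B(1) by (simp add: D_def ennreal_mult mult.assoc)
    finally have "ennreal C1 * system_norm p N (\<lambda>j. diff_op (r j)) f \<le> ennreal D * (?T + Lp p f)"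
      by (simp add: max_def ennreal_neg split: if_splits)
    then have "Lp p (diff_op q f) \<le> ennreal D * (?T + Lp p f) + ennreal (max C2 0) * Lp p f"
      by (intro order_trans[OF C[OF t]] add_mono mult_right_mono ennreal_leI) auto
    also have "\<dots> = ennreal D * ?T + ennreal (D + max C2 0) * Lp p f"
      using M(1) B(1) by (subst ennreal_plus) (auto simp: D_def distrib_left distrib_right add.assoc)
    finally show ?thesis .
  qed
  then have "\<exists>C1 C2. \<forall>f\<in>test_functions UNIV. Lp p (diff_op q f)
      \<le> ennreal C1 * (\<Sum>j\<in>{1..N}. Lp p (diff_op (a j) f)) + ennreal C2 * Lp p f"
    unfolding system_norm_def by (intro exI ballI)
  then show "q \<in> L0 p UNIV N a"
    using q unfolding L0_def by simp
qed

section \<open>A bump function\<close>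

text \<open>The negative powers are part of the family so that derivatives are combinations of its
  members.\<close>

definition flat :: "nat \<Rightarrow> real \<Rightarrow> real" where
  "flat m u = (if 0 < u then exp (- (1 / u)) / u ^ m else 0)"

lemma flat_nonneg: "0 \<le> flat m u"
  by (simp add: flat_def)

lemma flat_Suc: "flat m u = u * flat (Suc m) u"
  by (simp add: flat_def)

text \<open>Raise \<open>v \<le> exp v\<close> at \<open>v = 1 / (k u)\<close> to the power
  \<open>k = m + 2\<close>; two powers of \<open>u\<close> survive division by \<open>u ^ m\<close>.
  Quadratic smallness yields a zero derivative at the origin.\<close>

lemma flat_quadratic: "flat m u \<le> real (m + 2) ^ (m + 2) * u\<^sup>2"
proof (cases "0 < u")
  case True
  define k where "k = m + 2"
  have k: "0 < k" by (simp add: k_def)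
  have "1 / (real k * u) \<le> exp (1 / (real k * u))"
    using exp_ge_add_one_self[of "1 / (real k * u)"] by linarith
  then have "(1 / (real k * u)) ^ k \<le> exp (1 / (real k * u)) ^ k"
    using True k by (intro power_mono) auto
  also have "\<dots> = exp (real k * (1 / (real k * u)))" by (rule exp_of_nat_mult[symmetric])
  also have "real k * (1 / (real k * u)) = 1 / u" using k by simp
  finally have "1 / (real k ^ k * u ^ k) \<le> exp (1 / u)" by (simp add: power_divide power_mult_distrib)
  then have "exp (- (1 / u)) \<le> real k ^ k * u ^ k"
    using True k by (simp add: exp_minus field_simps)
  then have "flat m u \<le> real k ^ k * u ^ k / u ^ m"
    using True by (simp add: flat_def divide_right_mono)
  also have "\<dots> = real k ^ k * u\<^sup>2" using True by (simp add: k_def power2_eq_square)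
  finally show ?thesis by (simp only: k_def)
qed (simp add: flat_def)

lemma flat_deriv: "(flat m has_real_derivative (flat (m + 2) u - real m * flat (m + 1) u)) (at u)"
proof (cases u "0 :: real" rule: linorder_cases)
  case less
  have "((\<lambda>u. 0) has_real_derivative 0) (at u)" by simp
  then have "(flat m has_real_derivative 0) (at u)"
    by (rule has_field_derivative_transform_within_open[where S="{..<0}"]) (use less in \<open>auto simp: flat_def\<close>)
  then show ?thesis using less by (simp add: flat_def)
next
  case greater
  \<comment> \<open>The truncated exponent at \<open>m = 0\<close> is harmless because of the factor
    \<open>m\<close>.\<close>
  have *: "real m * u ^ (m - 1) = real m * u ^ m / u" using greater by (cases m) auto
  have "((\<lambda>u. exp (- (1 / u)) / u ^ m) has_real_derivative
      (exp (- (1 / u)) * (1 / u\<^sup>2) * u ^ m - exp (- (1 / u)) * (real m * u ^ (m - 1))) / (u ^ m * u ^ m)) (at u)"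
    using greater by (auto intro!: derivative_eq_intros simp: power2_eq_square)
  also have "(exp (- (1 / u)) * (1 / u\<^sup>2) * u ^ m - exp (- (1 / u)) * (real m * u ^ (m - 1))) / (u ^ m * u ^ m)
      = flat (m + 2) u - real m * flat (m + 1) u"
    unfolding * using greater by (simp add: flat_def field_simps power2_eq_square)
  finally have "((\<lambda>u. exp (- (1 / u)) / u ^ m) has_real_derivative (flat (m + 2) u - real m * flat (m + 1) u)) (at u)" .
  then show ?thesis
    by (rule has_field_derivative_transform_within_open[where S="{0<..}"]) (use greater in \<open>auto simp: flat_def\<close>)
next
  case equal
  define C where "C = real (m + 2) ^ (m + 2)"
  have "((\<lambda>y. (flat m y - flat m 0) / (y - 0)) \<longlongrightarrow> 0) (at 0)"
  proof (rule Lim_null_comparison)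
    show "\<forall>\<^sub>F y in at 0. norm ((flat m y - flat m 0) / (y - 0)) \<le> C * \<bar>y\<bar>"
    proof (intro always_eventually allI)
      fix y :: real
      have "\<bar>flat m y\<bar> \<le> (C * \<bar>y\<bar>) * \<bar>y\<bar>"
        using flat_quadratic[of m y] flat_nonneg[of m y] by (simp add: C_def power2_eq_square)
      then show "norm ((flat m y - flat m 0) / (y - 0)) \<le> C * \<bar>y\<bar>"
        by (cases "y = 0") (auto simp: flat_def pos_divide_le_eq)
    qed
    show "((\<lambda>y. C * \<bar>y\<bar>) \<longlongrightarrow> 0) (at 0)" by (auto intro!: tendsto_eq_intros)
  qed
  then have "(flat m has_real_derivative 0) (at 0)" by (simp add: has_field_derivative_iff)
  then show ?thesis using equal by (simp add: flat_def)
qed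

definition bump :: "real^'n \<Rightarrow> complex" where
  "bump x = of_real (flat 0 (1 - x \<bullet> x))"

text \<open>The class for \<open>smooth_closed_class\<close> consists of polynomials times
  \<open>flat m\<close> of \<open>1 - x \<bullet> x\<close>.\<close>

lemma smooth_bump: "smooth (bump :: real^'n \<Rightarrow> complex)"
proof -
  define s where "s x = 1 - x \<bullet> x" for x :: "real^'n"
  define F where "F f \<longleftrightarrow> (\<exists>Q m. cpoly Q \<and> f = (\<lambda>x. Q x * of_real (flat m (s x))))" for f :: "real^'n \<Rightarrow> complex"
  have sp: "cpoly (\<lambda>x. complex_of_real (s x))"
  proof -
    have "(\<lambda>x. complex_of_real (s x)) = (\<lambda>x. 1 + (-1) * (\<Sum>k\<in>UNIV. of_real (x $ k) * of_real (x $ k)))"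
      by (auto simp: s_def inner_vec_def)
    then show ?thesis by (simp only:) (intro cpoly_add cpoly_mult cpoly_sum cpoly_const cpoly_coord)
  qed
  have hd: "((\<lambda>x. complex_of_real (flat m (s x))) has_derivative
     (\<lambda>v. of_real ((flat (m + 2) (s x) - real m * flat (m + 1) (s x)) * (- 2 * (x \<bullet> v))))) (at x)" for m x
  proof -
    have "(s has_derivative (\<lambda>v. - 2 * (x \<bullet> v))) (at x)"
      unfolding s_def by (auto intro!: derivative_eq_intros simp: inner_commute)
    moreover have "(flat m has_derivative (\<lambda>h. (flat (m + 2) (s x) - real m * flat (m + 1) (s x)) * h)) (at (s x))"
      using flat_deriv[of m "s x"] by (simp add: has_field_derivative_def)
    ultimately have "((\<lambda>x. flat m (s x)) has_derivative
        (\<lambda>v. (flat (m + 2) (s x) - real m * flat (m + 1) (s x)) * (- 2 * (x \<bullet> v)))) (at x)"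
      by (rule has_derivative_compose)
    then show ?thesis by (rule has_derivative_of_real)
  qed
  have fd: "(\<lambda>x. complex_of_real (flat m (s x))) differentiable (at x)" for m x
    using hd differentiableI by blast
  have "F bump"
    unfolding F_def by (intro exI[of _ "\<lambda>x. 1"] exI[of _ 0]) (auto simp: bump_def s_def intro: cpoly_const)
  moreover have "f differentiable (at x)" if "F f" for f x
    using that fd cpoly_differentiable by (auto simp: F_def intro!: differentiable_mult)
  moreover have "F (partial k f)" if "F f" for f k
  proof -
    obtain Q m where Q: "cpoly Q" "f = (\<lambda>x. Q x * of_real (flat m (s x)))" using \<open>F f\<close> by (auto simp: F_def)
    \<comment> \<open>Lower members of the flat family are polynomial multiples of
      \<open>flat (m + 2)\<close> by \<open>flat_Suc\<close>, so the whole derivative has one flat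
      factor.\<close>
    let ?Q = "\<lambda>x. Q x * ((-2 * of_real (x $ k)) * (1 + (- of_nat m) * of_real (s x)))
       + partial k Q x * (of_real (s x) * of_real (s x))"
    have "partial k f x = ?Q x * of_real (flat (m + 2) (s x))" for x
    proof -
      have p: "partial k (\<lambda>x. complex_of_real (flat m (s x))) x
          = of_real ((flat (m + 2) (s x) - real m * flat (m + 1) (s x)) * (- 2 * (x $ k)))"
        using partial_has_derivative[OF hd] by (simp add: inner_axis)
      have e: "flat (m + 1) (s x) = s x * flat (m + 2) (s x)" "flat m (s x) = s x * (s x * flat (m + 2) (s x))"
        using flat_Suc[of "m + 1" "s x"] flat_Suc[of m "s x"] by simp_all
      show ?thesis
        unfolding Q(2) partial_mult[OF cpoly_differentiable[OF Q(1)] fd] p e by (simp add: algebra_simps)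
    qed
    moreover have "cpoly ?Q"
      using Q(1) sp by (intro cpoly_add cpoly_mult cpoly_const cpoly_coord cpoly_partial)
    ultimately show ?thesis unfolding F_def by blast
  qed
  ultimately show ?thesis by (rule smooth_closed_class(2)[of F])
qed

definition supp_unit :: "(real^'n \<Rightarrow> complex) \<Rightarrow> bool" where
  "supp_unit g \<longleftrightarrow> smooth g \<and> (\<forall>y. y \<notin> cball 0 1 \<longrightarrow> g y = 0)"

lemma supp_unit_bump: "supp_unit bump"
proof -
  have "bump y = 0" if "y \<notin> cball 0 1" for y :: "real^'a"
  proof -
    have "1 < norm y" using that by simp
    then have "1 < (norm y)\<^sup>2" by (simp add: one_less_power)
    then show ?thesis by (simp add: bump_def flat_def dot_square_norm)
  qed
  then show ?thesis by (simp add: supp_unit_def smooth_bump)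
qed

lemma supp_unit_zero: "supp_unit (\<lambda>y. 0)"
  by (simp add: supp_unit_def smooth_const)

lemma supp_unit_add: "supp_unit f \<Longrightarrow> supp_unit g \<Longrightarrow> supp_unit (\<lambda>y. f y + g y)"
  by (simp add: supp_unit_def smooth_add)

lemma supp_unit_cmult: "supp_unit f \<Longrightarrow> supp_unit (\<lambda>y. c * f y)"
  by (simp add: supp_unit_def smooth_cmult)

lemma supp_unit_Dk:
  assumes "supp_unit g" shows "supp_unit (Dk k g)"
proof -
  have "Dk k g y = 0" if y: "y \<notin> cball 0 1" for y
  proof -
    have "((\<lambda>x. 0) has_derivative (\<lambda>h. 0)) (at y)" by simp
    then have "(g has_derivative (\<lambda>h. 0)) (at y)"
      by (rule has_derivative_transform_within_open[where s="- cball 0 1"])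
         (use assms y in \<open>auto simp: supp_unit_def\<close>)
    then show ?thesis using partial_has_derivative by (fastforce simp: Dk_def)
  qed
  then show ?thesis using assms by (simp add: supp_unit_def smooth_Dk)
qed

lemma supp_unit_bounded:
  assumes "supp_unit g" obtains B where "0 \<le> B" "\<And>y. cmod (g y) \<le> B * indicator (cball 0 1) y"
proof -
  have "compact (g ` cball 0 1)"
    using assms by (intro compact_continuous_image smooth_continuous) (auto simp: supp_unit_def)
  then obtain B where B: "\<And>y. y \<in> cball 0 1 \<Longrightarrow> cmod (g y) \<le> B"
    using compact_imp_bounded by (fastforce simp: bounded_iff)
  have "cmod (g y) \<le> max B 0 * indicator (cball 0 1) y" for y
    using B[of y] assms by (cases "y \<in> cball 0 1") (auto simp: supp_unit_def)
  then show ?thesis using that[of "max B 0"] by auto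
qed

section \<open>Wave packets\<close>

text \<open>Profiles in the expansion of \<open>foldr_Dk_packet\<close>: all choices of
  \<open>m\<close> letters of the word that differentiate the envelope, while the others contribute
  their frequency component.\<close>

fun amplitude :: "real^'n \<Rightarrow> 'n list \<Rightarrow> nat \<Rightarrow> real^'n \<Rightarrow> complex" where
  "amplitude \<xi> [] 0 = bump"
| "amplitude \<xi> [] (Suc m) = (\<lambda>y. 0)"
| "amplitude \<xi> (k # ks) 0 = (\<lambda>y. of_real (\<xi> $ k) * amplitude \<xi> ks 0 y)"
| "amplitude \<xi> (k # ks) (Suc m) = (\<lambda>y. of_real (\<xi> $ k) * amplitude \<xi> ks (Suc m) y + Dk k (amplitude \<xi> ks m) y)"

lemma supp_unit_amplitude: "supp_unit (amplitude \<xi> ks m)"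
  by (induction \<xi> ks m rule: amplitude.induct)
     (auto intro: supp_unit_bump supp_unit_zero supp_unit_add supp_unit_cmult supp_unit_Dk)

lemma Dk_zero: "Dk k (\<lambda>y. 0) = (\<lambda>y. 0)"
  by (simp add: Dk_def)

lemma amplitude_zero: "length ks < m \<Longrightarrow> amplitude \<xi> ks m = (\<lambda>y. 0)"
proof (induction ks arbitrary: m)
  case Nil
  then show ?case by (cases m) auto
next
  case (Cons k ks)
  then show ?case by (cases m) (auto simp: Dk_zero)
qed

lemma amplitude_leading: "amplitude \<xi> ks 0 y = prod_list (map (\<lambda>k. of_real (\<xi> $ k)) ks) * bump y"
  by (induction ks) auto

lemma partial_sum:
  fixes f :: "'i \<Rightarrow> real^'n \<Rightarrow> complex"
  assumes "finite I" "\<And>i. i \<in> I \<Longrightarrow> f i differentiable (at x)"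
  shows "(\<lambda>x. \<Sum>i\<in>I. f i x) differentiable (at x)"
    and "partial k (\<lambda>x. \<Sum>i\<in>I. f i x) x = (\<Sum>i\<in>I. partial k (f i) x)"
proof -
  have "(\<lambda>x. \<Sum>i\<in>I. f i x) differentiable (at x) \<and>
    partial k (\<lambda>x. \<Sum>i\<in>I. f i x) x = (\<Sum>i\<in>I. partial k (f i) x)"
    using assms by (induction I rule: finite_induct) (auto simp: partial_add differentiable_add)
  then show "(\<lambda>x. \<Sum>i\<in>I. f i x) differentiable (at x)"
    and "partial k (\<lambda>x. \<Sum>i\<in>I. f i x) x = (\<Sum>i\<in>I. partial k (f i) x)" by auto
qed

text \<open>Frequency and width grow together: each envelope derivative loses
  \<open>t\<^sup>2\<close> against a phase derivative, and it is this gap that leaves room for an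
  operator of order \<open>l - 1\<close>.\<close>

definition packet :: "real^'n \<Rightarrow> real \<Rightarrow> real^'n \<Rightarrow> complex" where
  "packet \<xi> t x = cis ((t *\<^sub>R \<xi>) \<bullet> x) * bump ((1 / t) *\<^sub>R x)"

lemma scale_deriv:
  fixes g :: "real^'n \<Rightarrow> complex"
  assumes "\<And>x. g differentiable (at x)"
  shows "(\<lambda>x. g (r *\<^sub>R x)) differentiable (at x)"
    and "partial k (\<lambda>x. g (r *\<^sub>R x)) x = of_real r * partial k g (r *\<^sub>R x)"
proof -
  obtain g' where g': "(g has_derivative g') (at (r *\<^sub>R x))" using assms by (auto simp: differentiable_def)
  have "((\<lambda>x. r *\<^sub>R x) has_derivative (\<lambda>h. r *\<^sub>R h)) (at x)" by (auto intro!: derivative_eq_intros)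
  then have d: "((\<lambda>x. g (r *\<^sub>R x)) has_derivative (\<lambda>h. g' (r *\<^sub>R h))) (at x)"
    using g' by (rule has_derivative_compose)
  then show "(\<lambda>x. g (r *\<^sub>R x)) differentiable (at x)" by (rule differentiableI)
  have "linear g'" using g' has_derivative_linear by blast
  then show "partial k (\<lambda>x. g (r *\<^sub>R x)) x = of_real r * partial k g (r *\<^sub>R x)"
    using partial_has_derivative[OF d] partial_has_derivative[OF g']
    by (simp add: linear_scale scaleR_conv_of_real[where 'a=complex])
qed

lemma amplitude_differentiable: "amplitude \<xi> ks m differentiable (at y)"
  using supp_unit_amplitude[of \<xi> ks m] by (simp add: supp_unit_def smooth_differentiable)

text \<open>Each derivative contributes a factor \<open>t \<xi>\<^sub>k\<close> from the phase or a factor \<open>1 / t\<close> from the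
  envelope; the index \<open>m\<close> counts the latter.\<close>

lemma foldr_Dk_packet:
  assumes t: "0 < t"
  shows "foldr Dk ks (packet \<xi> t) x = cis ((t *\<^sub>R \<xi>) \<bullet> x) *
    (\<Sum>m\<le>length ks. of_real (t ^ length ks / t ^ (2 * m)) * amplitude \<xi> ks m ((1 / t) *\<^sub>R x))"
proof (induction ks arbitrary: x)
  case Nil
  then show ?case by (simp add: packet_def)
next
  case (Cons k ks)
  let ?c = "\<lambda>x. cis ((t *\<^sub>R \<xi>) \<bullet> x)"
  let ?a = "\<lambda>m x. amplitude \<xi> ks m ((1 / t) *\<^sub>R x)"
  let ?w = "\<lambda>m. complex_of_real (t ^ length ks / t ^ (2 * m))"
  let ?w' = "\<lambda>m. complex_of_real (t ^ Suc (length ks) / t ^ (2 * m))"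
  let ?S = "\<lambda>x. \<Sum>m\<le>length ks. ?w m * ?a m x"
  have ad: "?a m differentiable (at x)" for m x
    using scale_deriv(1)[of "amplitude \<xi> ks m"] amplitude_differentiable by blast
  have wd: "(\<lambda>x. ?w m * ?a m x) differentiable (at x)" for m x
    using ad by (intro differentiable_mult differentiable_const)
  have dS: "?S differentiable (at x)" for x
    by (rule partial_sum(1)) (use wd in auto)
  have pS: "partial k ?S x = (\<Sum>m\<le>length ks. ?w m * partial k (?a m) x)" for x
    using partial_sum(2)[of "{..length ks}" "\<lambda>m x. ?w m * ?a m x" x k] wd
    by (simp only: partial_cmult[OF ad] finite_atMost)
  have IH: "foldr Dk ks (packet \<xi> t) = (\<lambda>x. ?c x * ?S x)"
    by (rule ext) (rule Cons)
  have "foldr Dk (k # ks) (packet \<xi> t) x = Dk k (\<lambda>x. ?c x * ?S x) x"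
    by (simp only: foldr.simps o_apply IH)
  also have "\<dots> = - \<i> * (?c x * partial k ?S x + (\<i> * ((t *\<^sub>R \<xi>) $ k) * ?c x) * ?S x)"
    unfolding Dk_def partial_mult[OF cis_inner_deriv(1) dS] cis_inner_deriv(2) ..
  also have "\<dots> = ?c x * (of_real t * of_real (\<xi> $ k) * ?S x - \<i> * partial k ?S x)"
    by (simp add: algebra_simps)
  \<comment> \<open>The chain rule factor \<open>1 / t\<close> turns \<open>?w m\<close> into
    \<open>?w' (Suc m)\<close> once the common factor is \<open>t ^ Suc (length ks)\<close>.\<close>
  also have "partial k ?S x = (\<Sum>m\<le>length ks. ?w m * (of_real (1 / t) * partial k (amplitude \<xi> ks m) ((1 / t) *\<^sub>R x)))"
    unfolding pS by (simp only: scale_deriv(2)[OF amplitude_differentiable])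
  also have "of_real t * of_real (\<xi> $ k) * ?S x - \<i> * \<dots>
     = (\<Sum>m\<le>length ks. ?w' m * (of_real (\<xi> $ k) * ?a m x))
     + (\<Sum>m\<le>length ks. ?w' (Suc m) * Dk k (amplitude \<xi> ks m) ((1 / t) *\<^sub>R x))"
    using t by (simp add: sum_distrib_left Dk_def sum_negf[symmetric] ac_simps power2_eq_square)
  also have "\<dots> = (\<Sum>m\<le>Suc (length ks). ?w' m * amplitude \<xi> (k # ks) m ((1 / t) *\<^sub>R x))"
  proof -
    \<comment> \<open>The extra top term vanishes by \<open>amplitude_zero\<close>; extending the
      range aligns this sum with the shifted one.\<close>
    have "(\<Sum>m\<le>length ks. ?w' m * (of_real (\<xi> $ k) * ?a m x))
       = (\<Sum>m\<le>Suc (length ks). ?w' m * (of_real (\<xi> $ k) * ?a m x))"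
      by (simp add: amplitude_zero)
    then show ?thesis
      by (simp only: sum.atMost_Suc_shift amplitude.simps distrib_left sum.distrib add.assoc)
  qed
  finally show ?case by simp
qed

text \<open>\<open>smooth\<close> is phrased with \<open>partial\<close>, while the explicit
  expansion is for \<open>Dk\<close>; they differ by powers of the imaginary unit.\<close>

lemma foldr_partial_packet:
  assumes t: "0 < t"
  shows "foldr Dk ks (packet \<xi> t) differentiable (at x)"
    and "foldr partial ks (packet \<xi> t) = (\<lambda>x. \<i> ^ length ks * foldr Dk ks (packet \<xi> t) x)"
proof -
  have d: "foldr Dk ks (packet \<xi> t) differentiable (at x)" for ks x
  proof -
    have a: "(\<lambda>x. amplitude \<xi> ks m ((1 / t) *\<^sub>R x)) differentiable (at x)" for m
      using scale_deriv(1)[of "amplitude \<xi> ks m"] amplitude_differentiable by blast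
    then show ?thesis
      unfolding foldr_Dk_packet[OF t, abs_def]
      by (intro differentiable_mult cis_inner_deriv(1) partial_sum(1) differentiable_const finite_atMost a)
  qed
  then show "foldr Dk ks (packet \<xi> t) differentiable (at x)" .
  show "foldr partial ks (packet \<xi> t) = (\<lambda>x. \<i> ^ length ks * foldr Dk ks (packet \<xi> t) x)"
  proof (induction ks)
    case (Cons k ks)
    have "foldr partial (k # ks) (packet \<xi> t) x = \<i> ^ length ks * partial k (foldr Dk ks (packet \<xi> t)) x" for x
      using Cons by (simp add: partial_cmult[OF d])
    then show ?case
      by (simp add: fun_eq_iff Dk_def[of k] mult.commute[of "\<i>" "\<i> ^ length ks"] mult.assoc)
  qed simp
qed

lemma packet_test_function:
  assumes t: "0 < t" shows "packet \<xi> t \<in> test_functions UNIV"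
proof -
  have "smooth (packet \<xi> t)"
    unfolding smooth_def foldr_partial_packet(2)[OF t]
    by (intro allI differentiable_mult differentiable_const foldr_partial_packet(1) t)
  moreover have "{x. packet \<xi> t x \<noteq> 0} \<subseteq> cball 0 t"
  proof
    fix x assume "x \<in> {x. packet \<xi> t x \<noteq> 0}"
    then have "bump ((1 / t) *\<^sub>R x) \<noteq> 0" by (simp add: packet_def)
    then have "(1 / t) *\<^sub>R x \<in> cball 0 1" using supp_unit_bump unfolding supp_unit_def by blast
    then have "norm x / t \<le> 1" using t by simp
    then show "x \<in> cball 0 t" using t by (simp add: divide_le_eq)
  qed
  then have "bounded {x. packet \<xi> t x \<noteq> 0}" using bounded_cball bounded_subset by blast
  ultimately show ?thesis by (simp add: test_functions_def compact_closure)
qed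

text \<open>In \<open>foldr_Dk_packet\<close> the term \<open>m = 0\<close> is the leading one. For
  \<open>m \<ge> 1\<close> and \<open>t \<ge> 1\<close> the weights are at most
  \<open>t ^ mi_abs \<alpha> / t\<^sup>2\<close>, and all profiles are supported in the unit
  ball.\<close>

lemma Dmulti_packet:
  fixes \<xi> :: "real^'n::finite"
  shows "\<exists>B\<ge>0. \<forall>t\<ge>1. \<forall>x.
    cmod (Dmulti \<alpha> (packet \<xi> t) x - cis ((t *\<^sub>R \<xi>) \<bullet> x) *
       (of_real (t ^ mi_abs \<alpha>) * ((\<Prod>k\<in>UNIV. of_real (\<xi> $ k) ^ \<alpha> k) * bump ((1 / t) *\<^sub>R x))))
      \<le> B * (t ^ mi_abs \<alpha> / t\<^sup>2) * indicator (cball 0 t) x"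
proof -
  let ?ks = "dlist \<alpha>"
  let ?n = "mi_abs \<alpha>"
  have "\<forall>m. \<exists>B\<ge>0. \<forall>y. cmod (amplitude \<xi> ?ks m y) \<le> B * indicator (cball 0 1) y"
    using supp_unit_bounded[OF supp_unit_amplitude] by blast
  then obtain b where b: "\<And>m. 0 \<le> b m" "\<And>m y. cmod (amplitude \<xi> ?ks m y) \<le> b m * indicator (cball 0 1) y"
    by metis
  define B where "B = (\<Sum>m\<in>{1..?n}. b m)"
  have B: "0 \<le> B" unfolding B_def using b by (intro sum_nonneg) auto
  show ?thesis
  proof (intro exI[of _ B] conjI B allI impI)
    fix t :: real and x assume t: "1 \<le> t"
    let ?c = "cis ((t *\<^sub>R \<xi>) \<bullet> x)" and ?y = "(1 / t) *\<^sub>R x"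
    let ?w = "\<lambda>m. complex_of_real (t ^ ?n / t ^ (2 * m))"
    have ind: "indicator (cball 0 1) ?y = (indicator (cball 0 t) x :: real)"
      using t by (auto simp: indicator_def divide_le_eq)
    have "Dmulti \<alpha> (packet \<xi> t) x = ?c * (\<Sum>m\<le>?n. ?w m * amplitude \<xi> ?ks m ?y)"
      using foldr_Dk_packet[of t ?ks \<xi> x] t by (simp add: Dmulti_dlist length_dlist)
    also have "(\<Sum>m\<le>?n. ?w m * amplitude \<xi> ?ks m ?y)
       = ?w 0 * amplitude \<xi> ?ks 0 ?y + (\<Sum>m\<in>{1..?n}. ?w m * amplitude \<xi> ?ks m ?y)"
      by (simp add: atMost_atLeast0 sum.atLeast_Suc_atMost)
    also have "amplitude \<xi> ?ks 0 ?y = (\<Prod>k\<in>UNIV. of_real (\<xi> $ k) ^ \<alpha> k) * bump ?y"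
      by (simp add: amplitude_leading prod_list_dlist)
    finally have "Dmulti \<alpha> (packet \<xi> t) x - ?c * (of_real (t ^ ?n) * ((\<Prod>k\<in>UNIV. of_real (\<xi> $ k) ^ \<alpha> k) * bump ?y))
      = ?c * (\<Sum>m\<in>{1..?n}. ?w m * amplitude \<xi> ?ks m ?y)"
      by (simp add: algebra_simps)
    then have "cmod (Dmulti \<alpha> (packet \<xi> t) x - ?c * (of_real (t ^ ?n) * ((\<Prod>k\<in>UNIV. of_real (\<xi> $ k) ^ \<alpha> k) * bump ?y)))
      = cmod (\<Sum>m\<in>{1..?n}. ?w m * amplitude \<xi> ?ks m ?y)"
      by (simp add: norm_mult)
    also have "\<dots> \<le> (\<Sum>m\<in>{1..?n}. b m * (t ^ ?n / t\<^sup>2) * indicator (cball 0 t) x)"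
    proof (rule order_trans[OF norm_sum sum_mono])
      fix m assume m: "m \<in> {1..?n}"
      have "t ^ 2 \<le> t ^ (2 * m)" using m t by (intro power_increasing) auto
      then have "t ^ ?n / t ^ (2 * m) \<le> t ^ ?n / t\<^sup>2" using t by (intro divide_left_mono) auto
      then have "(t ^ ?n / t ^ (2 * m)) * cmod (amplitude \<xi> ?ks m ?y) \<le> (t ^ ?n / t\<^sup>2) * (b m * indicator (cball 0 1) ?y)"
        using t b by (intro mult_mono) auto
      then show "cmod (?w m * amplitude \<xi> ?ks m ?y) \<le> b m * (t ^ ?n / t\<^sup>2) * indicator (cball 0 t) x"
        using t unfolding ind by (simp add: norm_mult norm_divide norm_power ac_simps)
    qed
    finally show "cmod (Dmulti \<alpha> (packet \<xi> t) x - ?c * (of_real (t ^ ?n) * ((\<Prod>k\<in>UNIV. of_real (\<xi> $ k) ^ \<alpha> k) * bump ?y)))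
      \<le> B * (t ^ ?n / t\<^sup>2) * indicator (cball 0 t) x"
      by (simp only: B_def sum_distrib_right)
  qed
qed

text \<open>Packets live on \<open>cball 0 t\<close> but are bounded below only on the half ball.
  Doubling of volume compares the two norms uniformly in \<open>t\<close>; for
  \<open>p = \<infinity>\<close> positive measure of balls suffices.\<close>

lemma Lp_indicator_ball:
  fixes p :: ennreal and t :: real
  assumes p: "1 \<le> p" and t: "0 < t"
  defines "V \<equiv> \<lambda>r. Lp p (indicator (cball (0 :: real^'n) r) :: real^'n \<Rightarrow> complex)"
  shows "0 < V (t / 2)" "V (t / 2) < \<infinity>" "V t \<le> ennreal (2 ^ DIM(real^'n)) * V (t / 2)"
proof -
  let ?d = "DIM(real^'n)"
  let ?i = "\<lambda>r. indicator (cball (0 :: real^'n) r) :: real^'n \<Rightarrow> complex"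
  define \<mu> where "\<mu> r = unit_ball_vol (real ?d) * r ^ ?d" for r
  have em: "emeasure lborel (cball (0 :: real^'n) r) = ennreal (\<mu> r)" if "0 < r" for r
    using that by (simp add: \<mu>_def emeasure_cball)
  have \<mu>pos: "0 < \<mu> r" if "0 < r" for r using that by (simp add: \<mu>_def)
  have \<mu>2: "\<mu> t = 2 ^ ?d * \<mu> (t / 2)" by (simp add: \<mu>_def power_divide)
  have meas: "?i r \<in> borel_measurable lebesgue" for r
    by (intro borel_lebesgue_measurable borel_measurable_indicator) auto
  have "0 < V (t / 2) \<and> V (t / 2) < \<infinity> \<and> V t \<le> ennreal (2 ^ ?d) * V (t / 2)"
  proof (cases "p = \<infinity>")
    case True
    have le1: "V r \<le> ennreal 1" for r
      unfolding V_def True by (subst Lp_infinity_le_iff[OF meas]) (auto simp: indicator_def)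
    have ge1: "1 \<le> C" if C: "0 \<le> C" "V r \<le> ennreal C" "0 < r" for C r
    proof (rule ccontr)
      assume "\<not> 1 \<le> C"
      have "AE x in lborel. cmod (?i r x) \<le> C"
        using C(2) unfolding V_def True using Lp_infinity_le_iff[OF meas C(1)] by simp
      then have "AE x in lborel. x \<notin> cball (0 :: real^'n) r"
        by eventually_elim (use \<open>\<not> 1 \<le> C\<close> in \<open>auto simp: indicator_def split: if_splits\<close>)
      then have "cball (0 :: real^'n) r \<in> null_sets lborel" by (subst AE_iff_null_sets) auto
      then show False using em[OF C(3)] \<mu>pos[OF C(3)] by (simp add: null_sets_def)
    qed
    have t2: "0 < t / 2" using t by simp
    obtain C where C: "0 \<le> C" "V (t / 2) = ennreal C"
      using le1[of "t / 2"] by (cases "V (t / 2)") (auto simp: top_unique)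
    have "1 \<le> C" using ge1[OF C(1) _ t2] C(2) by simp
    have "1 \<le> 2 ^ ?d * C" using \<open>1 \<le> C\<close> mult_mono[of 1 "2 ^ ?d" 1 C] by simp
    then have "V t \<le> ennreal (2 ^ ?d * C)" using le1[of t] by (meson ennreal_leI order_trans)
    then show ?thesis using C \<open>1 \<le> C\<close> by (simp add: ennreal_mult)
  next
    case False
    let ?P = "enn2real p"
    have P: "1 \<le> ?P" using p False by (rule enn2real_ge_1)
    have I: "(\<integral>\<^sup>+x. ennreal (cmod (?i r x) powr ?P) \<partial>lborel) = ennreal (\<mu> r)" if "0 < r" for r
    proof -
      have "(\<integral>\<^sup>+x. ennreal (cmod (?i r x) powr ?P) \<partial>lborel) = (\<integral>\<^sup>+x. indicator (cball 0 r) x \<partial>(lborel :: (real^'n) measure))"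
        using P by (intro nn_integral_cong) (auto simp: indicator_def)
      then show ?thesis using em[OF that] by simp
    qed
    have iff: "V r \<le> ennreal C \<longleftrightarrow> \<mu> r \<le> C powr ?P" if "0 \<le> C" "0 < r" for r C
      unfolding V_def using Lp_finite_le_iff[OF p False that(1), of "?i r"] I[OF that(2)] by simp
    have t2: "0 < t / 2" using t by simp
    have "V (t / 2) \<le> ennreal (\<mu> (t / 2) powr (1 / ?P))"
      using P \<mu>pos[OF t2] by (subst iff[OF _ t2]) (auto simp: powr_powr)
    then obtain C where C: "0 \<le> C" "V (t / 2) = ennreal C"
      by (cases "V (t / 2)") (auto simp: top_unique)
    have Ci: "\<mu> (t / 2) \<le> C powr ?P" using iff[OF C(1) t2] C(2) by simp
    have "0 < C" using Ci \<mu>pos[OF t2] C(1) by (cases "C = 0") auto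
    have "\<mu> t \<le> 2 ^ ?d * C powr ?P" unfolding \<mu>2 using Ci by (intro mult_left_mono) auto
    \<comment> \<open>Crude but uniform in \<open>p\<close>: the base is at least 1 and so is the
      exponent.\<close>
    also have "\<dots> \<le> (2 ^ ?d) powr ?P * C powr ?P"
      using powr_mono[OF P, of "2 ^ ?d"] by (intro mult_right_mono) auto
    also have "\<dots> = (2 ^ ?d * C) powr ?P" by (simp add: powr_mult)
    finally have "V t \<le> ennreal (2 ^ ?d * C)" using iff[of "2 ^ ?d * C" t] C t by simp
    then show ?thesis using C \<open>0 < C\<close> by (simp add: ennreal_mult)
  qed
  then show "0 < V (t / 2)" "V (t / 2) < \<infinity>" "V t \<le> ennreal (2 ^ DIM(real^'n)) * V (t / 2)" by auto
qed

lemma bump_lower_bound: "norm y \<le> 1 / 2 \<Longrightarrow> exp (- 2) \<le> cmod (bump y)"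
proof -
  assume y: "norm y \<le> 1 / 2"
  then have "(norm y)\<^sup>2 \<le> (1 / 2)\<^sup>2" by (intro power_mono) auto
  then have s: "1 / 2 \<le> 1 - y \<bullet> y" by (simp add: dot_square_norm power2_eq_square)
  then have "1 / (1 - y \<bullet> y) \<le> 2" by (simp add: pos_divide_le_eq)
  then show "exp (- 2) \<le> cmod (bump y)" using s by (simp add: bump_def flat_def)
qed

lemma principal_op_packet:
  fixes \<xi> :: "real^'n::finite"
  shows "\<exists>B\<ge>0. \<forall>t\<ge>1. \<forall>x.
    cmod (principal_op l c (packet \<xi> t) x - cis ((t *\<^sub>R \<xi>) \<bullet> x) *
       (of_real (t ^ l) * (principal_symbol l c \<xi> * bump ((1 / t) *\<^sub>R x))))
      \<le> B * (t ^ l / t\<^sup>2) * indicator (cball 0 t) x"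
proof -
  let ?I = "{\<alpha> :: 'n multiindex. mi_abs \<alpha> = l}"
  let ?X = "\<lambda>\<alpha>. (\<Prod>k\<in>UNIV. complex_of_real (\<xi> $ k) ^ \<alpha> k)"
  have "\<forall>\<alpha>. \<exists>b\<ge>0. \<forall>t\<ge>1. \<forall>x.
    cmod (Dmulti \<alpha> (packet \<xi> t) x - cis ((t *\<^sub>R \<xi>) \<bullet> x) *
       (of_real (t ^ mi_abs \<alpha>) * (?X \<alpha> * bump ((1 / t) *\<^sub>R x))))
      \<le> b * (t ^ mi_abs \<alpha> / t\<^sup>2) * indicator (cball 0 t) x"
    by (intro allI) (rule Dmulti_packet)
  from choice[OF this] obtain b where b: "\<forall>\<alpha>. 0 \<le> b \<alpha> \<and> (\<forall>t\<ge>1. \<forall>x.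
    cmod (Dmulti \<alpha> (packet \<xi> t) x - cis ((t *\<^sub>R \<xi>) \<bullet> x) *
       (of_real (t ^ mi_abs \<alpha>) * (?X \<alpha> * bump ((1 / t) *\<^sub>R x))))
      \<le> b \<alpha> * (t ^ mi_abs \<alpha> / t\<^sup>2) * indicator (cball 0 t) x)"
    by (elim exE)
  define B where "B = (\<Sum>\<alpha>\<in>?I. cmod (c \<alpha>) * b \<alpha>)"
  have B: "0 \<le> B" unfolding B_def using b by (intro sum_nonneg) auto
  show ?thesis
  proof (intro exI[of _ B] conjI B allI impI)
    fix t :: real and x assume t: "1 \<le> t"
    let ?m = "cis ((t *\<^sub>R \<xi>) \<bullet> x)" and ?y = "(1 / t) *\<^sub>R x"
    have "principal_op l c (packet \<xi> t) x - ?m * (of_real (t ^ l) * (principal_symbol l c \<xi> * bump ?y))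
      = (\<Sum>\<alpha>\<in>?I. c \<alpha> * (Dmulti \<alpha> (packet \<xi> t) x - ?m * (of_real (t ^ l) * (?X \<alpha> * bump ?y))))"
      by (simp add: principal_op_def principal_symbol_def sum_distrib_left sum_distrib_right
          right_diff_distrib sum_subtractf ac_simps)
    also have "cmod \<dots> \<le> (\<Sum>\<alpha>\<in>?I. cmod (c \<alpha>) * b \<alpha> * (t ^ l / t\<^sup>2) * indicator (cball 0 t) x)"
    proof (rule order_trans[OF norm_sum sum_mono])
      fix \<alpha> assume "\<alpha> \<in> ?I"
      then show "cmod (c \<alpha> * (Dmulti \<alpha> (packet \<xi> t) x - ?m * (of_real (t ^ l) * (?X \<alpha> * bump ?y))))
        \<le> cmod (c \<alpha>) * b \<alpha> * (t ^ l / t\<^sup>2) * indicator (cball 0 t) x"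
        using mult_left_mono[OF b[rule_format, THEN conjunct2, rule_format, OF t, of \<alpha> x], of "cmod (c \<alpha>)"] by (simp add: norm_mult mult.assoc)
    qed
    finally show "cmod (principal_op l c (packet \<xi> t) x - ?m * (of_real (t ^ l) * (principal_symbol l c \<xi> * bump ?y)))
      \<le> B * (t ^ l / t\<^sup>2) * indicator (cball 0 t) x"
      by (simp only: B_def sum_distrib_right)
  qed
qed

lemma const_Linf: "(\<lambda>x. c) \<in> Linf UNIV"
proof -
  have m: "(\<lambda>x::real^'a. c) \<in> borel_measurable lebesgue" by simp
  have "Lp \<infinity> (\<lambda>x::real^'a. c) \<le> ennreal (cmod c)" by (subst Lp_infinity_le_iff[OF m]) auto
  then show ?thesis using m by (simp add: Linf_def lebesgue_on_UNIV_eq order_le_less_trans)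
qed

text \<open>At a common zero \<open>\<xi>\<close> of the principal symbols the principal parts only produce
  \<open>O(t\<^bsup>l-2\<^esup>)\<close> on packets of frequency \<open>t \<xi>\<close> and width \<open>t\<close>, whereas \<open>D\<^sub>k\<^bsup>l-1\<^esup>\<close> produces
  \<open>t\<^bsup>l-1\<^esup>\<close>. Hence adding \<open>D\<^sub>k\<^bsup>l-1\<^esup>\<close> to one of the operators changes the space.\<close>

lemma principal_type_imp_elliptic:
  fixes a :: "nat \<Rightarrow> 'n::finite coeffs"
  assumes l: "2 \<le> l" and N: "1 \<le> N" and p: "1 \<le> p"
    and pr: "\<forall>j\<in>{1..N}. \<forall>\<alpha>. mi_abs \<alpha> = l \<longrightarrow> (AE x in lebesgue. a j \<alpha> x = c j \<alpha>)"
    and pt: "principal_type p UNIV l N a"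
  shows "elliptic l N c"
proof (rule ccontr)
  assume "\<not> elliptic l N c"
  then obtain \<xi> :: "real^'n" where \<xi>: "\<xi> \<noteq> 0" "\<And>j. j \<in> {1..N} \<Longrightarrow> principal_symbol l (c j) \<xi> = 0"
    by (auto simp: elliptic_def)
  obtain k where k: "\<xi> $ k \<noteq> 0" using \<xi>(1) by (auto simp: vec_eq_iff)
  define \<gamma> where "\<gamma> i = (if i = k then l - 1 else 0)" for i
  have mg: "mi_abs \<gamma> = l - 1" by (simp add: mi_abs_def \<gamma>_def)
  have X\<gamma>: "(\<Prod>i\<in>UNIV. complex_of_real (\<xi> $ i) ^ \<gamma> i) = of_real (\<xi> $ k) ^ (l - 1)"
  proof -
    have "(\<Prod>i\<in>UNIV. complex_of_real (\<xi> $ i) ^ \<gamma> i) = (\<Prod>i\<in>UNIV. if i = k then of_real (\<xi> $ i) ^ (l - 1) else 1)"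
      by (intro prod.cong) (auto simp: \<gamma>_def)
    then show ?thesis by (simp add: prod.delta)
  qed
  \<comment> \<open>Two systems with the principal part of \<open>a\<close>: \<open>r 0\<close> has
    no lower order terms, and \<open>r 1\<close> adds the perturbation to the first operator. They
    are compared with each other, since the lower order terms of \<open>a\<close> are
    arbitrary.\<close>
  define r where "r s j \<alpha> = (\<lambda>x::real^'n. if mi_abs \<alpha> = l then c j \<alpha> else if j = 1 \<and> \<alpha> = \<gamma> then s else 0)"
    for s :: complex and j \<alpha>
  have ord: "order_le l (r s j)" for s j using mg by (auto simp: order_le_def r_def)
  have "Linf_system UNIV l N (r s)" for s
    using ord unfolding Linf_system_def r_def by (auto intro: const_Linf)
  moreover have "same_principal_part UNIV l N a (r s)" for s
    using pr unfolding same_principal_part_def lebesgue_on_UNIV_eq r_def by auto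
  ultimately have "L0 p UNIV N a = L0 p UNIV N (r s)" for s
    using pt unfolding principal_type_def by blast
  then have L0: "L0 p UNIV N (r 1) = L0 p UNIV N (r 0)" by metis
  have op: "diff_op (r s j) f x = principal_op l (c j) f x + (if j = 1 then s * Dmulti \<gamma> f x else 0)" for s j f x
  proof -
    have "diff_op (r s j) f x = (\<Sum>\<alpha> | mi_abs \<alpha> \<le> l. (if mi_abs \<alpha> = l then c j \<alpha> * Dmulti \<alpha> f x else 0)
        + (if \<alpha> = \<gamma> then (if j = 1 then s * Dmulti \<gamma> f x else 0) else 0))"
      unfolding diff_op_order_le[OF ord] using mg l by (intro sum.cong) (auto simp: r_def)
    also have "\<dots> = (\<Sum>\<alpha> | mi_abs \<alpha> \<le> l. if mi_abs \<alpha> = l then c j \<alpha> * Dmulti \<alpha> f x else 0)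
        + (if j = 1 then s * Dmulti \<gamma> f x else 0)"
    proof -
      have "\<gamma> \<in> {\<alpha>. mi_abs \<alpha> \<le> l}" using mg by simp
      then show ?thesis unfolding sum.distrib sum.delta[OF finite_mi] by simp
    qed
    also have "(\<Sum>\<alpha> | mi_abs \<alpha> \<le> l. if mi_abs \<alpha> = l then c j \<alpha> * Dmulti \<alpha> f x else 0) = principal_op l (c j) f x"
      unfolding principal_op_def by (rule sum.mono_neutral_cong_right) (auto simp: finite_mi)
    finally show ?thesis .
  qed
  \<comment> \<open>A member of a system trivially lies in the space of that system; equality of the
    spaces then forces an estimate by the pure principal parts.\<close>
  have "r 1 1 \<in> L0 p UNIV N (r 1)"
  proof -
    have "Lp p (diff_op (r 1 1) f) \<le> ennreal 1 * (\<Sum>j\<in>{1..N}. Lp p (diff_op (r 1 j) f)) + ennreal 0 * Lp p f" for f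
      using N member_le_sum[of 1 "{1..N}" "\<lambda>j. Lp p (diff_op (r 1 j) f)"] by simp
    moreover have "r 1 1 \<alpha> \<in> borel_measurable (lebesgue_on UNIV)" for \<alpha> by (simp add: r_def)
    ultimately show ?thesis using ord[of 1 1] unfolding L0_def by blast
  qed
  then have "r 1 1 \<in> L0 p UNIV N (r 0)" by (simp only: L0)
  then obtain C1 C2 where C: "\<And>f. f \<in> test_functions UNIV \<Longrightarrow>
      Lp p (diff_op (r 1 1) f) \<le> ennreal C1 * (\<Sum>j\<in>{1..N}. Lp p (diff_op (r 0 j) f)) + ennreal C2 * Lp p f"
    unfolding L0_def by auto
  have "\<forall>j. \<exists>b\<ge>0. \<forall>t\<ge>1. \<forall>x.
    cmod (principal_op l (c j) (packet \<xi> t) x - cis ((t *\<^sub>R \<xi>) \<bullet> x) *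
       (of_real (t ^ l) * (principal_symbol l (c j) \<xi> * bump ((1 / t) *\<^sub>R x))))
      \<le> b * (t ^ l / t\<^sup>2) * indicator (cball 0 t) x"
    by (intro allI) (rule principal_op_packet)
  from choice[OF this] obtain b where "\<forall>j. 0 \<le> b j \<and> (\<forall>t\<ge>1. \<forall>x.
    cmod (principal_op l (c j) (packet \<xi> t) x - cis ((t *\<^sub>R \<xi>) \<bullet> x) *
       (of_real (t ^ l) * (principal_symbol l (c j) \<xi> * bump ((1 / t) *\<^sub>R x))))
      \<le> b j * (t ^ l / t\<^sup>2) * indicator (cball 0 t) x)"
    by (elim exE)
  then have b: "\<And>j. 0 \<le> b j" "\<And>j t x. 1 \<le> t \<Longrightarrow>
    cmod (principal_op l (c j) (packet \<xi> t) x - cis ((t *\<^sub>R \<xi>) \<bullet> x) *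
       (of_real (t ^ l) * (principal_symbol l (c j) \<xi> * bump ((1 / t) *\<^sub>R x))))
      \<le> b j * (t ^ l / t\<^sup>2) * indicator (cball 0 t) x"
    by blast+
  \<comment> \<open>The leading term of \<open>principal_op_packet\<close> drops out because \<xi>
    is a common zero of the symbols.\<close>
  have b': "cmod (principal_op l (c j) (packet \<xi> t) x) \<le> b j * t ^ (l - 2) * indicator (cball 0 t) x"
    if "j \<in> {1..N}" "1 \<le> t" for j t x
    using b(2)[OF that(2), of j x] \<xi>(2)[OF that(1)] that(2) l by (simp add: power_diff)
  obtain e where e: "0 \<le> e" "\<And>t x. 1 \<le> t \<Longrightarrow>
    cmod (Dmulti \<gamma> (packet \<xi> t) x - cis ((t *\<^sub>R \<xi>) \<bullet> x) *
       (of_real (t ^ (l - 1)) * (of_real (\<xi> $ k) ^ (l - 1) * bump ((1 / t) *\<^sub>R x))))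
      \<le> e * (t ^ (l - 1) / t\<^sup>2) * indicator (cball 0 t) x"
    using Dmulti_packet[of \<gamma> \<xi>] unfolding mg X\<gamma> by blast
  obtain h where h: "0 \<le> h" "\<And>y::real^'n. cmod (bump y) \<le> h * indicator (cball 0 1) y"
    using supp_unit_bounded[OF supp_unit_bump] by blast
  \<comment> \<open>Lower bound, per factor \<open>t ^ (l - 1)\<close>, for the leading term of the
    perturbation on the half ball; \<open>exp (- 2)\<close> is from
    \<open>bump_lower_bound\<close>.\<close>
  define q where "q = \<bar>\<xi> $ k\<bar> ^ (l - 1) * exp (- 2)"
  have q: "0 < q" using k by (simp add: q_def)
  define b0 where "b0 = (\<Sum>j\<in>{1..N}. b j)"
  have b0: "0 \<le> b0" "b 1 \<le> b0" unfolding b0_def using b(1) N by (auto intro: sum_nonneg member_le_sum)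
  define K :: real where "K = 2 ^ DIM(real^'n)"
  have K: "0 < K" by (simp add: K_def)
  define Z where "Z = K * (max C1 0 * b0 + max C2 0 * h)"
  have Z: "0 \<le> Z" using K b0 h by (simp add: Z_def)
  \<comment> \<open>Large enough that the errors eat at most half of the leading term
    (\<open>t1\<close>), while that half still exceeds the right-hand side
    (\<open>t2\<close>).\<close>
  define t where "t = 1 + 2 * (e + b 1) / q + 2 * Z / q"
  have tq: "0 \<le> 2 * (e + b 1) / q" "0 \<le> 2 * Z / q" using e b(1) Z q by auto
  have t: "1 \<le> t" using tq by (simp add: t_def)
  have t1: "e + b 1 \<le> q / 2 * t"
  proof -
    have "2 * (e + b 1) / q \<le> t" using tq by (simp add: t_def)
    then show ?thesis using q by (simp add: divide_le_eq algebra_simps)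
  qed
  have t2: "Z < q / 2 * t"
  proof -
    have "2 * Z / q < t" using tq by (simp add: t_def)
    then show ?thesis using q by (simp add: divide_less_eq algebra_simps)
  qed
  let ?f = "packet \<xi> t"
  have tf: "?f \<in> test_functions UNIV" using t by (intro packet_test_function) simp
  let ?i = "\<lambda>r. indicator (cball (0 :: real^'n) r) :: real^'n \<Rightarrow> complex"
  have im: "?i r \<in> borel_measurable lebesgue" for r
    by (intro borel_lebesgue_measurable borel_measurable_indicator) auto
  have sf: "schwartz ?f" using tf by (rule test_function_schwartz)
  have pm: "principal_op l (c j) ?f \<in> borel_measurable lebesgue" for j
    by (rule continuous_lebesgue_measurable[OF schwartz_continuous[OF schwartz_principal_op[OF sf]]])
  have Dm: "Dmulti \<gamma> ?f \<in> borel_measurable lebesgue"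
    by (rule continuous_lebesgue_measurable[OF schwartz_continuous[OF schwartz_Dmulti[OF sf]]])
  have fm: "?f \<in> borel_measurable lebesgue"
    by (rule continuous_lebesgue_measurable[OF schwartz_continuous[OF sf]])
  have op0: "diff_op (r 0 j) ?f = principal_op l (c j) ?f" for j by (auto simp: op)
  have op1: "diff_op (r 1 1) ?f = (\<lambda>x. principal_op l (c 1) ?f x + Dmulti \<gamma> ?f x)" by (auto simp: op)
  have lt: "t ^ (l - 1) = t * t ^ (l - 2)" using l by (metis One_nat_def Suc_1 Suc_diff_le diff_Suc_Suc power_Suc)
  define V where "V s = Lp p (?i s)" for s
  have Vb: "0 < V (t / 2)" "V (t / 2) < \<infinity>" "V t \<le> ennreal K * V (t / 2)"
    unfolding V_def K_def using Lp_indicator_ball[OF p, of t, where 'n='n] t by auto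
  \<comment> \<open>Reverse triangle inequality: the packet error of the perturbation and the first
    principal part are both of order \<open>t ^ (l - 2)\<close>.\<close>
  have lower: "q / 2 * t ^ (l - 1) * cmod (?i (t / 2) x) \<le> cmod (diff_op (r 1 1) ?f x)" for x
  proof (cases "x \<in> cball 0 (t / 2)")
    case True
    then have xt: "x \<in> cball 0 t" using t by auto
    have "norm ((1 / t) *\<^sub>R x) \<le> 1 / 2" using True t by (simp add: divide_le_eq)
    then have bl: "exp (- 2) \<le> cmod (bump ((1 / t) *\<^sub>R x))" by (rule bump_lower_bound)
    let ?M = "cis ((t *\<^sub>R \<xi>) \<bullet> x) * (of_real (t ^ (l - 1)) * (of_real (\<xi> $ k) ^ (l - 1) * bump ((1 / t) *\<^sub>R x)))"
    have "t ^ (l - 1) * q \<le> cmod ?M"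
      using mult_left_mono[OF bl, of "t ^ (l - 1) * \<bar>\<xi> $ k\<bar> ^ (l - 1)"] t
      by (simp add: q_def norm_mult norm_power mult.assoc)
    moreover have "cmod (Dmulti \<gamma> ?f x - ?M) \<le> e * t ^ (l - 2)"
    proof -
      have "t ^ (l - 1) / t\<^sup>2 \<le> t ^ (l - 2)"
        unfolding lt using t by (simp add: divide_le_eq power2_eq_square mult_left_mono)
      then have "e * (t ^ (l - 1) / t\<^sup>2) \<le> e * t ^ (l - 2)" using e(1) by (rule mult_left_mono)
      then show ?thesis using e(2)[OF t, of x] xt by simp
    qed
    moreover have "cmod (principal_op l (c 1) ?f x) \<le> b 1 * t ^ (l - 2)"
      using b'[of 1 t x] N t xt by simp
    moreover have "cmod ?M \<le> cmod (Dmulti \<gamma> ?f x - ?M) + cmod (principal_op l (c 1) ?f x)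
        + cmod (principal_op l (c 1) ?f x + Dmulti \<gamma> ?f x)"
    proof -
      have "?M = (principal_op l (c 1) ?f x + Dmulti \<gamma> ?f x) - (Dmulti \<gamma> ?f x - ?M) - principal_op l (c 1) ?f x"
        by simp
      then show ?thesis
        by (smt (verit) norm_triangle_ineq4)
    qed
    moreover have "(e + b 1) * t ^ (l - 2) \<le> q / 2 * t ^ (l - 1)"
    proof -
      have "0 \<le> t ^ (l - 2)" using t by simp
      from mult_right_mono[OF t1 this] show ?thesis unfolding lt by (simp only: mult.assoc)
    qed
    ultimately have "q / 2 * t ^ (l - 1) \<le> cmod (principal_op l (c 1) ?f x + Dmulti \<gamma> ?f x)"
      by (simp add: algebra_simps)
    then show ?thesis unfolding op1 using True by simp
  qed simp
  have "ennreal (q / 2 * t ^ (l - 1)) * V (t / 2) \<le> Lp p (diff_op (r 1 1) ?f)"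
  proof -
    let ?s = "complex_of_real (q / 2 * t ^ (l - 1))"
    have pos: "0 < q / 2 * t ^ (l - 1)" using q t by simp
    have sm: "(\<lambda>x. ?s * ?i (t / 2) x) \<in> borel_measurable lebesgue" using im by measurable
    have dm: "diff_op (r 1 1) ?f \<in> borel_measurable lebesgue" unfolding op1 using pm Dm by measurable
    have "Lp p (?i (t / 2)) \<le> ennreal (1 / (q / 2 * t ^ (l - 1))) * Lp p (diff_op (r 1 1) ?f)"
      using lower pos by (intro Lp_dominated[OF p dm im]) (auto simp: pos_le_divide_eq mult.commute)
    then have "ennreal (q / 2 * t ^ (l - 1)) * V (t / 2)
      \<le> ennreal (q / 2 * t ^ (l - 1)) * (ennreal (1 / (q / 2 * t ^ (l - 1))) * Lp p (diff_op (r 1 1) ?f))"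
      unfolding V_def by (rule mult_left_mono) simp
    also have "\<dots> = ennreal (q / 2 * t ^ (l - 1) * (1 / (q / 2 * t ^ (l - 1)))) * Lp p (diff_op (r 1 1) ?f)"
      using pos by (subst ennreal_mult) (auto simp: mult.assoc)
    also have "q / 2 * t ^ (l - 1) * (1 / (q / 2 * t ^ (l - 1))) = 1" using q t by simp
    finally show ?thesis by simp
  qed
  also have "\<dots> \<le> ennreal (max C1 0) * (\<Sum>j\<in>{1..N}. Lp p (diff_op (r 0 j) ?f)) + ennreal (max C2 0) * Lp p ?f"
    using C[OF tf] by (rule order_trans) (auto intro!: add_mono mult_right_mono ennreal_leI)
  also have "\<dots> \<le> ennreal (max C1 0) * (ennreal (b0 * t ^ (l - 2)) * V t) + ennreal (max C2 0) * (ennreal (h * t ^ (l - 2)) * V t)"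
  proof (intro add_mono mult_left_mono)
    have "(\<Sum>j\<in>{1..N}. Lp p (diff_op (r 0 j) ?f)) \<le> (\<Sum>j\<in>{1..N}. ennreal (b j * t ^ (l - 2)) * V t)"
      unfolding op0 V_def
    proof (rule sum_mono)
      fix j assume j: "j \<in> {1..N}"
      show "Lp p (principal_op l (c j) ?f) \<le> ennreal (b j * t ^ (l - 2)) * Lp p (?i t)"
      proof (intro Lp_dominated[OF p im pm] AE_I2)
        show "cmod (principal_op l (c j) ?f x) \<le> b j * t ^ (l - 2) * cmod (?i t x)" for x
          using b'[OF j t, of x] by (auto simp: indicator_def split: if_splits)
      qed (use b(1)[of j] t in simp)
    qed
    also have "\<dots> = ennreal (b0 * t ^ (l - 2)) * V t"
      using b(1) t by (simp add: sum_distrib_right[symmetric] sum_ennreal b0_def)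
    finally show "(\<Sum>j\<in>{1..N}. Lp p (diff_op (r 0 j) ?f)) \<le> ennreal (b0 * t ^ (l - 2)) * V t" .
    have "cmod (?f x) \<le> h * t ^ (l - 2) * cmod (?i t x)" for x
    proof -
      \<comment> \<open>The packet itself is only bounded; the power is inserted so that the term
        with \<open>C2\<close> has the same order as the principal parts.\<close>
      have "1 \<le> t ^ (l - 2)" using t by simp
      then have "h * 1 \<le> h * t ^ (l - 2)" using h(1) by (intro mult_left_mono) auto
      moreover have "cmod (?f x) \<le> h * indicator (cball 0 t) x"
        using h(2)[of "(1 / t) *\<^sub>R x"] t by (simp add: packet_def norm_mult indicator_def divide_le_eq split: if_splits)
      ultimately show ?thesis by (auto simp: indicator_def split: if_splits)
    qed
    then show "Lp p ?f \<le> ennreal (h * t ^ (l - 2)) * V t"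
      unfolding V_def using h(1) t by (intro Lp_dominated[OF p im fm]) auto
  qed simp_all
  also have "\<dots> = ennreal ((max C1 0 * b0 + max C2 0 * h) * t ^ (l - 2)) * V t"
  proof -
    have "ennreal (max C1 0) * (ennreal (b0 * t ^ (l - 2)) * V t) = ennreal (max C1 0 * b0 * t ^ (l - 2)) * V t"
      using b0 t by (simp only: mult.assoc[symmetric]) (subst ennreal_mult[symmetric], auto simp: mult.assoc)
    moreover have "ennreal (max C2 0) * (ennreal (h * t ^ (l - 2)) * V t) = ennreal (max C2 0 * h * t ^ (l - 2)) * V t"
      using h t by (simp only: mult.assoc[symmetric]) (subst ennreal_mult[symmetric], auto simp: mult.assoc)
    ultimately show ?thesis
      using b0 h t by (simp add: distrib_right ennreal_plus)
  qed
  also have "\<dots> \<le> ennreal ((max C1 0 * b0 + max C2 0 * h) * t ^ (l - 2)) * (ennreal K * V (t / 2))"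
    by (rule mult_left_mono[OF Vb(3)]) simp
  also have "\<dots> = ennreal (Z * t ^ (l - 2)) * V (t / 2)"
    using b0 h t K by (simp add: Z_def ennreal_mult ac_simps)
  finally have final: "ennreal (q / 2 * t ^ (l - 1)) * V (t / 2) \<le> ennreal (Z * t ^ (l - 2)) * V (t / 2)" .
  \<comment> \<open>A positive finite norm can be cancelled, leaving
    \<open>q / 2 * t \<le> Z\<close> after division by \<open>t ^ (l - 2)\<close>.\<close>
  obtain v where v: "0 < v" "V (t / 2) = ennreal v" using Vb(1,2) by (cases "V (t / 2)") auto
  have "q / 2 * t ^ (l - 1) * v \<le> Z * t ^ (l - 2) * v"
    using final v q t Z by (simp add: ennreal_mult[symmetric] ennreal_le_iff)
  then have "q / 2 * t ^ (l - 1) \<le> Z * t ^ (l - 2)" using v(1) by (rule mult_right_le_imp_le)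
  then have "q / 2 * t * t ^ (l - 2) \<le> Z * t ^ (l - 2)" unfolding lt by (simp only: mult.assoc)
  then have "q / 2 * t \<le> Z" using t by (simp add: mult_le_cancel_right)
  then show False using t2 by simp
qed

theorem proposition3p10:
  fixes a :: "nat \<Rightarrow> 'n::finite multiindex \<Rightarrow> real^'n \<Rightarrow> complex"
    and c :: "nat \<Rightarrow> 'n multiindex \<Rightarrow> complex"
    and l N :: nat
    and p :: ennreal
  assumes "2 \<le> l" and "1 \<le> N"
    and "Linf_system UNIV l N a"
    and "\<forall>j\<in>{1..N}. \<forall>\<alpha>. mi_abs \<alpha> = l \<longrightarrow> (AE x in lebesgue. a j \<alpha> x = c j \<alpha>)"
    and "1 < p \<or>
         1 \<le> p \<and> (\<forall>j\<in>{1..N}. \<forall>\<alpha>. \<exists>b. AE x in lebesgue. a j \<alpha> x = b)"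
  shows "elliptic l N c \<longleftrightarrow> principal_type p UNIV l N a"
proof
  have p: "1 \<le> p" using assms(5) by auto
  show "elliptic l N c" if "principal_type p UNIV l N a"
    using principal_type_imp_elliptic[OF assms(1,2) p assms(4) that] .
  show "principal_type p UNIV l N a" if ell: "elliptic l N c"
    unfolding principal_type_def
  proof (intro allI impI, elim conjE)
    fix r :: "nat \<Rightarrow> 'n coeffs" assume r: "Linf_system UNIV l N r" and same: "same_principal_part UNIV l N a r"
    have l: "1 \<le> l" using assms(1) by simp
    have pr: "\<forall>j\<in>{1..N}. \<forall>\<alpha>. mi_abs \<alpha> = l \<longrightarrow> (AE x in lebesgue. r j \<alpha> x = c j \<alpha>)"
    proof (intro ballI allI impI)
      fix j and \<alpha> :: "'n multiindex" assume j: "j \<in> {1..N}" and \<alpha>: "mi_abs \<alpha> = l"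
      have "AE x in lebesgue. a j \<alpha> x = r j \<alpha> x"
        using same[unfolded same_principal_part_def lebesgue_on_UNIV_eq] j \<alpha> by blast
      moreover have "AE x in lebesgue. a j \<alpha> x = c j \<alpha>" using assms(4) j \<alpha> by blast
      ultimately show "AE x in lebesgue. r j \<alpha> x = c j \<alpha>" by eventually_elim simp
    qed
    show "L0 p UNIV N a = L0 p UNIV N r"
      using elliptic_imp_L0_subset[OF ell l p assms(3) r assms(4) pr]
        elliptic_imp_L0_subset[OF ell l p r assms(3) pr assms(4)] by blast
  qed
qed

end
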